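(* Let $m$ be a prime-power, $n$ a positive integer, $v$ a multilinear commutator word and $w=v^m$. Let $\mathcal V(m,n,v)$ be the class of all groups $G$ in which every $w$-value is $n$-Engel in $G$ and the verbal subgroup $v(G)$ has an ascending normal series each of whose quotients is either locally soluble or locally finite. Then $\mathcal V(m,n,v)$ is precisely the class of all groups $G$ in which every $w$-value is $n$-Engel in $G$ and the verbal subgroup $v(G)$ is (locally nilpotent)-by-(locally finite).
   Context: A multilinear commutator word of weight $s$ is a word having the form of a multilinear Lie monomial in exactly $s$ independent variables: a single variable is one of weight $1$, and for $s\ge 2$ it is $[\alpha,\beta]$ with $\alpha,\beta$ multilinear commutator words in disjoint sets of variables whose weights sum to $s$. Here $[x,y]=x^{-1}y^{-1}xy$. For a word $w$, a $w$-value in $G$ is an element obtained by substituting elements of $G$ for the variables of $w$, and $w(G)$ is the subgroup generated by all $w$-values in $G$. An element $x\in G$ is (left) $n$-Engel if $[g,_n x]=1$ for all $g\in G$, where $[g,_0x]=g$ and $[g,_ix]=[[g,_{i-1}x],x]$. A group locally has a property if all its finitely generated subgroups have it. A group is (locally nilpotent)-by-(locally finite) if it has a locally nilpotent normal subgroup with locally finite quotient. An ascending normal series of a group $K$ is a chain $(K_\alpha)_{\alpha\le\beta}$ of normal subgroups of $K$ indexed by ordinals, with $K_0=1$, $K_\beta=K$, $K_\alpha\le K_{\alpha+1}$, and $K_\lambda=\bigcup_{\alpha<\lambda}K_\alpha$ for limit ordinals $\lambda\le\beta$; its quotients are the groups $K_{\alpha+1}/K_\alpha$. *)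

theory Defs
  imports "HOL-Algebra.Solvable_Groups" "HOL-Number_Theory.Prime_Powers"
begin

section \<open>Group words and verbal subgroups\<close>

datatype group_word =
    Var nat
  | One
  | Inv group_word
  | Mul group_word group_word

definition comm_word :: "group_word \<Rightarrow> group_word \<Rightarrow> group_word" where
  "comm_word x y = Mul (Mul (Mul (Inv x) (Inv y)) x) y"

primrec pow_word :: "group_word \<Rightarrow> nat \<Rightarrow> group_word" where
  "pow_word w 0 = One"
| "pow_word w (Suc k) = Mul (pow_word w k) w"

primrec word_vars :: "group_word \<Rightarrow> nat set" where
  "word_vars (Var i) = {i}"
| "word_vars One = {}"
| "word_vars (Inv x) = word_vars x"
| "word_vars (Mul x y) = word_vars x \<union> word_vars y"

inductive multilinear_commutator_word :: "nat \<Rightarrow> group_word \<Rightarrow> bool" where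
  "multilinear_commutator_word 1 (Var i)"
| "multilinear_commutator_word s x \<Longrightarrow> multilinear_commutator_word t y \<Longrightarrow>
     word_vars x \<inter> word_vars y = {} \<Longrightarrow>
     multilinear_commutator_word (s + t) (comm_word x y)"

primrec word_eval :: "('a, 'b) monoid_scheme \<Rightarrow> (nat \<Rightarrow> 'a) \<Rightarrow> group_word \<Rightarrow> 'a" where
  "word_eval G f (Var i) = f i"
| "word_eval G f One = \<one>\<^bsub>G\<^esub>"
| "word_eval G f (Inv x) = inv\<^bsub>G\<^esub> (word_eval G f x)"
| "word_eval G f (Mul x y) = word_eval G f x \<otimes>\<^bsub>G\<^esub> word_eval G f y"

definition word_values :: "('a, 'b) monoid_scheme \<Rightarrow> group_word \<Rightarrow> 'a set" where
  "word_values G w = {word_eval G f w | f. \<forall>i. f i \<in> carrier G}"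

definition verbal_subgroup :: "('a, 'b) monoid_scheme \<Rightarrow> group_word \<Rightarrow> 'a set" where
  "verbal_subgroup G w = generate G (word_values G w)"


section \<open>Engel elements and nilpotency\<close>

text \<open>The convention \<open>[x, y] = x\<^sup>-\<^sup>1 y\<^sup>-\<^sup>1 x y\<close> differs from the one used in
  \<open>derived_set\<close>.\<close>

definition group_comm :: "('a, 'b) monoid_scheme \<Rightarrow> 'a \<Rightarrow> 'a \<Rightarrow> 'a" where
  "group_comm G x y = inv\<^bsub>G\<^esub> x \<otimes>\<^bsub>G\<^esub> inv\<^bsub>G\<^esub> y \<otimes>\<^bsub>G\<^esub> x \<otimes>\<^bsub>G\<^esub> y"

primrec iter_comm :: "('a, 'b) monoid_scheme \<Rightarrow> 'a \<Rightarrow> nat \<Rightarrow> 'a \<Rightarrow> 'a" where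
  "iter_comm G g 0 x = g"
| "iter_comm G g (Suc i) x = group_comm G (iter_comm G g i x) x"

definition engel_element :: "('a, 'b) monoid_scheme \<Rightarrow> nat \<Rightarrow> 'a \<Rightarrow> bool" where
  "engel_element G n x \<longleftrightarrow> x \<in> carrier G \<and> (\<forall>g\<in>carrier G. iter_comm G g n x = \<one>\<^bsub>G\<^esub>)"

primrec lower_central :: "('a, 'b) monoid_scheme \<Rightarrow> nat \<Rightarrow> 'a set" where
  "lower_central G 0 = carrier G"
| "lower_central G (Suc i) =
     generate G {group_comm G x y | x y. x \<in> lower_central G i \<and> y \<in> carrier G}"

definition nilpotent :: "('a, 'b) monoid_scheme \<Rightarrow> bool" where
  "nilpotent G \<longleftrightarrow> (\<exists>c. lower_central G c = {\<one>\<^bsub>G\<^esub>})"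


section \<open>Local properties\<close>

definition locally_has :: "('a monoid \<Rightarrow> bool) \<Rightarrow> 'a monoid \<Rightarrow> bool" where
  "locally_has P G \<longleftrightarrow>
     (\<forall>S. finite S \<and> S \<subseteq> carrier G \<longrightarrow> P (G\<lparr>carrier := generate G S\<rparr>))"

definition locally_nilpotent :: "'a monoid \<Rightarrow> bool" where
  "locally_nilpotent = locally_has nilpotent"

definition locally_soluble :: "'a monoid \<Rightarrow> bool" where
  "locally_soluble = locally_has solvable"

definition locally_finite :: "'a monoid \<Rightarrow> bool" where
  "locally_finite = locally_has (\<lambda>H. finite (carrier H))"

definition locally_nilpotent_by_locally_finite :: "'a monoid \<Rightarrow> bool" where
  "locally_nilpotent_by_locally_finite G \<longleftrightarrow>
     (\<exists>N. N \<lhd> G \<and> locally_nilpotent (G\<lparr>carrier := N\<rparr>) \<and> locally_finite (G Mod N))"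


section \<open>Ascending normal series\<close>

definition covers :: "'i rel \<Rightarrow> 'i \<Rightarrow> 'i \<Rightarrow> bool" where
  "covers r i j \<longleftrightarrow>
     (i, j) \<in> r \<and> i \<noteq> j \<and> (\<forall>k. (i, k) \<in> r \<and> (k, j) \<in> r \<longrightarrow> k = i \<or> k = j)"

definition least_in :: "'i rel \<Rightarrow> 'i \<Rightarrow> bool" where
  "least_in r i \<longleftrightarrow> i \<in> Field r \<and> (\<forall>j\<in>Field r. (i, j) \<in> r)"

definition greatest_in :: "'i rel \<Rightarrow> 'i \<Rightarrow> bool" where
  "greatest_in r i \<longleftrightarrow> i \<in> Field r \<and> (\<forall>j\<in>Field r. (j, i) \<in> r)"

definition limit_in :: "'i rel \<Rightarrow> 'i \<Rightarrow> bool" where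
  "limit_in r i \<longleftrightarrow> i \<in> Field r \<and> \<not> least_in r i \<and> (\<nexists>j. covers r j i)"

text \<open>The ordinals \<open>\<alpha> \<le> \<beta>\<close> are represented by a well-order \<open>r\<close> with a greatest
  element; its least element plays the role of \<open>0\<close> and \<open>covers r i j\<close> says that
  \<open>j\<close> is the successor of \<open>i\<close>.\<close>

definition ascending_normal_series ::
    "('a set monoid \<Rightarrow> bool) \<Rightarrow> 'a monoid \<Rightarrow> 'i rel \<Rightarrow> ('i \<Rightarrow> 'a set) \<Rightarrow> bool" where
  "ascending_normal_series P G r K \<longleftrightarrow>
     Well_order r \<and>
     (\<forall>i\<in>Field r. K i \<lhd> G) \<and>
     (\<exists>i. least_in r i \<and> K i = {\<one>\<^bsub>G\<^esub>}) \<and>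
     (\<exists>i. greatest_in r i \<and> K i = carrier G) \<and>
     (\<forall>i j. covers r i j \<longrightarrow> K i \<subseteq> K j) \<and>
     (\<forall>i. limit_in r i \<longrightarrow> K i = (\<Union>j\<in>underS r i. K j)) \<and>
     (\<forall>i j. covers r i j \<longrightarrow> P (G\<lparr>carrier := K j\<rparr> Mod K i))"

text \<open>HOL cannot quantify over the type of indices inside a formula. Index sets
  consisting of subsets of the group suffice: the lemma
  \<open>has_ascending_normal_seriesI\<close> below shows that a series indexed by a
  well-order on any type whatsoever yields one of this form.\<close>

definition has_ascending_normal_series :: "('a set monoid \<Rightarrow> bool) \<Rightarrow> 'a monoid \<Rightarrow> bool" where
  "has_ascending_normal_series P G \<longleftrightarrow>
     (\<exists>(r :: 'a set rel) K. ascending_normal_series P G r K)"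

lemma Well_order_least:
  assumes "Well_order r" "A \<subseteq> Field r" "A \<noteq> {}"
  shows "\<exists>i\<in>A. \<forall>j\<in>A. (i, j) \<in> r"
  using Linear_order_Well_order_iff[of r] assms by (auto simp: order_on_defs)

lemma Well_order_total:
  assumes "Well_order r" "a \<in> Field r" "b \<in> Field r"
  shows "(a, b) \<in> r \<or> (b, a) \<in> r"
  using assms by (cases "a = b") (auto simp: order_on_defs refl_on_def total_on_def)

lemma ascending_normal_series_mono:
  assumes s: "ascending_normal_series P G r K" and ij: "(i, j) \<in> r"
  shows "K i \<subseteq> K j"
proof (rule ccontr)
  assume n: "\<not> K i \<subseteq> K j"
  have W: "Well_order r" using s by (simp add: ascending_normal_series_def)
  have tr: "trans r" and an: "antisym r" and rf: "\<And>k. k \<in> Field r \<Longrightarrow> (k, k) \<in> r"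
    and tot: "\<And>a b. a \<in> Field r \<Longrightarrow> b \<in> Field r \<Longrightarrow> (a, b) \<in> r \<or> (b, a) \<in> r"
    using W Well_order_total[OF W] by (simp_all add: order_on_defs refl_on_def)
  let ?A = "{k. (i, k) \<in> r \<and> \<not> K i \<subseteq> K k}"
  obtain k where k: "(i, k) \<in> r" "\<not> K i \<subseteq> K k" and m: "\<And>l. l \<in> ?A \<Longrightarrow> (k, l) \<in> r"
    using Well_order_least[OF W, of ?A] ij n by (auto simp: Field_def)
  have ki: "k \<noteq> i" using k by auto
  have F: "i \<in> Field r" "k \<in> Field r" using k by (auto simp: Field_def)
  show False
  proof (cases "\<exists>l. covers r l k")
    case True
    then obtain l where l: "covers r l k" by blast
    have lr: "(l, k) \<in> r" "l \<noteq> k" using l by (auto simp: covers_def)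
    have "l \<in> Field r" using lr by (auto simp: Field_def)
    then have "(i, l) \<in> r"
      using tot[OF F(1), of l] l k(1) ki rf F unfolding covers_def by metis
    moreover have "l \<notin> ?A" using m[of l] lr an by (auto dest: antisymD)
    ultimately have "K i \<subseteq> K l" by auto
    also have "K l \<subseteq> K k" using s l by (auto simp: ascending_normal_series_def)
    finally show False using k by blast
  next
    case False
    have "\<not> least_in r k" using ki k(1) F an by (auto simp: least_in_def dest: antisymD)
    then have "limit_in r k" using False F by (auto simp: limit_in_def)
    then have "K k = (\<Union>j\<in>underS r k. K j)" using s by (auto simp: ascending_normal_series_def)
    moreover have "i \<in> underS r k" using k ki by (auto simp: underS_def)
    ultimately show False using k by blast
  qed
qed

lemma has_ascending_normal_seriesI:
  fixes r :: "'i rel"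
  assumes s: "ascending_normal_series P G r K"
  shows "has_ascending_normal_series P G"
proof -
  have W: "Well_order r" using s by (simp add: ascending_normal_series_def)
  have tr: "trans r" and an: "antisym r" and rf: "\<And>k. k \<in> Field r \<Longrightarrow> (k, k) \<in> r"
    and tot: "\<And>a b. a \<in> Field r \<Longrightarrow> b \<in> Field r \<Longrightarrow> (a, b) \<in> r \<or> (b, a) \<in> r"
    using W Well_order_total[OF W] by (simp_all add: order_on_defs refl_on_def)
  note mono = ascending_normal_series_mono[OF s]
  have nrm: "K i \<lhd> G" if "i \<in> Field r" for i
    using s that unfolding ascending_normal_series_def by blast
  have quo: "P (G\<lparr>carrier := K j\<rparr> Mod K i)" if "covers r i j" for i j
    using s that unfolding ascending_normal_series_def by blast
  have unions: "K i = (\<Union>j\<in>underS r i. K j)" if "limit_in r i" for i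
    using s that unfolding ascending_normal_series_def by blast
  obtain a where a: "least_in r a" "K a = {\<one>\<^bsub>G\<^esub>}"
    using s unfolding ascending_normal_series_def by blast
  obtain b where b: "greatest_in r b" "K b = carrier G"
    using s unfolding ascending_normal_series_def by blast
  let ?F = "K ` Field r"
  define R where "R = {(A, B). A \<in> ?F \<and> B \<in> ?F \<and> A \<subseteq> B}"
  have FR: "Field R = ?F" by (auto simp: R_def Field_def)
  have RI: "(A, B) \<in> R \<longleftrightarrow> A \<in> ?F \<and> B \<in> ?F \<and> A \<subseteq> B" for A B
    by (simp add: R_def)
  have lin: "A \<subseteq> B \<or> B \<subseteq> A" if "A \<in> ?F" "B \<in> ?F" for A B
    using that tot mono by blast
  have first: "\<exists>j\<in>Field r. K j = B \<and> (\<forall>k. (k, j) \<in> r \<and> k \<noteq> j \<longrightarrow> K k \<subset> B)"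
    if B: "B \<in> ?F" for B
  proof -
    obtain j where j: "j \<in> Field r" "K j = B"
      and m: "\<And>k. k \<in> Field r \<Longrightarrow> K k = B \<Longrightarrow> (j, k) \<in> r"
    proof -
      have "{k \<in> Field r. K k = B} \<noteq> {}" using B by blast
      then have "\<exists>i\<in>{k \<in> Field r. K k = B}. \<forall>j\<in>{k \<in> Field r. K k = B}. (i, j) \<in> r"
        by (intro Well_order_least[OF W]) auto
      then show ?thesis using that by blast
    qed
    have "K k \<subset> B" if k: "(k, j) \<in> r" "k \<noteq> j" for k
    proof -
      have "k \<in> Field r" using k by (auto simp: Field_def)
      then have "K k \<noteq> B" using m[of k] k an by (auto dest: antisymD)
      then show ?thesis using mono[OF k(1)] j by auto
    qed
    then show ?thesis using j by blast
  qed
  have Lin: "Linear_order R"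
    unfolding order_on_defs FR using lin
    by (auto simp: R_def refl_on_def trans_def antisym_def total_on_def)
  have WR: "Well_order R"
  proof (subst Linear_order_Well_order_iff[OF Lin], intro allI impI)
    fix C assume C: "C \<subseteq> Field R" and ne: "C \<noteq> {}"
    obtain i where i: "i \<in> Field r" "K i \<in> C"
      and m: "\<And>j. j \<in> Field r \<Longrightarrow> K j \<in> C \<Longrightarrow> (i, j) \<in> r"
    proof -
      have "{k \<in> Field r. K k \<in> C} \<noteq> {}" using C ne unfolding FR by blast
      then have "\<exists>i\<in>{k \<in> Field r. K k \<in> C}. \<forall>j\<in>{k \<in> Field r. K k \<in> C}. (i, j) \<in> r"
        by (intro Well_order_least[OF W]) auto
      then show ?thesis using that by blast
    qed
    show "\<exists>a\<in>C. \<forall>b\<in>C. (a, b) \<in> R"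
    proof (intro bexI[of _ "K i"] ballI i)
      fix B assume "B \<in> C"
      moreover from this obtain j where "j \<in> Field r" "B = K j" using C unfolding FR by auto
      ultimately show "(K i, B) \<in> R" using m mono i by (auto simp: R_def)
    qed
  qed
  have cov: "\<exists>i j. covers r i j \<and> K i = A \<and> K j = B" if c: "covers R A B" for A B
  proof -
    have AB: "A \<in> ?F" "B \<in> ?F" "A \<subset> B"
      and nb: "\<And>C. C \<in> ?F \<Longrightarrow> A \<subseteq> C \<Longrightarrow> C \<subseteq> B \<Longrightarrow> C = A \<or> C = B"
      using c by (auto simp: covers_def R_def)
    obtain j where j: "j \<in> Field r" "K j = B"
      and m: "\<And>k. (k, j) \<in> r \<Longrightarrow> k \<noteq> j \<Longrightarrow> K k \<subset> B"
      using first[OF AB(2)] by blast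
    obtain i' where i': "i' \<in> Field r" "K i' = A" using AB by auto
    have i'j: "(i', j) \<in> r" "i' \<noteq> j" using tot[OF i'(1) j(1)] mono[of j i'] i' j AB by auto
    have below: "K k \<subseteq> A" if "(k, j) \<in> r" "k \<noteq> j" for k
    proof -
      have "K k \<in> ?F" using that by (auto simp: Field_def)
      then show ?thesis using lin[of "K k" A] nb[of "K k"] m[OF that] AB by blast
    qed
    have "\<not> limit_in r j"
    proof
      assume "limit_in r j"
      then have "K j = (\<Union>k\<in>underS r j. K k)" by (rule unions)
      then have "K j \<subseteq> A" using below by (auto simp: underS_def)
      then show False using j AB by auto
    qed
    moreover have "\<not> least_in r j" using i'j i' an by (auto simp: least_in_def dest: antisymD)
    ultimately obtain i where i: "covers r i j" using j by (auto simp: limit_in_def)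
    have ir: "(i, j) \<in> r" "i \<noteq> j" using i by (auto simp: covers_def)
    have "i \<in> Field r" using ir by (auto simp: Field_def)
    then have "(i', i) \<in> r"
      using tot[OF i'(1), of i] i i'j i' rf unfolding covers_def by metis
    then have "K i = A" using mono[of i' i] i' below[OF ir] by auto
    then show ?thesis using i j by blast
  qed
  have lim: "B = (\<Union>A\<in>underS R B. A)" if l: "limit_in R B" for B
  proof -
    have B: "B \<in> ?F" "\<not> least_in R B" "\<And>A. \<not> covers R A B"
      using l by (auto simp: limit_in_def FR)
    obtain j where j: "j \<in> Field r" "K j = B"
      and m: "\<And>k. (k, j) \<in> r \<Longrightarrow> k \<noteq> j \<Longrightarrow> K k \<subset> B"
      using first[OF B(1)] by blast
    have "\<not> least_in r j"
    proof
      assume "least_in r j"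
      then have "(j, k) \<in> r" if "k \<in> Field r" for k using that by (simp add: least_in_def)
      then have "B \<subseteq> C" if "C \<in> ?F" for C using that mono j by blast
      then have "least_in R B" using B(1) unfolding least_in_def FR RI by blast
      then show False using B by blast
    qed
    moreover have "\<not> covers r i j" for i
    proof
      assume c: "covers r i j"
      have ir: "(i, j) \<in> r" "i \<noteq> j" using c by (auto simp: covers_def)
      have iF: "i \<in> Field r" using ir by (auto simp: Field_def)
      have "K k = K i \<or> K k = B" if k: "k \<in> Field r" "K i \<subseteq> K k" "K k \<subseteq> B" for k
      proof -
        have "(k, i) \<in> r \<or> (j, k) \<in> r"
          using tot[OF k(1) iF] tot[OF k(1) j(1)] c rf[OF iF] rf[OF j(1)]
          unfolding covers_def by metis
        then show ?thesis using mono[of k i] mono[of j k] k j by auto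
      qed
      then have "covers R (K i) B"
        using iF B(1) m[OF ir] by (auto simp: covers_def R_def)
      then show False using B by blast
    qed
    ultimately have "limit_in r j" using j by (auto simp: limit_in_def)
    then have Kj: "K j = (\<Union>k\<in>underS r j. K k)" by (rule unions)
    show ?thesis
    proof (intro equalityI subsetI)
      fix x assume "x \<in> B"
      then have "x \<in> (\<Union>k\<in>underS r j. K k)" using Kj j(2) by metis
      then obtain k where k: "(k, j) \<in> r" "k \<noteq> j" "x \<in> K k" by (auto simp: underS_def)
      have "K k \<in> ?F" using k(1) by (auto simp: Field_def)
      then have "K k \<in> underS R B" using m[OF k(1,2)] B(1) RI unfolding underS_def by blast
      then show "x \<in> (\<Union>A\<in>underS R B. A)" using k(3) by blast
    next
      fix x assume "x \<in> (\<Union>A\<in>underS R B. A)"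
      then show "x \<in> B" using RI unfolding underS_def by blast
    qed
  qed
  have "ascending_normal_series P G R (\<lambda>A. A)"
    unfolding ascending_normal_series_def
  proof (intro conjI)
    show "Well_order R" by (rule WR)
    show "\<forall>i\<in>Field R. i \<lhd> G" unfolding FR using nrm by blast
    have "(a, k) \<in> r" if "k \<in> Field r" for k using that a(1) by (simp add: least_in_def)
    then have "K a \<subseteq> C" if "C \<in> ?F" for C using that mono by blast
    moreover have "K a \<in> ?F" using a(1) by (simp add: least_in_def)
    ultimately have "least_in R (K a)" unfolding least_in_def FR RI by blast
    then show "\<exists>i. least_in R i \<and> i = {\<one>\<^bsub>G\<^esub>}" using a by auto
    have "(k, b) \<in> r" if "k \<in> Field r" for k using that b(1) by (simp add: greatest_in_def)
    then have "C \<subseteq> K b" if "C \<in> ?F" for C using that mono by blast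
    moreover have "K b \<in> ?F" using b(1) by (simp add: greatest_in_def)
    ultimately have "greatest_in R (K b)" unfolding greatest_in_def FR RI by blast
    then show "\<exists>i. greatest_in R i \<and> i = carrier G" using b by auto
    show "\<forall>i j. covers R i j \<longrightarrow> i \<subseteq> j" by (auto simp: covers_def R_def)
    show "\<forall>i. limit_in R i \<longrightarrow> i = (\<Union>j\<in>underS R i. j)" using lim by blast
    show "\<forall>i j. covers R i j \<longrightarrow> P (G\<lparr>carrier := j\<rparr> Mod i)"
    proof (intro allI impI)
      fix A B assume "covers R A B"
      then obtain i j where ij: "covers r i j" "K i = A" "K j = B" using cov by blast
      show "P (G\<lparr>carrier := B\<rparr> Mod A)" using quo[OF ij(1)] unfolding ij(2,3) .
    qed
  qed
  then show ?thesis unfolding has_ascending_normal_series_def by blast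
qed


section \<open>The class \<open>V(m, n, v)\<close>\<close>

definition engel_series_class :: "nat \<Rightarrow> nat \<Rightarrow> group_word \<Rightarrow> 'a monoid set" where
  "engel_series_class m n v =
     {G. group G \<and>
         (\<forall>x\<in>word_values G (pow_word v m). engel_element G n x) \<and>
         has_ascending_normal_series (\<lambda>Q. locally_soluble Q \<or> locally_finite Q)
           (G\<lparr>carrier := verbal_subgroup G v\<rparr>)}"

end

theory Submission
  imports Defs
begin

text \<open>
  Let \<open>H = v(G)\<close> have an ascending normal series as in the statement. The \<open>w\<close>-values are
  \<open>n\<close>-Engel elements, and any finite set of them generates a nilpotent group: otherwise a
  quotient of that group is not nilpotent although it is an extension of a locally soluble or
  locally finite group by a nilpotent one, which the theorems of Gruenberg, Baer and
  Hirsch--Plotkin exclude. So \<open>w(G)\<close> is locally nilpotent, and modulo \<open>w(G)\<close> all \<open>v\<close>-values have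
  finite order. It remains to see that \<open>H\<close> is then locally finite.

  Factor out the locally finite radical of \<open>H\<close>. Since \<open>[N, v(G)]\<close> is generated by \<open>v\<close>-values
  with an entry in \<open>N\<close> whenever \<open>N\<close> is normal, a torsion-free normal subgroup of \<open>G\<close> in \<open>H\<close> is
  central in \<open>H\<close>; hence so are the soluble ones, among them the centraliser of \<open>v(H)\<close> in \<open>H\<close>, and
  hence all torsion-free or soluble normal subgroups of \<open>H\<close>. Therefore the first member of
  the series that is not central cannot exist, and \<open>H\<close> is abelian and generated by elements of
  finite order, that is, locally finite.
\<close>

section \<open>Commutators and normalising subgroups\<close>

text \<open>The obstacle is that the members of the series are normal in \<open>H\<close> only,
  while commutators with \<open>v(G)\<close> are under control only for normal subgroups of
  \<open>G\<close>. Inside \<open>H\<close> the same argument merely shows that a torsion-free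
  normal subgroup centralises \<open>v(H)\<close>; but the centraliser of \<open>v(H)\<close> in
  \<open>H\<close> is again normal in \<open>G\<close>, so the result for \<open>G\<close> applies
  to it. Torsion-free subgroups matter because a \<open>v\<close>-value with an entry in a normal
  subgroup lies in that subgroup, and all \<open>v\<close>-values have finite order once
  \<open>w(G)\<close> is factored out. For the local nilpotence of \<open>w(G)\<close> there is no
  transfinite induction along the series: in a finitely generated group Zorn's lemma yields a
  maximal \<open>L\<close> with non-nilpotent quotient, and a single factor of the series not
  absorbed by \<open>L\<close> gives the contradiction. Gruenberg's argument treats soluble factors
  and Baer's finite ones; both show that conjugates of an Engel element generate a locally nilpotent
  subgroup, and Hirsch--Plotkin joins these. Most notions are stated for subsets of one group,
  relative to a normal subgroup, because a quotient changes the element type.\<close>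

context group
begin

lemma group_comm_closed [simp, intro]:
  "x \<in> carrier G \<Longrightarrow> y \<in> carrier G \<Longrightarrow> group_comm G x y \<in> carrier G"
  by (simp add: group_comm_def)

lemma inv_mult_cancel [simp]:
  "x \<in> carrier G \<Longrightarrow> y \<in> carrier G \<Longrightarrow> inv x \<otimes> (x \<otimes> y) = y"
  "x \<in> carrier G \<Longrightarrow> y \<in> carrier G \<Longrightarrow> x \<otimes> (inv x \<otimes> y) = y"
  by (simp_all flip: m_assoc)

lemmas free_group_simps = m_assoc inv_mult_group group_comm_def

lemma group_comm_swap:
  "x \<in> carrier G \<Longrightarrow> y \<in> carrier G \<Longrightarrow> inv (group_comm G x y) = group_comm G y x"
  by (simp add: free_group_simps)

lemma group_comm_mult_left:
  assumes "x \<in> carrier G" "y \<in> carrier G" "z \<in> carrier G"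
  shows "group_comm G (x \<otimes> y) z = (inv y \<otimes> group_comm G x z \<otimes> y) \<otimes> group_comm G y z"
  using assms by (simp add: free_group_simps)

lemma group_comm_mult_right:
  assumes "x \<in> carrier G" "y \<in> carrier G" "z \<in> carrier G"
  shows "group_comm G x (y \<otimes> z) = group_comm G x z \<otimes> (inv z \<otimes> group_comm G x y \<otimes> z)"
  using assms by (simp add: free_group_simps)

lemma group_comm_inv_left:
  assumes "x \<in> carrier G" "y \<in> carrier G"
  shows "group_comm G (inv x) y = x \<otimes> inv (group_comm G x y) \<otimes> inv x"
  using assms by (simp add: free_group_simps)

lemma group_comm_inv_right:
  assumes "x \<in> carrier G" "y \<in> carrier G"
  shows "group_comm G x (inv y) = y \<otimes> inv (group_comm G x y) \<otimes> inv y"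
  using assms by (simp add: free_group_simps)

lemma hall_witt:
  assumes "x \<in> carrier G" "y \<in> carrier G" "z \<in> carrier G"
  shows "(inv y \<otimes> group_comm G (group_comm G x (inv y)) z \<otimes> y)
    \<otimes> (inv z \<otimes> group_comm G (group_comm G y (inv z)) x \<otimes> z)
    \<otimes> (inv x \<otimes> group_comm G (group_comm G z (inv x)) y \<otimes> x) = \<one>"
  using assms by (simp add: free_group_simps)

lemma generate_finite_support:
  assumes "x \<in> generate G S"
  shows "\<exists>F. finite F \<and> F \<subseteq> S \<and> x \<in> generate G F"
  using assms
proof induction
  case one
  show ?case by (intro exI[of _ "{}"]) (auto intro: generate.one)
next
  case (incl h)
  then show ?case by (intro exI[of _ "{h}"]) (auto intro: generate.incl)
next
  case (inv h)
  then show ?case by (intro exI[of _ "{h}"]) (auto intro: generate.inv)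
next
  case (eng h1 h2)
  then obtain F1 F2 where "finite F1" "F1 \<subseteq> S" "h1 \<in> generate G F1"
    "finite F2" "F2 \<subseteq> S" "h2 \<in> generate G F2" by blast
  then show ?case
    using mono_generate[of F1 "F1 \<union> F2"] mono_generate[of F2 "F1 \<union> F2"]
    by (intro exI[of _ "F1 \<union> F2"]) (auto intro!: generate.eng)
qed

lemma generate_finite_support_set:
  assumes "finite T" "T \<subseteq> generate G S"
  shows "\<exists>F. finite F \<and> F \<subseteq> S \<and> T \<subseteq> generate G F"
  using assms
proof (induction T rule: finite_induct)
  case empty
  then show ?case by blast
next
  case (insert x T)
  then obtain F where F: "finite F" "F \<subseteq> S" "T \<subseteq> generate G F" by blast
  obtain F' where F': "finite F'" "F' \<subseteq> S" "x \<in> generate G F'"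
    using generate_finite_support[of x S] insert by blast
  show ?case
    using F F' mono_generate[of F "F \<union> F'"] mono_generate[of F' "F \<union> F'"]
    by (intro exI[of _ "F \<union> F'"]) auto
qed

lemma generate_idem:
  assumes "S \<subseteq> carrier G" "T \<subseteq> generate G S"
  shows "generate G T \<subseteq> generate G S"
  using generate_subgroup_incl[OF assms(2) generate_is_subgroup[OF assms(1)]] .

lemma generate_of_subgroup: "subgroup H G \<Longrightarrow> generate G H = H"
  using generate_subgroup_incl[of H H] generate.incl[of _ H G] by blast

end


text \<open>\<open>N\<close> need not lie in \<open>H\<close>: two subgroups that normalise each
  other, as in Hirsch--Plotkin, are then described without naming a group in which both are normal.
  One direction of conjugation is enough, since \<open>H\<close> is closed under inverses.\<close>

definition normalises :: "('a, 'b) monoid_scheme \<Rightarrow> 'a set \<Rightarrow> 'a set \<Rightarrow> bool" where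
  "normalises G H N \<longleftrightarrow> subgroup H G \<and> subgroup N G \<and>
     (\<forall>h\<in>H. \<forall>x\<in>N. inv\<^bsub>G\<^esub> h \<otimes>\<^bsub>G\<^esub> x \<otimes>\<^bsub>G\<^esub> h \<in> N)"

context group
begin

lemma normalisesD:
  assumes "normalises G H N"
  shows "subgroup H G" "subgroup N G" "h \<in> H \<Longrightarrow> x \<in> N \<Longrightarrow> inv h \<otimes> x \<otimes> h \<in> N"
    "h \<in> H \<Longrightarrow> x \<in> N \<Longrightarrow> h \<otimes> x \<otimes> inv h \<in> N"
proof -
  show H: "subgroup H G" and "subgroup N G" using assms by (auto simp: normalises_def)
  show c: "inv h \<otimes> x \<otimes> h \<in> N" if "h \<in> H" "x \<in> N" for h x
    using assms that by (auto simp: normalises_def)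
  show "h \<otimes> x \<otimes> inv h \<in> N" if "h \<in> H" "x \<in> N"
    using c[OF subgroup.m_inv_closed[OF H that(1)] that(2)] subgroup.mem_carrier[OF H that(1)]
    by simp
qed

lemma normalises_carrier_iff: "normalises G (carrier G) N \<longleftrightarrow> N \<lhd> G"
  using subgroup_self by (auto simp: normalises_def normal_inv_iff)
    (metis inv_closed inv_inv)+

lemma normalises_self: "subgroup H G \<Longrightarrow> normalises G H H"
  by (auto simp: normalises_def subgroup.m_closed subgroup.m_inv_closed)

lemma normalises_one: "subgroup H G \<Longrightarrow> normalises G H {\<one>}"
  by (auto simp: normalises_def triv_subgroup subgroup.mem_carrier)

lemma normalises_subgroup:
  "normalises G H N \<Longrightarrow> subgroup K G \<Longrightarrow> K \<subseteq> H \<Longrightarrow> normalises G K N"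
  by (auto simp: normalises_def)

lemma normalises_Int:
  "normalises G H N \<Longrightarrow> normalises G H K \<Longrightarrow> normalises G H (N \<inter> K)"
  by (auto simp: normalises_def subgroups_Inter_pair)

text \<open>Both directions of conjugation are demanded of a generator: an element may conjugate an
  infinite subgroup properly into itself.\<close>

lemma normalises_generateI:
  assumes S: "S \<subseteq> carrier G" and N: "subgroup N G"
    and "\<And>s x. s \<in> S \<Longrightarrow> x \<in> N \<Longrightarrow> inv s \<otimes> x \<otimes> s \<in> N"
    and "\<And>s x. s \<in> S \<Longrightarrow> x \<in> N \<Longrightarrow> s \<otimes> x \<otimes> inv s \<in> N"
  shows "normalises G (generate G S) N"
proof -
  have "\<forall>x\<in>N. inv h \<otimes> x \<otimes> h \<in> N" if "h \<in> generate G S" for h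
    using that
  proof induction
    case one
    then show ?case using subgroup.mem_carrier[OF N] by auto
  next
    case (incl h)
    then show ?case using assms(3) by auto
  next
    case (inv h)
    then show ?case using assms(4) S by (auto simp: subset_iff)
  next
    case (eng h1 h2)
    have h: "h1 \<in> carrier G" "h2 \<in> carrier G" using eng generate_in_carrier[OF S] by auto
    show ?case
    proof
      fix x assume x: "x \<in> N"
      then have "inv h2 \<otimes> (inv h1 \<otimes> x \<otimes> h1) \<otimes> h2 \<in> N" using eng by blast
      then show "inv (h1 \<otimes> h2) \<otimes> x \<otimes> (h1 \<otimes> h2) \<in> N"
        using h subgroup.mem_carrier[OF N x] by (simp add: free_group_simps)
    qed
  qed
  then show ?thesis using N generate_is_subgroup[OF S] by (auto simp: normalises_def)
qed

lemma normalises_generate_right: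
  assumes H: "subgroup H G" and S: "S \<subseteq> carrier G"
    and c: "\<And>h x. h \<in> H \<Longrightarrow> x \<in> S \<Longrightarrow> inv h \<otimes> x \<otimes> h \<in> generate G S"
  shows "normalises G H (generate G S)"
proof -
  note gs = generate_is_subgroup[OF S]
  have "inv h \<otimes> x \<otimes> h \<in> generate G S" if h: "h \<in> H" and x: "x \<in> generate G S" for h x
    using x
  proof induction
    case one
    then show ?case using subgroup.mem_carrier[OF H h] generate.one by simp
  next
    case (incl y)
    then show ?case using c h by auto
  next
    case (inv y)
    have "inv (inv h \<otimes> y \<otimes> h) \<in> generate G S"
      using c[OF h inv] gs by (rule subgroup.m_inv_closed[rotated])
    then show ?case using subgroup.mem_carrier[OF H h] S inv
      by (simp add: free_group_simps subset_iff)
  next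
    case (eng y1 y2)
    have "(inv h \<otimes> y1 \<otimes> h) \<otimes> (inv h \<otimes> y2 \<otimes> h) \<in> generate G S"
      using eng by (blast intro: generate.eng)
    moreover have "y1 \<in> carrier G" "y2 \<in> carrier G" "h \<in> carrier G"
      using eng generate_in_carrier[OF S] subgroup.mem_carrier[OF H h] by auto
    ultimately show ?case by (simp add: free_group_simps)
  qed
  then show ?thesis using H gs by (auto simp: normalises_def)
qed

lemma normalises_generate_sets:
  assumes S: "S \<subseteq> carrier G" and T: "T \<subseteq> carrier G"
    and a: "\<And>s x. s \<in> S \<Longrightarrow> x \<in> T \<Longrightarrow> inv s \<otimes> x \<otimes> s \<in> generate G T"
    and b: "\<And>s x. s \<in> S \<Longrightarrow> x \<in> T \<Longrightarrow> s \<otimes> x \<otimes> inv s \<in> generate G T"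
  shows "normalises G (generate G S) (generate G T)"
proof (rule normalises_generateI[OF S generate_is_subgroup[OF T]])
  have *: "inv s \<otimes> x \<otimes> s \<in> generate G T"
    if "s \<in> carrier G" "x \<in> generate G T" "\<And>x. x \<in> T \<Longrightarrow> inv s \<otimes> x \<otimes> s \<in> generate G T" for s x
    using that(2)
  proof induction
    case one
    then show ?case using that generate.one by simp
  next
    case (incl y)
    then show ?case using that by auto
  next
    case (inv y)
    have "inv (inv s \<otimes> y \<otimes> s) \<in> generate G T"
      using that(3)[OF inv] generate_m_inv_closed[OF T] by auto
    then show ?case using that(1) T inv by (simp add: free_group_simps subset_iff)
  next
    case (eng y1 y2)
    have "(inv s \<otimes> y1 \<otimes> s) \<otimes> (inv s \<otimes> y2 \<otimes> s) \<in> generate G T"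
      using eng by (blast intro: generate.eng)
    moreover have "y1 \<in> carrier G" "y2 \<in> carrier G"
      using eng generate_in_carrier[OF T] by auto
    ultimately show ?case using that(1) by (simp add: free_group_simps)
  qed
  show "inv s \<otimes> x \<otimes> s \<in> generate G T" if "s \<in> S" "x \<in> generate G T" for s x
    using *[of s x] that S a by auto
  show "s \<otimes> x \<otimes> inv s \<in> generate G T" if "s \<in> S" "x \<in> generate G T" for s x
    using *[of "inv s" x] that S b by auto
qed

lemma normalises_comm:
  assumes "normalises G H N" "x \<in> N" "h \<in> H"
  shows "group_comm G x h \<in> N" "group_comm G h x \<in> N"
proof -
  note d = normalisesD[OF assms(1)]
  have "inv x \<in> N" using d(2) assms(2) by (rule subgroup.m_inv_closed)
  then have "inv x \<otimes> (inv h \<otimes> x \<otimes> h) \<in> N" "(inv h \<otimes> inv x \<otimes> h) \<otimes> x \<in> N"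
    using d(3)[OF assms(3)] assms(2) by (simp_all add: subgroup.m_closed[OF d(2)])
  then show "group_comm G x h \<in> N" "group_comm G h x \<in> N"
    using subgroup.mem_carrier[OF d(1) assms(3)] subgroup.mem_carrier[OF d(2) assms(2)]
    by (simp_all add: free_group_simps)
qed

text \<open>By \<open>[a, hk] = [a, k] [a, h]^k\<close>, the \<open>k\<close> in \<open>K\<close>
  with \<open>[a, k]\<close> in \<open>V\<close> are closed under products when \<open>K\<close>
  normalises \<open>V\<close>, and similarly under inverses. This is what reduces commutator
  conditions to generators later on.\<close>

lemma comm_generate_right:
  assumes V: "normalises G K V" and a: "a \<in> carrier G" and S: "S \<subseteq> K"
    and c: "\<And>s. s \<in> S \<Longrightarrow> group_comm G a s \<in> V" and k: "k \<in> generate G S"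
  shows "group_comm G a k \<in> V"
proof -
  note d = normalisesD[OF V]
  have SK: "generate G S \<subseteq> K" using generate_subgroup_incl[OF S d(1)] .
  have SG: "S \<subseteq> carrier G" using S subgroup.subset[OF d(1)] by blast
  show ?thesis using k
  proof induction
    case one
    then show ?case using a subgroup.one_closed[OF d(2)] by (simp add: free_group_simps)
  next
    case (incl h)
    then show ?case using c by auto
  next
    case (inv h)
    have "h \<otimes> inv (group_comm G a h) \<otimes> inv h \<in> V"
      using c[OF inv] d inv S by (auto simp: subgroup.m_inv_closed)
    then show ?case using group_comm_inv_right[OF a, of h] inv SG by auto
  next
    case (eng h1 h2)
    have "h1 \<in> carrier G" "h2 \<in> carrier G" using eng generate_in_carrier[OF SG] by auto
    moreover have "group_comm G a h2 \<otimes> (inv h2 \<otimes> group_comm G a h1 \<otimes> h2) \<in> V"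
      using eng d(3)[of h2] SK by (auto simp: subgroup.m_closed[OF d(2)])
    ultimately show ?case using group_comm_mult_right[OF a] by simp
  qed
qed

lemma comm_swap_mem:
  assumes "subgroup V G" "x \<in> carrier G" "y \<in> carrier G" "group_comm G x y \<in> V"
  shows "group_comm G y x \<in> V"
  using subgroup.m_inv_closed[OF assms(1,4)] group_comm_swap[OF assms(2,3)] by simp

lemma comm_generate_left:
  assumes V: "normalises G K V" and a: "a \<in> carrier G" and S: "S \<subseteq> K"
    and c: "\<And>s. s \<in> S \<Longrightarrow> group_comm G s a \<in> V" and k: "k \<in> generate G S"
  shows "group_comm G k a \<in> V"
proof -
  note d = normalisesD[OF V]
  have SG: "S \<subseteq> carrier G" using S subgroup.subset[OF d(1)] by blast
  have "group_comm G a k \<in> V"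
    by (rule comm_generate_right[OF V a S _ k])
      (use comm_swap_mem[OF d(2) _ a c] SG in auto)
  then show ?thesis using comm_swap_mem[OF d(2) a generate_in_carrier[OF SG k]] by auto
qed

end

section \<open>Relative nilpotency\<close>

text \<open>The preimage in \<open>H\<close> of the \<open>k\<close>-th term of the upper central
  series of \<open>H/N\<close>, when \<open>N\<close> is a normal subgroup of \<open>H\<close>.
  Preimages keep all terms inside \<open>G\<close>.\<close>

primrec upper_central_over ::
    "('a, 'b) monoid_scheme \<Rightarrow> 'a set \<Rightarrow> 'a set \<Rightarrow> nat \<Rightarrow> 'a set" where
  "upper_central_over G H N 0 = N"
| "upper_central_over G H N (Suc k) =
     {x \<in> H. \<forall>y\<in>H. group_comm G x y \<in> upper_central_over G H N k}"

definition nilpotent_over :: "('a, 'b) monoid_scheme \<Rightarrow> 'a set \<Rightarrow> 'a set \<Rightarrow> bool" where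
  "nilpotent_over G H N \<longleftrightarrow> (\<exists>k. H \<subseteq> upper_central_over G H N k)"

text \<open>Left-normed commutators of weight \<open>k + 1\<close> in elements of \<open>X\<close>.
  For finite \<open>X\<close> there are finitely many of each weight, which turns nilpotency into a
  condition on a finite set.\<close>

primrec left_comms :: "('a, 'b) monoid_scheme \<Rightarrow> 'a set \<Rightarrow> nat \<Rightarrow> 'a set" where
  "left_comms G X 0 = X"
| "left_comms G X (Suc k) = {group_comm G u x | u x. u \<in> left_comms G X k \<and> x \<in> X}"

lemma finite_left_comms: "finite X \<Longrightarrow> finite (left_comms G X k)"
  by (induction k) (auto intro!: finite_image_set2)

lemma upper_central_over_add:
  "upper_central_over G H (upper_central_over G H N j) k = upper_central_over G H N (j + k)"
  by (induction k) auto

context group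
begin

lemma iter_comm_closed:
  "x \<in> carrier G \<Longrightarrow> g \<in> carrier G \<Longrightarrow> iter_comm G g k x \<in> carrier G"
  by (induction k) auto

lemma word_eval_closed:
  "(\<And>i. f i \<in> carrier G) \<Longrightarrow> word_eval G f w \<in> carrier G"
  by (induction w) auto

lemma normalises_centre_over:
  assumes n: "normalises G H V" and s: "V \<subseteq> H"
  defines "C \<equiv> {x \<in> H. \<forall>y\<in>H. group_comm G x y \<in> V}"
  shows "normalises G H C" "V \<subseteq> C" "C \<subseteq> H"
proof -
  note d = normalisesD[OF n]
  have Hc: "x \<in> carrier G" if "x \<in> H" for x using subgroup.mem_carrier[OF d(1) that] .
  show VC: "V \<subseteq> C" using s normalises_comm[OF n] by (auto simp: C_def)
  show "C \<subseteq> H" by (auto simp: C_def)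
  have sub: "subgroup C G"
  proof (rule subgroupI)
    show "C \<subseteq> carrier G" using Hc by (auto simp: C_def)
    show "C \<noteq> {}" using VC subgroup.one_closed[OF d(2)] by blast
    show "inv x \<in> C" if x: "x \<in> C" for x
    proof -
      have "x \<otimes> inv (group_comm G x y) \<otimes> inv x \<in> V" if "y \<in> H" for y
        using x that d(4)[of x] subgroup.m_inv_closed[OF d(2)] by (auto simp: C_def)
      then show ?thesis using x Hc group_comm_inv_left subgroup.m_inv_closed[OF d(1)]
        by (auto simp: C_def)
    qed
    show "x \<otimes> y \<in> C" if xy: "x \<in> C" "y \<in> C" for x y
    proof -
      have "(inv y \<otimes> group_comm G x z \<otimes> y) \<otimes> group_comm G y z \<in> V" if "z \<in> H" for z
        using xy that d(3)[of y] subgroup.m_closed[OF d(2)] by (auto simp: C_def)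
      then show ?thesis using xy Hc group_comm_mult_left subgroup.m_closed[OF d(1)]
        by (auto simp: C_def)
    qed
  qed
  have "inv h \<otimes> x \<otimes> h \<in> C" if h: "h \<in> H" and x: "x \<in> C" for h x
  proof -
    have "x \<otimes> group_comm G x h \<in> C"
      using h x VC by (intro subgroup.m_closed[OF sub]) (auto simp: C_def)
    then show ?thesis using h x Hc by (auto simp: C_def free_group_simps)
  qed
  then show "normalises G H C" using sub d(1) by (auto simp: normalises_def)
qed

lemma upper_central_over_normal:
  assumes "normalises G H N" "N \<subseteq> H"
  shows "normalises G H (upper_central_over G H N k)" "upper_central_over G H N k \<subseteq> H"
proof (induction k)
  case 0
  { case 1 then show ?case using assms by simp next
    case 2 then show ?case using assms by simp }
next
  case (Suc k)
  note * = normalises_centre_over[OF Suc.IH]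
  { case 1 then show ?case using * by simp next
    case 2 then show ?case using * by simp }
qed

lemma upper_central_over_incl:
  assumes "normalises G H N" "N \<subseteq> H"
  shows "N \<subseteq> upper_central_over G H N k"
proof (induction k)
  case (Suc k)
  then show ?case
    using normalises_centre_over(2)[OF upper_central_over_normal[OF assms]] by auto
qed simp

text \<open>The upper central series is the largest sequence that commutation with \<open>H\<close>
  lowers by one step. The \<open>Z i\<close> are arbitrary sets, so they may be the central terms of
  a bigger group.\<close>

lemma upper_central_overI:
  assumes H: "subgroup H G" and "H \<inter> Z 0 \<subseteq> N"
    and "\<And>i x y. x \<in> H \<Longrightarrow> x \<in> Z (Suc i) \<Longrightarrow> y \<in> H \<Longrightarrow> group_comm G x y \<in> Z i"
  shows "H \<inter> Z k \<subseteq> upper_central_over G H N k"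
proof (induction k)
  case 0
  then show ?case using assms by auto
next
  case (Suc k)
  have "group_comm G x y \<in> H" if "x \<in> H" "y \<in> H" for x y
    using that H by (auto simp: group_comm_def subgroup.m_closed subgroup.m_inv_closed)
  then show ?case using Suc assms(3) by fastforce
qed

lemma nilpotent_over_subgroup:
  assumes "nilpotent_over G H N" "subgroup K G" "K \<subseteq> H" "K \<inter> N \<subseteq> N'"
  shows "nilpotent_over G K N'"
proof -
  obtain k where k: "H \<subseteq> upper_central_over G H N k"
    using assms by (auto simp: nilpotent_over_def)
  have "K \<inter> upper_central_over G H N k \<subseteq> upper_central_over G K N' k"
    by (rule upper_central_overI) (use assms in auto)
  then show ?thesis using k assms by (auto simp: nilpotent_over_def)
qed

lemma nilpotent_over_trans:
  assumes "nilpotent_over G H (upper_central_over G H N j)"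
  shows "nilpotent_over G H N"
  using assms unfolding nilpotent_over_def upper_central_over_add by blast

lemma left_comms_closed:
  "subgroup H G \<Longrightarrow> X \<subseteq> H \<Longrightarrow> left_comms G X k \<subseteq> H"
  by (induction k) (force simp: group_comm_def subgroup.m_closed subgroup.m_inv_closed)+

text \<open>Each commutation descends one step of the upper central series, which gives one
  direction. Conversely, the terms are normal in \<open>H\<close>, so commutators with generators
  decide membership in the next term; by induction on \<open>j\<close> the commutators of weight
  \<open>k - j + 1\<close> lie in the \<open>j\<close>-th term, and \<open>j = k\<close> reaches the
  generators.\<close>

lemma nilpotent_over_iff_left_comms:
  assumes X: "X \<subseteq> carrier G" and H: "H = generate G X"
    and n: "normalises G H N" "N \<subseteq> H"
  shows "nilpotent_over G H N \<longleftrightarrow> (\<exists>k. left_comms G X k \<subseteq> N)"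
proof
  assume "nilpotent_over G H N"
  then obtain c where c: "H \<subseteq> upper_central_over G H N c" by (auto simp: nilpotent_over_def)
  have XH: "X \<subseteq> H" using H by (auto intro: generate.incl)
  have "j \<le> c \<Longrightarrow> left_comms G X j \<subseteq> upper_central_over G H N (c - j)" for j
  proof (induction j)
    case 0
    then show ?case using c XH by auto
  next
    case (Suc j)
    then have "c - j = Suc (c - Suc j)" by auto
    then have "left_comms G X j \<subseteq> upper_central_over G H N (Suc (c - Suc j))"
      using Suc by auto
    then show ?case using XH by fastforce
  qed
  from this[of c] show "\<exists>k. left_comms G X k \<subseteq> N" by auto
next
  assume "\<exists>k. left_comms G X k \<subseteq> N"
  then obtain k where k: "left_comms G X k \<subseteq> N" by blast
  have XH: "X \<subseteq> H" using H by (auto intro: generate.incl)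
  note sH = normalisesD(1)[OF n(1)]
  note ucn = upper_central_over_normal[OF n]
  have "j \<le> k \<Longrightarrow> left_comms G X (k - j) \<subseteq> upper_central_over G H N j" for j
  proof (induction j)
    case 0
    then show ?case using k by auto
  next
    case (Suc j)
    have kj: "k - j = Suc (k - Suc j)" using Suc by auto
    show ?case
    proof
      fix u assume u: "u \<in> left_comms G X (k - Suc j)"
      have uH: "u \<in> H" using left_comms_closed[OF sH XH] u by blast
      have "group_comm G u y \<in> upper_central_over G H N j" if y: "y \<in> H" for y
      proof (rule comm_generate_right[OF ucn(1) _ XH])
        show "u \<in> carrier G" using uH subgroup.mem_carrier[OF sH] by auto
        show "y \<in> generate G X" using y H by simp
        show "group_comm G u s \<in> upper_central_over G H N j" if "s \<in> X" for s
          using Suc u that kj by auto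
      qed
      then show "u \<in> upper_central_over G H N (Suc j)" using uH by auto
    qed
  qed
  from this[of k] have "X \<subseteq> upper_central_over G H N k" by simp
  then show "nilpotent_over G H N"
    using generate_subgroup_incl normalisesD(2)[OF ucn(1)] H
    unfolding nilpotent_over_def by blast
qed

lemma nilpotent_over_mono:
  assumes "nilpotent_over G H N" "N \<subseteq> N'" "subgroup H G"
  shows "nilpotent_over G H N'"
  using nilpotent_over_subgroup[OF assms(1,3), of N'] assms(2) by auto

lemma nilpotent_over_self: "nilpotent_over G H H"
  unfolding nilpotent_over_def by (rule exI[of _ 0]) simp

text \<open>For a finitely generated group the normal subgroups with non-nilpotent quotient are
  closed under unions of chains, because nilpotency over \<open>L\<close> of class \<open>k\<close> only says that finitely
  many commutators lie in \<open>L\<close>.\<close>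

lemma finitely_generated_nilpotentI:
  assumes fin: "finite X" and X: "X \<subseteq> carrier G" and M: "M = generate G X"
    and step: "\<And>L. normalises G M L \<Longrightarrow> L \<subset> M \<Longrightarrow>
      \<exists>T. normalises G M T \<and> L \<subset> T \<and> T \<subseteq> M \<and> (nilpotent_over G M T \<longrightarrow> nilpotent_over G M L)"
  shows "nilpotent_over G M {\<one>}"
proof (rule ccontr)
  assume non: "\<not> nilpotent_over G M {\<one>}"
  have sM: "subgroup M G" using M generate_is_subgroup[OF X] by simp
  define \<A> where "\<A> = {L. normalises G M L \<and> L \<subseteq> M \<and> \<not> nilpotent_over G M L}"
  have "{\<one>} \<in> \<A>" using non normalises_one[OF sM] subgroup.one_closed[OF sM] by (auto simp: \<A>_def)
  then have "\<A> \<noteq> {}" by blast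
  moreover have "\<Union>\<C> \<in> \<A>" if ne: "\<C> \<noteq> {}" and ch: "subset.chain \<A> \<C>" for \<C>
  proof -
    have mem: "normalises G M L" "L \<subseteq> M" "\<not> nilpotent_over G M L" if "L \<in> \<C>" for L
      using ch that by (auto simp: \<A>_def subset_chain_def)
    have lin: "L \<subseteq> L' \<or> L' \<subseteq> L" if "L \<in> \<C>" "L' \<in> \<C>" for L L'
      using ch that by (auto simp: subset_chain_def)
    have "subgroup (\<Union>\<C>) G"
    proof (rule subgroupI)
      show "\<Union>\<C> \<subseteq> carrier G" using mem(2) subgroup.subset[OF sM] by blast
      obtain L where "L \<in> \<C>" using ne by blast
      then show "\<Union>\<C> \<noteq> {}" using subgroup.one_closed[OF normalisesD(2)[OF mem(1)]] by blast
      show "inv x \<in> \<Union>\<C>" if "x \<in> \<Union>\<C>" for x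
        using that subgroup.m_inv_closed[OF normalisesD(2)[OF mem(1)]] by blast
      show "x \<otimes> y \<in> \<Union>\<C>" if xy: "x \<in> \<Union>\<C>" "y \<in> \<Union>\<C>" for x y
      proof -
        obtain L L' where "L \<in> \<C>" "x \<in> L" "L' \<in> \<C>" "y \<in> L'" using xy by blast
        then obtain K where "K \<in> \<C>" "x \<in> K" "y \<in> K" using lin[of L L'] by blast
        then show ?thesis using subgroup.m_closed[OF normalisesD(2)[OF mem(1)]] by blast
      qed
    qed
    then have n: "normalises G M (\<Union>\<C>)"
      using mem(1) sM by (auto simp: normalises_def)
    have sub: "\<Union>\<C> \<subseteq> M" using mem by blast
    have "\<not> nilpotent_over G M (\<Union>\<C>)"
    proof
      assume "nilpotent_over G M (\<Union>\<C>)"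
      then obtain k where k: "left_comms G X k \<subseteq> \<Union>\<C>"
        using nilpotent_over_iff_left_comms[OF X M n sub] by blast
      obtain L where "L \<in> \<C>" "left_comms G X k \<subseteq> L"
        using finite_subset_Union_chain[OF finite_left_comms[OF fin] k ne ch] by blast
      then show False
        using nilpotent_over_iff_left_comms[OF X M mem(1,2)] mem(3) by blast
    qed
    then show ?thesis using n sub by (auto simp: \<A>_def)
  qed
  ultimately obtain L where L: "L \<in> \<A>" "\<And>K. K \<in> \<A> \<Longrightarrow> L \<subseteq> K \<Longrightarrow> K = L"
    using subset_Zorn_nonempty[of \<A>] by blast
  then have "L \<noteq> M" using nilpotent_over_self by (auto simp: \<A>_def)
  then obtain T where "normalises G M T" "L \<subset> T" "T \<subseteq> M"
    "nilpotent_over G M T \<longrightarrow> nilpotent_over G M L"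
    using step[of L] L(1) by (auto simp: \<A>_def)
  then show False using L(2)[of T] L(1) by (auto simp: \<A>_def)
qed

text \<open>The hypothesis says that nontrivial quotients have nontrivial centre. Enlarging
  \<open>L\<close> by the preimage of that centre raises the class by at most one, so nilpotency
  descends from the larger kernel to \<open>L\<close>.\<close>

lemma finitely_generated_hypercentral_imp_nilpotent:
  assumes "finite X" "X \<subseteq> carrier G" and M: "M = generate G X"
    and step: "\<And>L. normalises G M L \<Longrightarrow> L \<subset> M \<Longrightarrow> \<exists>z\<in>M - L. \<forall>y\<in>M. group_comm G z y \<in> L"
  shows "nilpotent_over G M {\<one>}"
proof (rule finitely_generated_nilpotentI[OF assms(1-3)])
  fix L assume L: "normalises G M L" "L \<subset> M"
  let ?T = "upper_central_over G M L 1"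
  have n: "normalises G M ?T" "?T \<subseteq> M" "L \<subseteq> ?T"
    using upper_central_over_normal[OF L(1)] upper_central_over_incl[OF L(1)] L(2) by blast+
  obtain z where "z \<in> M - L" "z \<in> ?T" using step[OF L] by auto
  then have "L \<subset> ?T" using n by blast
  then show "\<exists>T. normalises G M T \<and> L \<subset> T \<and> T \<subseteq> M \<and>
      (nilpotent_over G M T \<longrightarrow> nilpotent_over G M L)"
    using n nilpotent_over_trans[of M L 1]
    by (intro exI[of _ ?T] conjI impI) (simp_all only:)
qed

end

context group_hom
begin

lemma hom_group_comm:
  "x \<in> carrier G \<Longrightarrow> y \<in> carrier G \<Longrightarrow> h (group_comm G x y) = group_comm H (h x) (h y)"
  by (simp add: group_comm_def)

lemma hom_iter_comm:
  "x \<in> carrier G \<Longrightarrow> g \<in> carrier G \<Longrightarrow> h (iter_comm G g k x) = iter_comm H (h g) k (h x)"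
  by (induction k) (auto simp: hom_group_comm G.iter_comm_closed)

lemma hom_word_eval:
  "(\<And>i. f i \<in> carrier G) \<Longrightarrow> h (word_eval G f w) = word_eval H (h \<circ> f) w"
  by (induction w) (auto simp: G.word_eval_closed)

lemma left_comms_img:
  assumes "X \<subseteq> carrier G"
  shows "left_comms H (h ` X) k = h ` left_comms G X k"
proof (induction k)
  case (Suc k)
  have c: "left_comms G X k \<subseteq> carrier G"
    using G.left_comms_closed[OF G.subgroup_self assms] .
  have "left_comms H (h ` X) (Suc k)
      = {group_comm H (h u) (h x) | u x. u \<in> left_comms G X k \<and> x \<in> X}"
    using Suc by auto
  also have "\<dots> = {h (group_comm G u x) | u x. u \<in> left_comms G X k \<and> x \<in> X}"
    using hom_group_comm c assms by (metis (no_types, opaque_lifting) subsetD)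
  also have "\<dots> = h ` left_comms G X (Suc k)" by auto
  finally show ?case .
qed simp

text \<open>A homomorphism maps left-normed commutators in \<open>X\<close> to those in the image of
  \<open>X\<close>, so both sides say that the commutators of some weight lie in the kernel.\<close>

lemma nilpotent_over_img_iff:
  assumes X: "X \<subseteq> carrier G"
  shows "nilpotent_over H (h ` generate G X) {\<one>\<^bsub>H\<^esub>} \<longleftrightarrow>
    nilpotent_over G (generate G X) (generate G X \<inter> kernel G H h)"
proof -
  let ?M = "generate G X"
  have gen: "h ` ?M = generate H (h ` X)" using generate_img[OF X] by simp
  have hX: "h ` X \<subseteq> carrier H" using X by auto
  have sM: "subgroup ?M G" using G.generate_is_subgroup[OF X] .
  have one: "normalises H (generate H (h ` X)) {\<one>\<^bsub>H\<^esub>}" "{\<one>\<^bsub>H\<^esub>} \<subseteq> generate H (h ` X)"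
    using H.normalises_one[OF H.generate_is_subgroup[OF hX]] generate.one[of H] by auto
  have "normalises G (carrier G) (kernel G H h)"
    using normal_kernel G.normalises_carrier_iff by blast
  then have ker: "normalises G ?M (?M \<inter> kernel G H h)"
    using G.normalises_Int[OF G.normalises_self[OF sM] G.normalises_subgroup[OF _ sM]]
      subgroup.subset[OF sM] by blast
  have "left_comms H (h ` X) k \<subseteq> {\<one>\<^bsub>H\<^esub>} \<longleftrightarrow> left_comms G X k \<subseteq> ?M \<inter> kernel G H h" for k
  proof -
    have "left_comms G X k \<subseteq> ?M"
      using G.left_comms_closed[OF sM] by (blast intro: generate.incl)
    then show ?thesis
      using left_comms_img[OF X, of k] subgroup.subset[OF sM]
      by (auto simp: kernel_def image_subset_iff)
  qed
  then show ?thesis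
    unfolding gen H.nilpotent_over_iff_left_comms[OF hX refl one]
      G.nilpotent_over_iff_left_comms[OF X refl ker Int_lower1]
    by simp
qed

end

lemma (in group) inclusion_group_hom:
  "subgroup H G \<Longrightarrow> group_hom (G\<lparr>carrier := H\<rparr>) G (\<lambda>x. x)"
  using subgroup_imp_group subgroup.subset
  by (fastforce simp: group_hom_def group_hom_axioms_def hom_def)

lemma (in normal) quotient_group_hom: "group_hom G (G Mod H) (\<lambda>x. H #> x)"
  using r_coset_hom_Mod factorgroup_is_group
  by (auto simp: group_hom_def group_hom_axioms_def)

lemma (in normal) quotient_kernel: "kernel G (G Mod H) (\<lambda>x. H #> x) = H"
  using coset_join1[OF _ _ subgroup_axioms] coset_join2[OF _ subgroup_axioms] subset
  unfolding kernel_def one_FactGroup by blast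

section \<open>The Hirsch--Plotkin theorem\<close>

definition loc_nilpotent :: "('a, 'b) monoid_scheme \<Rightarrow> 'a set \<Rightarrow> bool" where
  "loc_nilpotent G H \<longleftrightarrow> subgroup H G \<and>
     (\<forall>S. finite S \<longrightarrow> S \<subseteq> H \<longrightarrow> nilpotent_over G (generate G S) {\<one>\<^bsub>G\<^esub>})"

text \<open>No bound on \<open>k\<close> is asked for: the Engel elements that arise inside the
  proof of Hirsch--Plotkin get their exponents from nilpotent subgroups that vary with
  \<open>g\<close>.\<close>

definition engel_on :: "('a, 'b) monoid_scheme \<Rightarrow> 'a set \<Rightarrow> 'a \<Rightarrow> bool" where
  "engel_on G A y \<longleftrightarrow> (\<forall>g\<in>A. \<exists>k. iter_comm G g k y = \<one>\<^bsub>G\<^esub>)"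

context group
begin

lemma iter_comm_Suc: "iter_comm G g (Suc k) x = iter_comm G (group_comm G g x) k x"
  by (induction k) auto

lemma group_comm_one [simp]: "x \<in> carrier G \<Longrightarrow> group_comm G \<one> x = \<one>"
  by (simp add: group_comm_def)

lemma group_comm_self [simp]: "x \<in> carrier G \<Longrightarrow> group_comm G x x = \<one>"
  by (simp add: free_group_simps)

lemma generate_Un_generate:
  assumes "A \<subseteq> carrier G" "B \<subseteq> carrier G"
  shows "generate G (A \<union> generate G B) = generate G (A \<union> B)"
proof
  have "generate G B \<subseteq> generate G (A \<union> B)" by (rule mono_generate) auto
  then show "generate G (A \<union> generate G B) \<subseteq> generate G (A \<union> B)"
    using assms by (intro generate_idem) (auto intro: generate.incl)
  show "generate G (A \<union> B) \<subseteq> generate G (A \<union> generate G B)"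
    by (rule mono_generate) (auto intro: generate.incl)
qed

lemma normalises_iter_comm:
  assumes "normalises G H N" "y \<in> H" "g \<in> N"
  shows "iter_comm G g k y \<in> N"
  using normalises_comm(1)[OF assms(1)] assms(2,3) by (induction k) auto

text \<open>Collect the commutators \<open>[s,_i y]\<close> up to the index where they become
  trivial. Conjugation by \<open>y\<close> stays inside the generated subgroup because
  \<open>c^y = c [c, y]\<close>.\<close>

lemma finite_commutator_closure:
  assumes y: "y \<in> carrier G" and S: "finite S" "S \<subseteq> carrier G" and e: "engel_on G S y"
  shows "\<exists>T. finite T \<and> S \<subseteq> T \<and> T \<subseteq> {iter_comm G s i y | s i. s \<in> S} \<and>
    normalises G (generate G {y}) (generate G T)"
proof -
  obtain k where k: "\<And>s. s \<in> S \<Longrightarrow> iter_comm G s (k s) y = \<one>"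
    using e unfolding engel_on_def by metis
  define T where "T = (\<Union>s\<in>S. (\<lambda>i. iter_comm G s i y) ` {..k s})"
  have c: "iter_comm G s i y \<in> carrier G" if "s \<in> S" for s i
    using iter_comm_closed that y S by auto
  have T: "T \<subseteq> carrier G" using c by (auto simp: T_def)
  have mem: "iter_comm G s i y \<in> generate G T" if "s \<in> S" "i \<le> k s" for s i
    using that by (intro generate.incl) (auto simp: T_def)
  have Suc_mem: "iter_comm G s (Suc i) y \<in> generate G T" if "s \<in> S" "i \<le> k s" for s i
  proof (cases "i = k s")
    case True
    then show ?thesis using k[OF that(1)] y generate.one by simp
  next
    case False
    then show ?thesis using mem[of s "Suc i"] that by auto
  qed
  have up: "inv y \<otimes> iter_comm G s i y \<otimes> y \<in> generate G T" if "s \<in> S" "i \<le> k s" for s i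
  proof -
    have "iter_comm G s i y \<otimes> iter_comm G s (Suc i) y \<in> generate G T"
      using generate.eng[OF mem Suc_mem] that by blast
    then show ?thesis using c[of s i] that y by (simp add: free_group_simps)
  qed
  \<comment> \<open>Conjugation by \<open>inv y\<close> needs an induction from the trivial end
    downwards: the conjugate of \<open>[s,_i y]\<close> is \<open>[s,_i y]\<close> times the inverse
    of the conjugate of \<open>[s,_(i+1) y]\<close>.\<close>
  have down: "j \<le> k s \<Longrightarrow> y \<otimes> iter_comm G s (k s - j) y \<otimes> inv y \<in> generate G T"
    if s: "s \<in> S" for s j
  proof (induction j)
    case 0
    then show ?case using k[OF s] y generate.one by simp
  next
    case (Suc j)
    let ?c = "\<lambda>i. iter_comm G s i y"
    have kj: "k s - j = Suc (k s - Suc j)" using Suc by auto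
    have "?c (k s - Suc j) \<otimes> inv (y \<otimes> ?c (k s - j) \<otimes> inv y) \<in> generate G T"
      using Suc mem[OF s] generate_m_inv_closed[OF T] by (intro generate.eng) auto
    then show ?case
      unfolding kj using c[OF s, of "k s - Suc j"] y by (simp add: free_group_simps)
  qed
  have "normalises G (generate G {y}) (generate G T)"
  proof (rule normalises_generate_sets[OF _ T])
    show "{y} \<subseteq> carrier G" using y by auto
    show "inv s \<otimes> x \<otimes> s \<in> generate G T" if "s \<in> {y}" "x \<in> T" for s x
      using up that by (auto simp: T_def)
    show "s \<otimes> x \<otimes> inv s \<in> generate G T" if sx: "s \<in> {y}" "x \<in> T" for s x
    proof -
      obtain t i where "t \<in> S" "i \<le> k t" "x = iter_comm G t i y" using sx by (auto simp: T_def)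
      then show ?thesis using down[of t "k t - i"] sx by auto
    qed
  qed
  moreover have "S \<subseteq> T" by (force simp: T_def image_iff)
  moreover have "finite T" using S by (auto simp: T_def)
  moreover have "T \<subseteq> {iter_comm G s i y | s i. s \<in> S}" by (auto simp: T_def)
  ultimately show ?thesis by blast
qed

text \<open>Conjugation by an element of \<open>M\<close> is an automorphism of \<open>H\<close>
  preserving \<open>N\<close>, hence it preserves the upper central series; the use is for
  \<open>M\<close> larger than \<open>H\<close>.\<close>

lemma normalises_upper_central_over:
  assumes H: "normalises G M H" and N: "normalises G M N" and HN: "normalises G H N" "N \<subseteq> H"
  shows "normalises G M (upper_central_over G H N k)"
proof (induction k)
  case 0
  then show ?case using N by simp
next
  case (Suc k)
  note d = normalisesD[OF H]
  have "inv m \<otimes> x \<otimes> m \<in> upper_central_over G H N (Suc k)"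
    if m: "m \<in> M" and x: "x \<in> upper_central_over G H N (Suc k)" for m x
  proof -
    have xH: "x \<in> H" using x by auto
    have "group_comm G (inv m \<otimes> x \<otimes> m) y \<in> upper_central_over G H N k" if y: "y \<in> H" for y
    proof -
      have "group_comm G x (m \<otimes> y \<otimes> inv m) \<in> upper_central_over G H N k"
        using x d(4)[OF m y] by auto
      then have "inv m \<otimes> group_comm G x (m \<otimes> y \<otimes> inv m) \<otimes> m \<in> upper_central_over G H N k"
        using normalisesD(3)[OF Suc m] by blast
      then show ?thesis
        using subgroup.mem_carrier[OF d(1) m] subgroup.mem_carrier[OF d(2) y]
          subgroup.mem_carrier[OF d(2) xH]
        by (simp add: free_group_simps)
    qed
    then show ?thesis using d(3)[OF m xH] by auto
  qed
  then show ?case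
    using d(1) normalisesD(2)[OF upper_central_over_normal(1)[OF HN], of "Suc k"]
    unfolding normalises_def by blast
qed

lemma nilpotent_engel:
  assumes "nilpotent_over G H {\<one>}" "g \<in> H" "x \<in> H"
  shows "\<exists>k. iter_comm G g k x = \<one>"
proof -
  obtain c where c: "H \<subseteq> upper_central_over G H {\<one>} c"
    using assms(1) by (auto simp: nilpotent_over_def)
  have "j \<le> c \<Longrightarrow> iter_comm G g j x \<in> upper_central_over G H {\<one>} (c - j)" for j
  proof (induction j)
    case 0
    then show ?case using c assms by auto
  next
    case (Suc j)
    then have "c - j = Suc (c - Suc j)" by auto
    then have "iter_comm G g j x \<in> upper_central_over G H {\<one>} (Suc (c - Suc j))"
      using Suc by auto
    then show ?case using assms by auto
  qed
  from this[of c] show ?thesis by auto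
qed

lemma loc_nilpotent_subgroup:
  "loc_nilpotent G H \<Longrightarrow> subgroup K G \<Longrightarrow> K \<subseteq> H \<Longrightarrow> loc_nilpotent G K"
  by (auto simp: loc_nilpotent_def)

lemma loc_nilpotentI:
  assumes "subgroup H G"
    and "\<And>S. finite S \<Longrightarrow> S \<subseteq> H \<Longrightarrow> \<exists>K. S \<subseteq> K \<and> loc_nilpotent G K"
  shows "loc_nilpotent G H"
  unfolding loc_nilpotent_def
proof (intro conjI allI impI assms(1))
  fix S assume S: "finite S" "S \<subseteq> H"
  then obtain K where "S \<subseteq> K" "loc_nilpotent G K" using assms(2) by blast
  then show "nilpotent_over G (generate G S) {\<one>}" using S(1) by (simp add: loc_nilpotent_def)
qed

lemma loc_nilpotent_of_nilpotent:
  assumes "subgroup H G" "nilpotent_over G H {\<one>}"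
  shows "loc_nilpotent G H"
  unfolding loc_nilpotent_def
proof (intro conjI allI impI assms(1))
  fix S assume S: "S \<subseteq> H"
  then have "subgroup (generate G S) G"
    using subgroup.subset[OF assms(1)] by (intro generate_is_subgroup) simp
  then show "nilpotent_over G (generate G S) {\<one>}"
    by (rule nilpotent_over_subgroup[OF assms(2) _ generate_subgroup_incl[OF S assms(1)]]) simp
qed

text \<open>A finite set lies in some \<open>?M\<close> generated by \<open>y\<close> and a finite
  \<open>T\<close>, where \<open>y\<close> normalises the nilpotent group \<open>?D\<close>
  generated by \<open>T\<close>. It suffices to find a nontrivial central element in each nontrivial
  quotient of \<open>?M\<close>.\<close>

lemma loc_nilpotent_insert_engel:
  assumes N: "loc_nilpotent G N" and y: "y \<in> carrier G"
    and n: "normalises G (generate G {y}) N" and e: "engel_on G N y"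
  shows "loc_nilpotent G (generate G (insert y N))"
proof (rule loc_nilpotentI)
  have sN: "subgroup N G" using N by (simp add: loc_nilpotent_def)
  have NG: "N \<subseteq> carrier G" using subgroup.subset[OF sN] .
  then show "subgroup (generate G (insert y N)) G" using y by (intro generate_is_subgroup) auto
  fix S assume S: "finite S" "S \<subseteq> generate G (insert y N)"
  then obtain F where F: "finite F" "F \<subseteq> insert y N" "S \<subseteq> generate G F"
    using generate_finite_support_set[OF S] by blast
  have FN: "finite (F \<inter> N)" "F \<inter> N \<subseteq> carrier G" "engel_on G (F \<inter> N) y"
    using F NG e by (auto simp: engel_on_def)
  obtain T where T: "finite T" "F \<inter> N \<subseteq> T" "T \<subseteq> {iter_comm G s i y | s i. s \<in> F \<inter> N}"
    and nT: "normalises G (generate G {y}) (generate G T)"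
    using finite_commutator_closure[OF y FN] by blast
  have yy: "y \<in> generate G {y}" by (auto intro: generate.incl)
  have TN: "T \<subseteq> N" using T(3) normalises_iter_comm[OF n yy] by auto
  have TG: "T \<subseteq> carrier G" using TN NG by blast
  let ?D = "generate G T" and ?X = "insert y T"
  let ?M = "generate G ?X"
  have XG: "?X \<subseteq> carrier G" using y TG by auto
  have sM: "subgroup ?M G" using generate_is_subgroup[OF XG] .
  have sD: "subgroup ?D G" using generate_is_subgroup[OF TG] .
  have DN: "?D \<subseteq> N" using generate_subgroup_incl[OF TN sN] .
  have "nilpotent_over G ?D {\<one>}" using N T(1) TN by (auto simp: loc_nilpotent_def)
  then obtain c where c: "?D \<subseteq> upper_central_over G ?D {\<one>} c" by (auto simp: nilpotent_over_def)
  have MD: "normalises G ?M ?D"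
  proof (intro normalises_generateI[OF XG sD])
    have "T \<subseteq> ?D" by (auto intro: generate.incl)
    then show "inv s \<otimes> x \<otimes> s \<in> ?D" "s \<otimes> x \<otimes> inv s \<in> ?D"
      if "s \<in> ?X" "x \<in> ?D" for s x
      using that normalisesD(3,4)[OF nT yy] normalisesD(3,4)[OF normalises_self[OF sD]] by blast+
  qed
  have DM: "?D \<subseteq> ?M" by (rule mono_generate) auto
  have D1: "normalises G ?D {\<one>}" "{\<one>} \<subseteq> ?D"
    using normalises_one[OF sD] generate.one by auto
  have "nilpotent_over G ?M {\<one>}"
  proof (rule finitely_generated_hypercentral_imp_nilpotent[OF _ XG refl])
    show "finite ?X" using T(1) by auto
    fix L assume L: "normalises G ?M L" "L \<subset> ?M"
    note sL = normalisesD(2)[OF L(1)]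
    have XM: "?X \<subseteq> ?M" by (auto intro: generate.incl)
    show "\<exists>z\<in>?M - L. \<forall>m\<in>?M. group_comm G z m \<in> L"
    proof (cases "?D \<subseteq> L")
      case True
      \<comment> \<open>Modulo \<open>L\<close> the group \<open>?M\<close> is generated by
        \<open>y\<close> alone, so \<open>y\<close> is the central element.\<close>
      have "y \<notin> L"
      proof
        assume "y \<in> L"
        then have "?X \<subseteq> L" using True by (auto intro: generate.incl)
        then show False using generate_subgroup_incl[OF _ sL] L(2) by blast
      qed
      moreover have "group_comm G y m \<in> L" if m: "m \<in> ?M" for m
      proof (rule comm_generate_right[OF L(1) y XM _ m])
        have TL: "T \<subseteq> L" using True by (auto intro: generate.incl)
        have yM: "y \<in> ?M" using XM by auto
        show "group_comm G y s \<in> L" if "s \<in> ?X" for s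
          using that y subgroup.one_closed[OF sL] TL normalises_comm(2)[OF L(1) _ yM]
          by auto
      qed
      ultimately show ?thesis using XM by blast
    next
      case False
      let ?U = "upper_central_over G ?D {\<one>}"
      \<comment> \<open>The first central term of \<open>?D\<close> not inside \<open>L\<close>: its
        elements commute with \<open>?D\<close> modulo \<open>L\<close>, because the preceding term
        is contained in \<open>L\<close>.\<close>
      define j where "j = (LEAST j. \<not> ?U j \<subseteq> L)"
      have "\<not> ?U c \<subseteq> L" using c False by blast
      then have j: "\<not> ?U j \<subseteq> L" "\<And>i. i < j \<Longrightarrow> ?U i \<subseteq> L"
        unfolding j_def by (rule LeastI, use not_less_Least in blast)
      have "j \<noteq> 0" using j(1) subgroup.one_closed[OF sL] by (cases j) auto
      then obtain i where i: "j = Suc i" using not0_implies_Suc by blast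
      obtain u where u: "u \<in> ?U (Suc i)" "u \<notin> L" using j(1) i by blast
      have nU: "normalises G ?M (?U (Suc i))"
        by (rule normalises_upper_central_over[OF MD normalises_one[OF sM] D1])
      have UD: "?U (Suc i) \<subseteq> ?D" using upper_central_over_normal(2)[OF D1] .
      \<comment> \<open>Commuting \<open>u\<close> with \<open>y\<close> stays in the chosen central
        term. The last commutator outside \<open>L\<close> commutes with \<open>y\<close> modulo
        \<open>L\<close> as well, hence with all of \<open>?M\<close>.\<close>
      define k where "k = (LEAST k. iter_comm G u k y \<in> L)"
      have "\<exists>k. iter_comm G u k y = \<one>" using e u UD DN by (auto simp: engel_on_def)
      then have "\<exists>k. iter_comm G u k y \<in> L" using subgroup.one_closed[OF sL] by metis
      then have k: "iter_comm G u k y \<in> L" "\<And>i. i < k \<Longrightarrow> iter_comm G u i y \<notin> L"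
        unfolding k_def by (rule LeastI_ex, use not_less_Least in blast)
      have "k \<noteq> 0" using k(1) u(2) by (cases k) auto
      then obtain l where l: "k = Suc l" using not0_implies_Suc by blast
      define z where "z = iter_comm G u l y"
      have yM: "y \<in> ?M" using XM by auto
      have zU: "z \<in> ?U (Suc i)" unfolding z_def by (rule normalises_iter_comm[OF nU yM u(1)])
      have zL: "z \<notin> L" "group_comm G z y \<in> L" using k l by (auto simp: z_def)
      have zM: "z \<in> ?M" using zU UD DM by blast
      have "group_comm G z m \<in> L" if m: "m \<in> ?M" for m
      proof (rule comm_generate_right[OF L(1) subgroup.mem_carrier[OF sM zM] XM _ m])
        have "group_comm G z s \<in> ?U i" if "s \<in> T" for s
          using zU generate.incl[OF that, of G] by auto
        then show "group_comm G z s \<in> L" if "s \<in> ?X" for s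
          using that zL(2) j(2)[of i] i by auto
      qed
      then show ?thesis using zM zL by blast
    qed
  qed
  then have "loc_nilpotent G ?M" by (rule loc_nilpotent_of_nilpotent[OF sM])
  moreover have "F \<subseteq> ?X" using F T by auto
  then have "S \<subseteq> ?M" using F(3) mono_generate[of F ?X] by blast
  ultimately show "\<exists>K. S \<subseteq> K \<and> loc_nilpotent G K" by blast
qed

text \<open>Induction on the nilpotency class of \<open>S\<close>. The term \<open>?C\<close> of the
  upper central series has smaller class and contains the commutators of \<open>S\<close>; a finite
  set of further elements of \<open>S\<close> is then adjoined one at a time as Engel
  elements.\<close>

lemma hirsch_plotkin_nilpotent:
  assumes N1: "loc_nilpotent G N1" and N2: "loc_nilpotent G N2"
    and n1: "normalises G N2 N1" and n2: "normalises G N1 N2"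
  shows "subgroup S G \<Longrightarrow> S \<subseteq> N2 \<Longrightarrow> S \<subseteq> upper_central_over G S {\<one>} c \<Longrightarrow>
    loc_nilpotent G (generate G (N1 \<union> S))"
proof (induction c arbitrary: S)
  case 0
  have s1: "subgroup N1 G" using N1 by (simp add: loc_nilpotent_def)
  have "N1 \<union> S = N1" using 0 subgroup.one_closed[OF s1] by auto
  then show ?case using N1 generate_of_subgroup[OF s1] by simp
next
  case (Suc c)
  have s1: "subgroup N1 G" and s2: "subgroup N2 G"
    using N1 N2 by (simp_all add: loc_nilpotent_def)
  note sG = subgroup.subset[OF s1] subgroup.subset[OF s2] subgroup.subset[OF Suc.prems(1)]
  let ?C = "upper_central_over G S {\<one>} c"
  have S1: "normalises G S {\<one>}" "{\<one>} \<subseteq> S"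
    using normalises_one subgroup.one_closed Suc.prems(1) by auto
  note nC = upper_central_over_normal[OF S1, of c]
  note sC = normalisesD(2)[OF nC(1)]
  \<comment> \<open>So \<open>?C\<close> has class at most \<open>c\<close>, as the induction
    hypothesis requires.\<close>
  have CC: "?C \<inter> upper_central_over G S {\<one>} c \<subseteq> upper_central_over G ?C {\<one>} c"
    by (rule upper_central_overI[OF sC]) (use nC(2) in auto)
  have X: "finite X \<Longrightarrow> X \<subseteq> S \<Longrightarrow> loc_nilpotent G (generate G (N1 \<union> ?C \<union> X))" for X
  proof (induction X rule: finite_induct)
    case empty
    then show ?case using Suc.IH[OF sC] nC(2) Suc.prems CC by auto
  next
    case (insert x X)
    let ?T = "N1 \<union> ?C \<union> X"
    have xS: "x \<in> S" "X \<subseteq> S" using insert by auto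
    have xG: "x \<in> carrier G" and TG: "?T \<subseteq> carrier G" using sG xS nC(2) by auto
    have comm: "group_comm G t s \<in> ?C" if "t \<in> S" "s \<in> S" for t s
      using Suc.prems(3) that by auto
    have sub: "generate G ?T \<subseteq> generate G (N1 \<union> N2)"
      using nC(2) xS Suc.prems(2) by (intro mono_generate) auto
    have nx: "normalises G (generate G {x}) (generate G ?T)"
    proof (rule normalises_generate_sets[OF _ TG])
      show "{x} \<subseteq> carrier G" using xG by auto
      have incl: "N1 \<subseteq> generate G ?T" "?C \<subseteq> generate G ?T" "X \<subseteq> generate G ?T"
        by (auto intro: generate.incl)
      have xN: "x \<in> N2" using xS Suc.prems by auto
      show "inv s \<otimes> t \<otimes> s \<in> generate G ?T" if s: "s \<in> {x}" and t: "t \<in> ?T" for s t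
      proof -
        \<comment> \<open>For \<open>t\<close> in \<open>X\<close> the conjugate \<open>t^x\<close>
          is \<open>t [t, x]\<close>, and \<open>[t, x]\<close> lies in \<open>?C\<close>; the parts
          \<open>N1\<close> and \<open>?C\<close> are normalised by \<open>x\<close> anyway.\<close>
        have "t \<otimes> group_comm G t x \<in> generate G ?T" if "t \<in> X"
          using that xS comm[of t x] incl by (intro generate.eng) auto
        moreover have "t \<in> X \<Longrightarrow> t \<in> carrier G" using TG by auto
        ultimately have "inv x \<otimes> t \<otimes> x \<in> generate G ?T" if "t \<in> X"
          using that xG by (simp add: free_group_simps)
        then show ?thesis
          using s t normalisesD(3)[OF n1 xN] normalisesD(3)[OF nC(1) xS(1)] incl by blast
      qed
      show "s \<otimes> t \<otimes> inv s \<in> generate G ?T" if s: "s \<in> {x}" and t: "t \<in> ?T" for s t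
      proof -
        have "inv x \<in> S" using subgroup.m_inv_closed[OF Suc.prems(1) xS(1)] .
        then have "t \<otimes> group_comm G t (inv x) \<in> generate G ?T" if "t \<in> X"
          using that xS comm[of t "inv x"] incl by (intro generate.eng) auto
        moreover have "t \<in> X \<Longrightarrow> t \<in> carrier G" using TG by auto
        ultimately have "x \<otimes> t \<otimes> inv x \<in> generate G ?T" if "t \<in> X"
          using that xG by (simp add: free_group_simps)
        then show ?thesis
          using s t normalisesD(4)[OF n1 xN] normalisesD(4)[OF nC(1) xS(1)] incl by blast
      qed
    qed
    have nN2: "normalises G (generate G (N1 \<union> N2)) N2"
      using sG normalisesD(3,4)[OF n2] normalisesD(3,4)[OF normalises_self[OF s2]]
      by (intro normalises_generateI s2) auto
    \<comment> \<open>One commutation moves any \<open>g\<close> into \<open>N2\<close>, which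
      contains \<open>x\<close>; the group generated by \<open>[g, x]\<close> and \<open>x\<close>
      is nilpotent, which ends the sequence.\<close>
    have "engel_on G (generate G ?T) x"
      unfolding engel_on_def
    proof
      fix g assume "g \<in> generate G ?T"
      then have "g \<in> generate G (N1 \<union> N2)" using sub by auto
      then have g: "group_comm G g x \<in> N2"
        using normalises_comm(2)[OF nN2] xS Suc.prems(2) by auto
      then have "nilpotent_over G (generate G {group_comm G g x, x}) {\<one>}"
        using N2 xS Suc.prems(2) by (auto simp: loc_nilpotent_def)
      then obtain k where "iter_comm G (group_comm G g x) k x = \<one>"
        using nilpotent_engel by (meson generate.incl insertCI)
      then show "\<exists>k. iter_comm G g k x = \<one>" unfolding iter_comm_Suc[symmetric] by blast
    qed
    then have "loc_nilpotent G (generate G (insert x (generate G ?T)))"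
      using insert.IH[OF xS(2)] loc_nilpotent_insert_engel[OF _ xG nx] by blast
    then show ?case using generate_Un_generate[of "{x}" ?T] xG TG by auto
  qed
  show ?case
  proof (rule loc_nilpotentI)
    show "subgroup (generate G (N1 \<union> S)) G" using sG by (intro generate_is_subgroup) auto
    fix Q assume Q: "finite Q" "Q \<subseteq> generate G (N1 \<union> S)"
    then obtain F where F: "finite F" "F \<subseteq> N1 \<union> S" "Q \<subseteq> generate G F"
      using generate_finite_support_set[OF Q] by blast
    have "generate G F \<subseteq> generate G (N1 \<union> ?C \<union> (F \<inter> S))" using F by (intro mono_generate) auto
    then show "\<exists>K. Q \<subseteq> K \<and> loc_nilpotent G K" using X[of "F \<inter> S"] F by blast
  qed
qed

text \<open>A finite subset of the join involves only finitely many elements of \<open>N2\<close>,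
  and these generate a nilpotent group, so the previous lemma applies to it.\<close>

theorem hirsch_plotkin:
  assumes N1: "loc_nilpotent G N1" and N2: "loc_nilpotent G N2"
    and n1: "normalises G N2 N1" and n2: "normalises G N1 N2"
  shows "loc_nilpotent G (generate G (N1 \<union> N2))"
proof (rule loc_nilpotentI)
  have s1: "subgroup N1 G" and s2: "subgroup N2 G"
    using N1 N2 by (simp_all add: loc_nilpotent_def)
  note sG = subgroup.subset[OF s1] subgroup.subset[OF s2]
  show "subgroup (generate G (N1 \<union> N2)) G" using sG by (intro generate_is_subgroup) auto
  fix Q assume Q: "finite Q" "Q \<subseteq> generate G (N1 \<union> N2)"
  then obtain F where F: "finite F" "F \<subseteq> N1 \<union> N2" "Q \<subseteq> generate G F"
    using generate_finite_support_set[OF Q] by blast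
  let ?S = "generate G (F \<inter> N2)"
  have "nilpotent_over G ?S {\<one>}" using N2 F by (auto simp: loc_nilpotent_def)
  then obtain c where c: "?S \<subseteq> upper_central_over G ?S {\<one>} c" by (auto simp: nilpotent_over_def)
  have "F \<inter> N2 \<subseteq> carrier G" using sG by auto
  then have "loc_nilpotent G (generate G (N1 \<union> ?S))"
    using hirsch_plotkin_nilpotent[OF assms _ _ c] generate_is_subgroup
      generate_subgroup_incl[OF _ s2, of "F \<inter> N2"] by auto
  moreover have "generate G F \<subseteq> generate G (N1 \<union> ?S)"
    using F by (intro mono_generate) (auto intro: generate.incl)
  ultimately show "\<exists>K. Q \<subseteq> K \<and> loc_nilpotent G K" using F by blast
qed

lemma normalises_generate_Union:
  assumes R: "subgroup R G" and P: "\<And>P. P \<in> \<P> \<Longrightarrow> normalises G R P"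
  shows "normalises G R (generate G (\<Union>\<P>))"
proof (rule normalises_generate_right[OF R])
  show "\<Union>\<P> \<subseteq> carrier G" using subgroup.subset[OF normalisesD(2)[OF P]] by blast
  show "inv h \<otimes> x \<otimes> h \<in> generate G (\<Union>\<P>)" if "h \<in> R" "x \<in> \<Union>\<P>" for h x
    using that normalisesD(3)[OF P] by (blast intro: generate.incl)
qed

text \<open>Kept abstract in \<open>Q\<close> because it serves both local nilpotence and local
  finiteness. The common normaliser \<open>R\<close> ensures that partial joins and further members
  normalise each other.\<close>

lemma local_property_Union:
  assumes loc: "\<And>H. subgroup H G \<Longrightarrow>
      (\<And>S. finite S \<Longrightarrow> S \<subseteq> H \<Longrightarrow> \<exists>K. S \<subseteq> K \<and> Q K) \<Longrightarrow> Q H"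
    and one: "Q {\<one>}"
    and bin: "\<And>A B. Q A \<Longrightarrow> Q B \<Longrightarrow> normalises G B A \<Longrightarrow> normalises G A B \<Longrightarrow>
      Q (generate G (A \<union> B))"
    and R: "subgroup R G"
    and P: "\<And>P. P \<in> \<P> \<Longrightarrow> normalises G R P" "\<And>P. P \<in> \<P> \<Longrightarrow> P \<subseteq> R" "\<And>P. P \<in> \<P> \<Longrightarrow> Q P"
  shows "Q (generate G (\<Union>\<P>))"
proof (rule loc)
  have UG: "\<Union>\<P> \<subseteq> carrier G" using P(2) subgroup.subset[OF R] by blast
  show "subgroup (generate G (\<Union>\<P>)) G" by (rule generate_is_subgroup[OF UG])
  fix S assume S: "finite S" "S \<subseteq> generate G (\<Union>\<P>)"
  then obtain F where F: "finite F" "F \<subseteq> \<Union>\<P>" "S \<subseteq> generate G F"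
    using generate_finite_support_set[OF S] by blast
  obtain \<F> where \<F>: "finite \<F>" "\<F> \<subseteq> \<P>" "F \<subseteq> \<Union>\<F>"
    using finite_subset_Union[OF F(1,2)] by blast
  have "\<F> \<subseteq> \<P> \<Longrightarrow> Q (generate G (\<Union>\<F>))"
    using \<F>(1)
  proof (induction \<F> rule: finite_induct)
    case empty
    show ?case using one by (simp add: generate_empty)
  next
    case (insert P \<F>)
    let ?K = "generate G (\<Union>\<F>)"
    have PP: "P \<in> \<P>" "\<F> \<subseteq> \<P>" using insert by auto
    have UF: "\<Union>\<F> \<subseteq> carrier G" "P \<subseteq> carrier G" using UG PP by auto
    have nK: "normalises G R ?K" using normalises_generate_Union[OF R] P(1) PP(2) by blast
    have KR: "?K \<subseteq> R" using P(2) PP(2) R by (intro generate_subgroup_incl) auto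
    have "Q (generate G (P \<union> ?K))"
      by (rule bin)
        (use insert.IH PP P normalises_subgroup[OF nK] normalises_subgroup[OF P(1)[OF PP(1)]]
          normalisesD(2)[OF P(1)[OF PP(1)]] normalisesD(2)[OF nK] KR in auto)
    then show ?case using generate_Un_generate UF by auto
  qed
  then have "Q (generate G (\<Union>\<F>))" using \<F>(2) by blast
  moreover have "generate G F \<subseteq> generate G (\<Union>\<F>)" using \<F> by (intro mono_generate)
  ultimately show "\<exists>K. S \<subseteq> K \<and> Q K" using F by blast
qed

lemma hirsch_plotkin_Union:
  assumes "subgroup R G"
    and "\<And>P. P \<in> \<P> \<Longrightarrow> normalises G R P" "\<And>P. P \<in> \<P> \<Longrightarrow> P \<subseteq> R"
      "\<And>P. P \<in> \<P> \<Longrightarrow> loc_nilpotent G P"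
  shows "loc_nilpotent G (generate G (\<Union>\<P>))"
proof (rule local_property_Union[where R = R and Q = "loc_nilpotent G"])
  show "loc_nilpotent G {\<one>}"
    by (rule loc_nilpotent_of_nilpotent[OF triv_subgroup nilpotent_over_self])
  show "loc_nilpotent G H" if "subgroup H G"
    "\<And>S. finite S \<Longrightarrow> S \<subseteq> H \<Longrightarrow> \<exists>K. S \<subseteq> K \<and> loc_nilpotent G K" for H
    using that by (rule loc_nilpotentI)
  show "loc_nilpotent G (generate G (A \<union> B))"
    if "loc_nilpotent G A" "loc_nilpotent G B" "normalises G B A" "normalises G A B" for A B
    using that by (rule hirsch_plotkin)
qed (use assms in simp_all)

end

section \<open>Finite normal sets of Engel elements\<close>

context group
begin

text \<open>Finiteness of \<open>A\<close> replaces the second conjugation condition: an injective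
  map of a finite set into itself is onto, so inverses of generators preserve \<open>A\<close>
  too.\<close>

lemma conj_closed_generate:
  assumes A: "finite A" "A \<subseteq> carrier G" and S: "S \<subseteq> carrier G"
    and c: "\<And>s a. s \<in> S \<Longrightarrow> a \<in> A \<Longrightarrow> inv s \<otimes> a \<otimes> s \<in> A"
    and g: "g \<in> generate G S" and a: "a \<in> A"
  shows "inv g \<otimes> a \<otimes> g \<in> A"
  using g a
proof (induction arbitrary: a)
  case one
  then show ?case using A by auto
next
  case (incl h)
  then show ?case using c by auto
next
  case (inv h)
  let ?f = "\<lambda>a. inv h \<otimes> a \<otimes> h"
  have hG: "h \<in> carrier G" using inv S by auto
  have "inj_on ?f A"
  proof (rule inj_onI)
    fix u v assume "u \<in> A" "v \<in> A" "?f u = ?f v"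
    then have "h \<otimes> ?f u \<otimes> inv h = h \<otimes> ?f v \<otimes> inv h" "u \<in> carrier G" "v \<in> carrier G"
      using A by auto
    then show "u = v" using hG by (simp add: free_group_simps)
  qed
  then have "?f ` A = A" using c inv(1) A(1) by (intro endo_inj_surj) auto
  then obtain u where u: "u \<in> A" "a = ?f u" using inv(2) by blast
  then have "inv (inv h) \<otimes> a \<otimes> inv h = u" using A hG by (auto simp: free_group_simps subset_iff)
  then show ?case using u by simp
next
  case (eng h1 h2)
  have h: "h1 \<in> carrier G" "h2 \<in> carrier G" using eng generate_in_carrier[OF S] by auto
  have "inv h2 \<otimes> (inv h1 \<otimes> a \<otimes> h1) \<otimes> h2 \<in> A" using eng by blast
  moreover have "a \<in> carrier G" using eng A by auto
  ultimately show ?case using h by (simp add: free_group_simps)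
qed

lemma conj_group_hom:
  "t \<in> carrier G \<Longrightarrow> group_hom G G (\<lambda>x. inv t \<otimes> x \<otimes> t)"
  unfolding group_hom_def group_hom_axioms_def hom_def
  by (auto simp: free_group_simps)

lemma nilpotent_conj:
  assumes t: "t \<in> carrier G" and D: "D \<subseteq> carrier G" and n: "nilpotent_over G (generate G D) {\<one>}"
  shows "nilpotent_over G (generate G ((\<lambda>x. inv t \<otimes> x \<otimes> t) ` D)) {\<one>}"
proof -
  interpret c: group_hom G G "\<lambda>x. inv t \<otimes> x \<otimes> t" by (rule conj_group_hom[OF t])
  have "nilpotent_over G (generate G D) (generate G D \<inter> kernel G G (\<lambda>x. inv t \<otimes> x \<otimes> t))"
    using nilpotent_over_mono[OF n _ generate_is_subgroup[OF D]] generate.one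
      subgroup.one_closed[OF c.subgroup_kernel] by blast
  then show ?thesis using c.nilpotent_over_img_iff[OF D] c.generate_img[OF D] by simp
qed

lemma nilpotent_cyclic:
  assumes "x \<in> carrier G"
  shows "nilpotent_over G (generate G {x}) {\<one>}"
proof -
  have X: "{x} \<subseteq> carrier G" using assms by auto
  have "left_comms G {x} 1 \<subseteq> {\<one>}" using assms by auto
  then show ?thesis
    using nilpotent_over_iff_left_comms[OF X refl normalises_one[OF generate_is_subgroup[OF X]]]
      generate.one by blast
qed

text \<open>The normaliser condition for nilpotent groups, for generating sets instead of subgroups.
  With \<open>?J\<close> generated by \<open>I\<close>, take the first \<open>k\<close> for which
  the product of \<open>?J\<close> and the \<open>k\<close>-th central term contains an element of
  \<open>D\<close> outside \<open>I\<close>; that element normalises \<open>I\<close>.\<close>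

lemma nilpotent_normaliser_grows:
  assumes D: "D \<subseteq> carrier G" and n: "nilpotent_over G (generate G D) {\<one>}"
    and I: "I \<subset> D" "D \<inter> generate G I \<subseteq> I"
    and c: "\<And>x y. x \<in> D \<Longrightarrow> y \<in> D \<Longrightarrow> inv x \<otimes> y \<otimes> x \<in> D"
  shows "\<exists>x\<in>D - I. \<forall>u\<in>I. inv x \<otimes> u \<otimes> x \<in> I"
proof -
  let ?H = "generate G D" and ?J = "generate G I"
  define U where "U = upper_central_over G ?H {\<one>}"
  have sH: "subgroup ?H G" using generate_is_subgroup[OF D] .
  have IG: "I \<subseteq> carrier G" using I D by auto
  have sJ: "subgroup ?J G" using generate_is_subgroup[OF IG] .
  have JH: "?J \<subseteq> ?H" using I by (intro mono_generate) auto
  have H1: "normalises G ?H {\<one>}" "{\<one>} \<subseteq> ?H" using normalises_one[OF sH] generate.one by auto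
  have UH: "U k \<subseteq> ?H" for k unfolding U_def using upper_central_over_normal(2)[OF H1] .
  define JZ where "JZ k = {j \<otimes> z | j z. j \<in> ?J \<and> z \<in> U k}" for k
  obtain m where m: "?H \<subseteq> U m" using n by (auto simp: nilpotent_over_def U_def)
  have "D \<subseteq> JZ m"
  proof
    fix d assume d: "d \<in> D"
    then have "d \<in> U m" "d = \<one> \<otimes> d" using m D by (auto intro: generate.incl)
    then show "d \<in> JZ m" unfolding JZ_def using generate.one by blast
  qed
  then have ex: "\<not> D \<inter> JZ m \<subseteq> I" using I by auto
  define k where "k = (LEAST k. \<not> D \<inter> JZ k \<subseteq> I)"
  have k: "\<not> D \<inter> JZ k \<subseteq> I" "\<And>i. i < k \<Longrightarrow> D \<inter> JZ i \<subseteq> I"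
    using LeastI[of "\<lambda>k. \<not> D \<inter> JZ k \<subseteq> I", OF ex] not_less_Least[of _ "\<lambda>k. \<not> D \<inter> JZ k \<subseteq> I"]
    unfolding k_def by blast+
  have "JZ 0 \<subseteq> ?J" using subgroup.mem_carrier[OF sJ] by (auto simp: JZ_def U_def)
  then have "k \<noteq> 0" using k(1) I(2) by (cases k) auto
  then obtain i where i: "k = Suc i" using not0_implies_Suc by blast
  obtain x where x: "x \<in> D" "x \<in> JZ (Suc i)" "x \<notin> I" using k(1) i by blast
  then obtain j z where jz: "x = j \<otimes> z" "j \<in> ?J" "z \<in> U (Suc i)" by (auto simp: JZ_def)
  have zG: "z \<in> carrier G" and jG: "j \<in> carrier G"
    using jz UH[of "Suc i"] subgroup.mem_carrier[OF sH] JH by blast+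
  have "inv x \<otimes> u \<otimes> x \<in> I" if u: "u \<in> I" for u
  proof -
    have uG: "u \<in> carrier G" using u IG by auto
    define w where "w = inv j \<otimes> u \<otimes> j"
    have w: "w \<in> ?J" unfolding w_def
      using jz(2) u subgroup.m_closed[OF sJ] subgroup.m_inv_closed[OF sJ] generate.incl[of u I G]
      by auto
    have wG: "w \<in> carrier G" using w subgroup.mem_carrier[OF sJ] by auto
    have "group_comm G z w \<in> U i" using jz(3) w JH by (auto simp: U_def)
    then have "group_comm G w z \<in> U i"
      using comm_swap_mem[OF normalisesD(2)[OF upper_central_over_normal(1)[OF H1]] zG wG]
      by (auto simp: U_def)
    then have "w \<otimes> group_comm G w z \<in> JZ i" using w by (auto simp: JZ_def)
    \<comment> \<open>Modulo the \<open>i\<close>-th central term, \<open>x\<close> acts on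
      \<open>I\<close> like \<open>j\<close>, so the conjugate falls into \<open>JZ i\<close>; by
      minimality of \<open>k\<close> this meets \<open>D\<close> only inside
      \<open>I\<close>.\<close>
    moreover have "inv x \<otimes> u \<otimes> x = w \<otimes> group_comm G w z"
      unfolding w_def using jz(1) zG jG uG by (simp add: free_group_simps)
    moreover have "inv x \<otimes> u \<otimes> x \<in> D" using c[of x u] x(1) u I by auto
    ultimately show ?thesis using k(2)[of i] i by auto
  qed
  then show ?thesis using x by blast
qed

text \<open>The proof follows the pattern of the Baer--Suzuki theorem: two distinct maximal nilpotently
  generated subsets of \<open>X\<close> with largest possible intersection \<open>I\<close> yield \<open>x\<close>, \<open>y\<close> outside \<open>I\<close>
  normalising \<open>I\<close>, and the Engel condition for \<open>x\<close> on \<open>y\<close> then forces one set into the other.\<close>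

theorem baer_finite_engel_set:
  assumes fin: "finite X" and XG: "X \<subseteq> carrier G"
    and conj: "\<And>x y. x \<in> X \<Longrightarrow> y \<in> X \<Longrightarrow> inv x \<otimes> y \<otimes> x \<in> X"
    and eng: "\<And>x. x \<in> X \<Longrightarrow> engel_on G (generate G X) x"
  shows "nilpotent_over G (generate G X) {\<one>}"
proof -
  define nil where "nil = {D. D \<subseteq> X \<and> nilpotent_over G (generate G D) {\<one>}}"
  define mx where "mx = {D \<in> nil. \<forall>E\<in>nil. D \<subseteq> E \<longrightarrow> D = E}"
  define \<phi> where "\<phi> t D = (\<lambda>x. inv t \<otimes> x \<otimes> t) ` D" for t D
  have sX: "subgroup (generate G X) G" using generate_is_subgroup[OF XG] .
  have finnil: "finite nil" using fin by (auto simp: nil_def intro: finite_subset[of _ "Pow X"])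
  have ex: "\<exists>M\<in>mx. D \<subseteq> M" if "D \<in> nil" for D
    using finite_has_maximal2[OF finnil that] by (auto simp: mx_def)
  have mxX: "D \<subseteq> X" "D \<subseteq> carrier G" "finite D" "D \<in> nil" "nilpotent_over G (generate G D) {\<one>}"
    if "D \<in> mx" for D
    using that XG fin finite_subset by (auto simp: mx_def nil_def)
  have conjX: "inv g \<otimes> x \<otimes> g \<in> X" if "g \<in> generate G X" "x \<in> X" for g x
    using conj_closed_generate[OF fin XG XG conj that] .
  \<comment> \<open>Maximality absorbs every element of \<open>X\<close> in the generated subgroup;
    hence \<open>D\<close> is closed under conjugation by that subgroup, which the normaliser lemma
    needs.\<close>
  have closed: "X \<inter> generate G D = D" if D: "D \<in> mx" for D
  proof -
    have "generate G (X \<inter> generate G D) \<subseteq> generate G D"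
      using mxX[OF D] by (intro generate_idem) auto
    then have "nilpotent_over G (generate G (X \<inter> generate G D)) {\<one>}"
      using nilpotent_over_subgroup[OF mxX(5)[OF D]] generate_is_subgroup[of "X \<inter> generate G D"] XG
      by blast
    then have "X \<inter> generate G D \<in> nil" by (auto simp: nil_def)
    moreover have "D \<subseteq> X \<inter> generate G D" using mxX(1)[OF D] by (auto intro: generate.incl)
    ultimately show ?thesis using D unfolding mx_def by blast
  qed
  have conjD: "inv g \<otimes> d \<otimes> g \<in> D" if D: "D \<in> mx" and g: "g \<in> generate G D" and d: "d \<in> D" for D g d
  proof -
    have sD: "subgroup (generate G D) G" using generate_is_subgroup mxX(2)[OF D] by blast
    have "g \<in> generate G X" using mono_generate[OF mxX(1)[OF D]] g by blast
    then have "inv g \<otimes> d \<otimes> g \<in> X" using conjX mxX(1)[OF D] d by blast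
    moreover have "inv g \<otimes> d \<otimes> g \<in> generate G D"
      using g d generate.incl[of d D G] subgroup.m_closed[OF sD] subgroup.m_inv_closed[OF sD] by auto
    ultimately show ?thesis using closed[OF D] by blast
  qed
  have phi_nil: "\<phi> t D \<in> nil" if "t \<in> generate G X" "D \<in> nil" for t D
    using that conjX nilpotent_conj[of t D] subgroup.mem_carrier[OF sX] XG
    by (auto simp: nil_def \<phi>_def)
  have phi_inv: "\<phi> t (\<phi> (inv t) E) = E" "\<phi> (inv t) (\<phi> t E) = E" if "t \<in> carrier G" "E \<subseteq> carrier G" for t E
  proof -
    have a: "inv t \<otimes> (inv (inv t) \<otimes> x \<otimes> inv t) \<otimes> t = x"
      "inv (inv t) \<otimes> (inv t \<otimes> x \<otimes> t) \<otimes> inv t = x" if "x \<in> E" for x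
      using that \<open>t \<in> carrier G\<close> \<open>E \<subseteq> carrier G\<close> by (auto simp: free_group_simps subset_iff)
    show "\<phi> t (\<phi> (inv t) E) = E" "\<phi> (inv t) (\<phi> t E) = E"
      unfolding \<phi>_def image_image using a by simp_all
  qed
  have phi_mx: "\<phi> t D \<in> mx" if t: "t \<in> generate G X" and D: "D \<in> mx" for t D
  proof -
    have tG: "t \<in> carrier G" using t subgroup.mem_carrier[OF sX] by auto
    have "\<phi> t D = E" if E: "E \<in> nil" "\<phi> t D \<subseteq> E" for E
    proof -
      have EG: "E \<subseteq> carrier G" using E(1) XG by (auto simp: nil_def)
      have "\<phi> (inv t) (\<phi> t D) \<subseteq> \<phi> (inv t) E" using E(2) unfolding \<phi>_def by (rule image_mono)
      then have "D \<subseteq> \<phi> (inv t) E" using phi_inv(2)[OF tG mxX(2)[OF D]] by simp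
      then have "D = \<phi> (inv t) E"
        using D phi_nil[OF subgroup.m_inv_closed[OF sX t] E(1)] by (auto simp: mx_def)
      then show ?thesis using phi_inv(1)[OF tG EG] by simp
    qed
    then show ?thesis using phi_nil[OF t mxX(4)[OF D]] by (auto simp: mx_def)
  qed
  have "D = D'" if "D \<in> mx" "D' \<in> mx" for D D'
  proof (rule ccontr)
    assume ne: "D \<noteq> D'"
    define P where "P = (\<lambda>p. fst p \<in> mx \<and> snd p \<in> mx \<and> fst p \<noteq> snd p)"
    have "P (D, D')" using that ne by (auto simp: P_def)
    moreover have "\<forall>p. P p \<longrightarrow> card (fst p \<inter> snd p) < Suc (card X)"
      using mxX(1) fin by (auto simp: P_def less_Suc_eq_le intro!: card_mono)
    \<comment> \<open>A pair of distinct maximal sets with largest intersection: a maximal set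
      meeting \<open>D1\<close> in more than \<open>I\<close> must be \<open>D1\<close>
      itself.\<close>
    ultimately obtain p where p: "P p" "\<And>q. P q \<Longrightarrow> card (fst q \<inter> snd q) \<le> card (fst p \<inter> snd p)"
      using ex_has_greatest_nat[of P "(D, D')" "\<lambda>p. card (fst p \<inter> snd p)"] by blast
    define D1 D2 where "D1 = fst p" and "D2 = snd p"
    define I where "I = D1 \<inter> D2"
    have D12: "D1 \<in> mx" "D2 \<in> mx" "D1 \<noteq> D2" using p(1) by (auto simp: P_def D1_def D2_def)
    have big: "E = D1" if "E \<in> mx" "card I < card (D1 \<inter> E)" for E
      using p(2)[of "(D1, E)"] that D12 by (auto simp: P_def I_def D1_def D2_def)
    have IG: "I \<subseteq> carrier G" "finite I" using mxX[OF D12(1)] by (auto simp: I_def)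
    have grow: "\<exists>x\<in>E - I. \<forall>u\<in>I. inv x \<otimes> u \<otimes> x \<in> I" if E: "E = D1 \<or> E = D2" for E
    proof (rule nilpotent_normaliser_grows)
      have Em: "E \<in> mx" using E D12 by auto
      show "E \<subseteq> carrier G" "nilpotent_over G (generate G E) {\<one>}" using mxX[OF Em] by auto
      have "\<not> D1 \<subseteq> D2" "\<not> D2 \<subseteq> D1" using D12 by (auto simp: mx_def)
      then show "I \<subset> E" using E by (auto simp: I_def)
      have "generate G I \<subseteq> generate G D1 \<inter> generate G D2"
        using mono_generate[of I D1] mono_generate[of I D2] by (auto simp: I_def)
      then show "E \<inter> generate G I \<subseteq> I"
        using closed[OF D12(1)] closed[OF D12(2)] E mxX(1)[OF D12(1)] mxX(1)[OF D12(2)]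
        unfolding I_def by blast
      show "inv x \<otimes> y \<otimes> x \<in> E" if "x \<in> E" "y \<in> E" for x y
        using conjD[OF Em generate.incl[OF that(1)] that(2)] .
    qed
    obtain x where x: "x \<in> D1" "x \<notin> I" "\<And>u. u \<in> I \<Longrightarrow> inv x \<otimes> u \<otimes> x \<in> I"
      using grow[of D1] by blast
    obtain y where y: "y \<in> D2" "y \<notin> I" "\<And>u. u \<in> I \<Longrightarrow> inv y \<otimes> u \<otimes> y \<in> I"
      using grow[of D2] by blast
    have xy: "x \<in> X" "y \<in> X" "{x, y} \<subseteq> carrier G"
      using x(1) y(1) mxX(1)[OF D12(1)] mxX(1)[OF D12(2)] XG by auto
    have xyX: "generate G {x, y} \<subseteq> generate G X" using xy by (intro mono_generate) auto
    \<comment> \<open>Such a \<open>t\<close> preserves \<open>I\<close>, so \<open>D1\<close> and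
      its conjugate share \<open>I\<close> and also \<open>e\<close>; by the choice of the pair they
      coincide. Then \<open>t\<close> is an Engel element normalising a nilpotent group and can be
      adjoined to it, and maximality puts \<open>t\<close> into \<open>D1\<close>.\<close>
    have star: "t \<in> D1" if t: "t \<in> X" "t \<in> generate G {x, y}" and e: "e \<in> D1" "e \<notin> I" "e \<in> \<phi> t D1" for t e
    proof -
      have tX: "t \<in> generate G X" using generate.incl[OF t(1)] .
      have tG: "t \<in> carrier G" using t XG by auto
      have "inv t \<otimes> u \<otimes> t \<in> I" if "u \<in> I" for u
        by (rule conj_closed_generate[OF IG(2,1) xy(3) _ t(2) that]) (use x y in auto)
      then have It: "\<phi> t I \<subseteq> I" by (auto simp: \<phi>_def)
      have "inj_on (\<lambda>x. inv t \<otimes> x \<otimes> t) I"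
        using tG IG by (auto intro!: inj_onI simp: subset_iff)
      then have "\<phi> t I = I" using It IG(2) unfolding \<phi>_def by (intro endo_inj_surj)
      moreover have "\<phi> t I \<subseteq> \<phi> t D1" by (auto simp: \<phi>_def I_def)
      ultimately have "insert e I \<subseteq> D1 \<inter> \<phi> t D1" using e by (auto simp: I_def)
      then have "card (insert e I) \<le> card (D1 \<inter> \<phi> t D1)"
        using mxX(3)[OF D12(1)] by (intro card_mono) auto
      then have "card I < card (D1 \<inter> \<phi> t D1)" using e IG(2) by simp
      then have eq: "\<phi> t D1 = D1" using big phi_mx[OF tX D12(1)] by blast
      have D1G: "D1 \<subseteq> carrier G" using mxX[OF D12(1)] by auto
      have sD: "subgroup (generate G D1) G" using generate_is_subgroup[OF D1G] .
      have c: "inv s \<otimes> d \<otimes> s \<in> D1" if "s \<in> generate G {t}" "d \<in> D1" for s d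
      proof (rule conj_closed_generate[OF mxX(3)[OF D12(1)] D1G _ _ that])
        show "{t} \<subseteq> carrier G" using tG by auto
        show "inv s \<otimes> a \<otimes> s \<in> D1" if "s \<in> {t}" "a \<in> D1" for s a
          using that eq unfolding \<phi>_def by blast
      qed
      have nt: "normalises G (generate G {t}) (generate G D1)"
        using c generate_is_subgroup[of "{t}"] tG D1G
        by (intro normalises_generate_right) (auto intro: generate.incl)
      have "engel_on G (generate G D1) t"
        using eng[OF t(1)] mono_generate[OF mxX(1)[OF D12(1)]] unfolding engel_on_def by blast
      moreover have "loc_nilpotent G (generate G D1)"
        using loc_nilpotent_of_nilpotent[OF sD mxX(5)[OF D12(1)]] .
      ultimately have "loc_nilpotent G (generate G (insert t (generate G D1)))"
        using loc_nilpotent_insert_engel tG nt by blast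
      moreover have "generate G (insert t (generate G D1)) = generate G (insert t D1)"
        using generate_Un_generate[of "{t}" D1] tG D1G by simp
      ultimately have "loc_nilpotent G (generate G (insert t D1))" by simp
      moreover have "finite (insert t D1)" "insert t D1 \<subseteq> generate G (insert t D1)"
        using mxX(3)[OF D12(1)] by (auto intro: generate.incl)
      ultimately have "nilpotent_over G (generate G (insert t D1)) {\<one>}"
        unfolding loc_nilpotent_def by blast
      then have "insert t D1 \<in> nil" using t mxX(1)[OF D12(1)] by (auto simp: nil_def)
      then show "t \<in> D1" using D12(1) unfolding mx_def by blast
    qed
    have yD1: "y \<notin> D1" using y by (auto simp: I_def)
    \<comment> \<open>The conjugates of \<open>x\<close> by \<open>[y,_i x]\<close> start at
      \<open>x^y\<close> and end at \<open>x\<close> by the Engel condition. The first one in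
      \<open>D1\<close> is played against \<open>star\<close>.\<close>
    define c where "c i = iter_comm G y i x" for i
    define Y where "Y i = inv (c i) \<otimes> x \<otimes> c i" for i
    have gx: "x \<in> generate G {x, y}" "y \<in> generate G {x, y}" by (auto intro: generate.incl)
    have sxy: "subgroup (generate G {x, y}) G" using generate_is_subgroup[OF xy(3)] .
    have c: "c i \<in> generate G {x, y}" for i
      unfolding c_def using normalises_iter_comm[OF normalises_self[OF sxy] gx] .
    have cG: "c i \<in> carrier G" for i using c subgroup.mem_carrier[OF sxy] by blast
    have YX: "Y i \<in> X" for i unfolding Y_def using conjX c xyX xy(1) by blast
    have Yg: "Y i \<in> generate G {x, y}" for i
      unfolding Y_def
      using c[of i] gx subgroup.m_closed[OF sxy] subgroup.m_inv_closed[OF sxy] by auto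
    obtain k where "iter_comm G y k x = \<one>"
      using eng[OF xy(1)] generate.incl[OF xy(2), of G] by (auto simp: engel_on_def)
    then have "Y k = x" using xy by (simp add: Y_def c_def)
    then have exY: "\<exists>k. Y k \<in> D1" using x by metis
    define l where "l = (LEAST k. Y k \<in> D1)"
    have l: "Y l \<in> D1" "\<And>i. i < l \<Longrightarrow> Y i \<notin> D1"
      unfolding l_def by (rule LeastI_ex[OF exY], use not_less_Least in blast)
    show False
    proof (cases l)
      case 0
      \<comment> \<open>Here \<open>x^y\<close> is in \<open>D1\<close> and in the conjugate of
        \<open>D1\<close> by \<open>y\<close>, but not in \<open>I\<close>, since \<open>y\<close>
        normalises \<open>I\<close> and \<open>x\<close> is outside. So \<open>star\<close> would
        put \<open>y\<close> into \<open>D1\<close>.\<close>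
      have "Y 0 \<in> \<phi> y D1" using x(1) by (auto simp: Y_def c_def \<phi>_def)
      moreover have "Y 0 \<notin> I"
      proof
        assume "Y 0 \<in> I"
        then have "inv (inv y) \<otimes> Y 0 \<otimes> inv y \<in> I"
          by (intro conj_closed_generate[OF IG(2,1) xy(3) _ generate.inv])
            (use x(3) y(3) in auto)
        then show False using x(2) xy(3) by (simp add: Y_def c_def free_group_simps)
      qed
      ultimately show False using star[OF xy(2) gx(2), of "Y 0"] l(1) 0 yD1 by auto
    next
      case (Suc i)
      have YG: "Y i \<in> carrier G" using YX XG by auto
      \<comment> \<open>This identity makes a conjugate of \<open>Y (Suc i)\<close> by
        \<open>x\<close> a conjugate of \<open>x\<close> by \<open>Y i\<close>. So \<open>x\<close>
        lies in the conjugate of \<open>D1\<close> by \<open>Y i\<close>, and \<open>star\<close>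
        puts \<open>Y i\<close> into \<open>D1\<close>, against minimality of
        \<open>l\<close>.\<close>
      have "c (Suc i) = inv (Y i) \<otimes> x"
        using cG[of i] xy(3) by (simp add: Y_def c_def free_group_simps)
      then have "Y (Suc i) = inv (inv (Y i) \<otimes> x) \<otimes> x \<otimes> (inv (Y i) \<otimes> x)"
        by (simp add: Y_def)
      then have *: "x \<otimes> Y (Suc i) \<otimes> inv x = Y i \<otimes> x \<otimes> inv (Y i)"
        using YG xy(3) by (simp add: free_group_simps)
      have "inv (inv x) \<otimes> Y (Suc i) \<otimes> inv x \<in> D1"
        by (rule conjD[OF D12(1) generate.inv[OF x(1)]]) (use l Suc in auto)
      then have "Y i \<otimes> x \<otimes> inv (Y i) \<in> D1" using * xy(3) by simp
      then have "inv (Y i) \<otimes> (Y i \<otimes> x \<otimes> inv (Y i)) \<otimes> Y i \<in> \<phi> (Y i) D1"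
        unfolding \<phi>_def by blast
      moreover have "inv (Y i) \<otimes> (Y i \<otimes> x \<otimes> inv (Y i)) \<otimes> Y i = x"
        using YG xy(3) by (simp add: free_group_simps)
      ultimately have "x \<in> \<phi> (Y i) D1" by simp
      then show False using star[OF YX Yg x(1,2)] l(2)[of i] Suc by auto
    qed
  qed
  moreover have "\<exists>D\<in>mx. x \<in> D" if "x \<in> X" for x
  proof -
    have "{x} \<in> nil" using that XG nilpotent_cyclic by (auto simp: nil_def)
    then show ?thesis using ex[of "{x}"] by auto
  qed
  moreover have "\<exists>D\<in>mx. True"
  proof -
    have "{} \<in> nil" using nilpotent_over_self[of "{\<one>}"] by (simp add: nil_def generate_empty)
    then show ?thesis using ex by blast
  qed
  ultimately obtain D where "D \<in> mx" "X \<subseteq> D" by blast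
  then show ?thesis using mxX[of D] by auto
qed

end

section \<open>Engel elements in locally soluble and locally finite extensions\<close>

text \<open>Usually written \<open>e^A\<close>. For \<open>A = M\<close> containing \<open>e\<close>
  this is the normal closure of \<open>e\<close> in \<open>M\<close>, and its local nilpotence puts
  \<open>e\<close> into the Hirsch--Plotkin radical of \<open>M\<close>.\<close>

definition conj_closure :: "('a, 'b) monoid_scheme \<Rightarrow> 'a set \<Rightarrow> 'a \<Rightarrow> 'a set" where
  "conj_closure G A e = generate G ((\<lambda>a. inv\<^bsub>G\<^esub> a \<otimes>\<^bsub>G\<^esub> e \<otimes>\<^bsub>G\<^esub> a) ` A)"

text \<open>Finitely many right cosets \<open>A f\<close> cover \<open>B\<close>. The
  representatives may lie outside \<open>B\<close>, and \<open>A\<close> need not lie in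
  \<open>B\<close>, which makes the notion monotone in both arguments.\<close>

definition finite_over :: "('a, 'b) monoid_scheme \<Rightarrow> 'a set \<Rightarrow> 'a set \<Rightarrow> bool" where
  "finite_over G A B \<longleftrightarrow>
     (\<exists>F. finite F \<and> F \<subseteq> carrier G \<and> (\<forall>x\<in>B. \<exists>f\<in>F. x \<otimes>\<^bsub>G\<^esub> inv\<^bsub>G\<^esub> f \<in> A))"

definition loc_finite_over :: "('a, 'b) monoid_scheme \<Rightarrow> 'a set \<Rightarrow> 'a set \<Rightarrow> bool" where
  "loc_finite_over G A B \<longleftrightarrow>
     (\<forall>S. finite S \<longrightarrow> S \<subseteq> B \<longrightarrow> finite_over G A (generate G S))"

definition loc_soluble_over :: "('a, 'b) monoid_scheme \<Rightarrow> 'a set \<Rightarrow> 'a set \<Rightarrow> bool" where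
  "loc_soluble_over G A B \<longleftrightarrow>
     (\<forall>S. finite S \<longrightarrow> S \<subseteq> B \<longrightarrow> (\<exists>d. (derived G ^^ d) (generate G S) \<subseteq> A))"

text \<open>The only consequence of an ascending normal series of \<open>H\<close> that is needed: the first member
  not contained in \<open>M\<close> exists and is a successor. In this form, with \<open>M\<close> an arbitrary
  set, the property passes to subgroups and to quotients.\<close>

definition hyper_loc_finite_or_soluble :: "('a, 'b) monoid_scheme \<Rightarrow> 'a set \<Rightarrow> bool" where
  "hyper_loc_finite_or_soluble G H \<longleftrightarrow> subgroup H G \<and> (\<forall>M. \<one>\<^bsub>G\<^esub> \<in> M \<longrightarrow> \<not> H \<subseteq> M \<longrightarrow>
     (\<exists>A B. normalises G H A \<and> normalises G H B \<and> A \<subseteq> B \<and> B \<subseteq> H \<and> A \<subseteq> M \<and> \<not> B \<subseteq> M \<and>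
        (loc_finite_over G A B \<or> loc_soluble_over G A B)))"

lemma finite_over_mono:
  "finite_over G A B \<Longrightarrow> A \<subseteq> A' \<Longrightarrow> B' \<subseteq> B \<Longrightarrow> finite_over G A' B'"
  unfolding finite_over_def by (meson subsetD)

context group
begin

lemma conj_closure_incl:
  "A \<subseteq> carrier G \<Longrightarrow> e \<in> carrier G \<Longrightarrow> a \<in> A \<Longrightarrow> inv a \<otimes> e \<otimes> a \<in> conj_closure G A e"
  unfolding conj_closure_def by (intro generate.incl) auto

lemma conj_closure_subgroup:
  "A \<subseteq> carrier G \<Longrightarrow> e \<in> carrier G \<Longrightarrow> subgroup (conj_closure G A e) G"
  unfolding conj_closure_def by (intro generate_is_subgroup) auto

lemma conj_closure_mono: "A \<subseteq> B \<Longrightarrow> conj_closure G A e \<subseteq> conj_closure G B e"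
  unfolding conj_closure_def by (intro mono_generate) auto

lemma conj_closure_subset:
  assumes "subgroup R G" "A \<subseteq> R" "e \<in> R"
  shows "conj_closure G A e \<subseteq> R"
  unfolding conj_closure_def
  using assms subgroup.m_closed[OF assms(1)] subgroup.m_inv_closed[OF assms(1)]
  by (intro generate_subgroup_incl assms(1)) (auto simp: subset_iff)

text \<open>Since \<open>e\<close> commutes with itself, conjugating \<open>e^b\<close> by
  \<open>e\<close> gives the conjugate of \<open>e\<close> by \<open>b^e\<close>, and
  \<open>b^e\<close> is again in \<open>A\<close>.\<close>

lemma conj_closure_normalised:
  assumes e: "e \<in> carrier G" and n: "normalises G (generate G (insert e A)) A"
  shows "normalises G (generate G (insert e A)) (conj_closure G A e)"
proof -
  let ?S = "(\<lambda>a. inv a \<otimes> e \<otimes> a) ` A"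
  note d = normalisesD[OF n]
  note AG = subgroup.subset[OF d(2)]
  have eM: "e \<in> generate G (insert e A)" by (auto intro: generate.incl)
  have S: "?S \<subseteq> carrier G" using AG e by auto
  show ?thesis
    unfolding conj_closure_def
  proof (rule normalises_generate_sets[OF _ S])
    show "insert e A \<subseteq> carrier G" using e AG by auto
    have A: "inv a \<otimes> (inv b \<otimes> e \<otimes> b) \<otimes> a \<in> generate G ?S" if "a \<in> A" "b \<in> A" for a b
    proof -
      have "inv (b \<otimes> a) \<otimes> e \<otimes> (b \<otimes> a) \<in> generate G ?S"
        using subgroup.m_closed[OF d(2) that(2,1)] by (intro generate.incl) auto
      then show ?thesis using that AG e by (simp add: free_group_simps subset_iff)
    qed
    have E1: "inv e \<otimes> (inv b \<otimes> e \<otimes> b) \<otimes> e \<in> generate G ?S" if "b \<in> A" for b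
    proof -
      have "inv (inv e \<otimes> b \<otimes> e) \<otimes> e \<otimes> (inv e \<otimes> b \<otimes> e) \<in> generate G ?S"
        using d(3)[OF eM that] by (intro generate.incl) auto
      then show ?thesis using that AG e by (simp add: free_group_simps subset_iff)
    qed
    have E2: "e \<otimes> (inv b \<otimes> e \<otimes> b) \<otimes> inv e \<in> generate G ?S" if "b \<in> A" for b
    proof -
      have "inv (e \<otimes> b \<otimes> inv e) \<otimes> e \<otimes> (e \<otimes> b \<otimes> inv e) \<in> generate G ?S"
        using d(4)[OF eM that] by (intro generate.incl) auto
      then show ?thesis using that AG e by (simp add: free_group_simps subset_iff)
    qed
    show "inv s \<otimes> x \<otimes> s \<in> generate G ?S" if "s \<in> insert e A" "x \<in> ?S" for s x
      using that A E1 by auto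
    show "s \<otimes> x \<otimes> inv s \<in> generate G ?S" if sx: "s \<in> insert e A" "x \<in> ?S" for s x
    proof (cases "s = e")
      case True
      then show ?thesis using sx E2 by auto
    next
      case False
      then have s: "s \<in> A" "inv s \<in> A" using sx subgroup.m_inv_closed[OF d(2)] by auto
      then show ?thesis using sx A[OF s(2)] AG by (auto simp: subset_iff)
    qed
  qed
qed

lemma loc_nilpotent_conj:
  assumes z: "z \<in> carrier G" and P: "loc_nilpotent G P"
  shows "loc_nilpotent G ((\<lambda>x. inv z \<otimes> x \<otimes> z) ` P)"
proof -
  interpret c: group_hom G G "\<lambda>x. inv z \<otimes> x \<otimes> z" by (rule conj_group_hom[OF z])
  have sP: "subgroup P G" using P by (simp add: loc_nilpotent_def)
  show ?thesis
    unfolding loc_nilpotent_def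
  proof (intro conjI allI impI)
    show "subgroup ((\<lambda>x. inv z \<otimes> x \<otimes> z) ` P) G" by (rule c.subgroup_img_is_subgroup[OF sP])
    fix S assume S: "finite S" "S \<subseteq> (\<lambda>x. inv z \<otimes> x \<otimes> z) ` P"
    obtain T where T: "T \<subseteq> P" "finite T" "S = (\<lambda>x. inv z \<otimes> x \<otimes> z) ` T"
      using finite_subset_image[OF S] by blast
    have "nilpotent_over G (generate G T) {\<one>}" using P T by (simp add: loc_nilpotent_def)
    then show "nilpotent_over G (generate G S) {\<one>}"
      using nilpotent_conj[OF z, of T] T subgroup.subset[OF sP] by simp
  qed
qed

text \<open>For \<open>z\<close> in \<open>B\<close>, the conjugate \<open>e^z\<close> differs from
  \<open>e\<close> by an element of \<open>A\<close>, so \<open>B\<close> normalises the group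
  \<open>?R\<close> generated by \<open>e\<close> and \<open>A\<close>. The conjugates by
  \<open>B\<close> of the locally nilpotent normal subgroup \<open>?P\<close> of \<open>?R\<close>
  are therefore normal in \<open>?R\<close>; Hirsch--Plotkin applies to their join, which contains
  all \<open>e^z\<close>.\<close>

lemma loc_nilpotent_conj_closure_step:
  assumes A: "normalises G M A" and B: "normalises G M B" and AB: "A \<subseteq> B" "B \<subseteq> M"
    and e: "e \<in> M" and c: "\<And>z. z \<in> B \<Longrightarrow> group_comm G z e \<in> A"
    and P: "loc_nilpotent G (conj_closure G A e)"
  shows "loc_nilpotent G (conj_closure G B e)"
proof -
  note dA = normalisesD[OF A] and dB = normalisesD[OF B]
  have G: "A \<subseteq> carrier G" "B \<subseteq> carrier G" "M \<subseteq> carrier G" "e \<in> carrier G"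
    using subgroup.subset[OF dA(1)] AB e by auto
  let ?R = "generate G (insert e A)" and ?P = "conj_closure G A e"
  have RS: "insert e A \<subseteq> carrier G" using G by auto
  have sR: "subgroup ?R G" using generate_is_subgroup[OF RS] .
  have RM: "?R \<subseteq> M" using e AB by (intro generate_subgroup_incl dA(1)) auto
  have nA: "normalises G ?R A" by (rule normalises_subgroup[OF A sR RM])
  have nP: "normalises G ?R ?P" using conj_closure_normalised[OF G(4) nA] .
  have incl: "e \<in> ?R" "A \<subseteq> ?R" by (auto intro: generate.incl)
  have PR: "?P \<subseteq> ?R" using conj_closure_subset[OF sR] incl by blast
  have ez: "inv z \<otimes> e \<otimes> z \<in> ?R" if "z \<in> B" for z
  proof -
    have "group_comm G e z \<in> A"
      using comm_swap_mem[OF dA(2) _ G(4) c[OF that]] that G by auto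
    then have "e \<otimes> group_comm G e z \<in> ?R" using incl subgroup.m_closed[OF sR] by blast
    then show ?thesis using that G by (simp add: free_group_simps subset_iff)
  qed
  have nB: "normalises G B ?R"
  proof (rule normalises_generate_right[OF dB(2) RS])
    show "inv h \<otimes> x \<otimes> h \<in> ?R" if "h \<in> B" "x \<in> insert e A" for h x
      using that ez dA(3)[of h x] AB incl by blast
  qed
  let ?\<phi> = "\<lambda>z x. inv z \<otimes> x \<otimes> z"
  let ?\<P> = "(\<lambda>z. ?\<phi> z ` ?P) ` B"
  have "loc_nilpotent G (generate G (\<Union>?\<P>))"
  proof (rule hirsch_plotkin_Union[OF sR])
    fix Q assume "Q \<in> ?\<P>"
    then obtain z where z: "z \<in> B" "Q = ?\<phi> z ` ?P" by blast
    have zG: "z \<in> carrier G" using z G by auto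
    show Q: "loc_nilpotent G Q" using loc_nilpotent_conj[OF zG P] z by simp
    show "Q \<subseteq> ?R" using normalisesD(3)[OF nB z(1)] z(2) PR by auto
    have "inv r \<otimes> ?\<phi> z p \<otimes> r \<in> Q" if r: "r \<in> ?R" and p: "p \<in> ?P" for r p
    proof -
      have "z \<otimes> r \<otimes> inv z \<in> ?R" using normalisesD(4)[OF nB z(1) r] .
      then have "inv (z \<otimes> r \<otimes> inv z) \<otimes> p \<otimes> (z \<otimes> r \<otimes> inv z) \<in> ?P"
        using normalisesD(3)[OF nP _ p] by blast
      then have "?\<phi> z (inv (z \<otimes> r \<otimes> inv z) \<otimes> p \<otimes> (z \<otimes> r \<otimes> inv z)) \<in> Q"
        using z(2) by blast
      moreover have "r \<in> carrier G" "p \<in> carrier G"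
        using subgroup.mem_carrier[OF sR] r p PR by auto
      ultimately show ?thesis using zG by (simp add: free_group_simps)
    qed
    then show "normalises G ?R Q"
      using sR Q z(2) by (auto simp: normalises_def loc_nilpotent_def)
  qed
  moreover have "conj_closure G B e \<subseteq> generate G (\<Union>?\<P>)"
  proof -
    have "e \<in> ?P" using conj_closure_incl[OF G(1,4) subgroup.one_closed[OF dA(2)]] G by simp
    then have "(\<lambda>a. inv a \<otimes> e \<otimes> a) ` B \<subseteq> \<Union>?\<P>" by blast
    then show ?thesis unfolding conj_closure_def by (rule mono_generate)
  qed
  ultimately show ?thesis using loc_nilpotent_subgroup conj_closure_subgroup G by blast
qed

text \<open>The previous step climbs the upper central series of \<open>M\<close> modulo
  \<open>T\<close>, where commutation with \<open>e\<close> descends one term.\<close>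

lemma loc_nilpotent_conj_closure_nilpotent_over:
  assumes T: "normalises G M T" "T \<subseteq> M" and n: "nilpotent_over G M T"
    and e: "e \<in> M" and P: "loc_nilpotent G (conj_closure G T e)"
  shows "loc_nilpotent G (conj_closure G M e)"
proof -
  have "loc_nilpotent G (conj_closure G (upper_central_over G M T k) e)" for k
  proof (induction k)
    case (Suc k)
    note u = upper_central_over_normal[OF T] normalises_centre_over(2)[OF upper_central_over_normal[OF T]]
    show ?case
      by (rule loc_nilpotent_conj_closure_step[OF u(1) u(1) _ u(2) e _ Suc])
        (use u(3) e in auto)
  qed (use P in simp)
  then show ?thesis
    using n upper_central_over_normal(2)[OF T] unfolding nilpotent_over_def
    by (metis subset_antisym)
qed

text \<open>The uniform exponent \<open>n\<close> makes \<open>M/A\<close> nilpotent: as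
  \<open>B/A\<close> is abelian, an element of \<open>B\<close> killed by \<open>i\<close>
  commutations with \<open>e\<close> modulo \<open>A\<close> lies in the \<open>i\<close>-th central
  term. So \<open>B\<close> lies in the \<open>n\<close>-th term, and \<open>e\<close>, whose
  commutators with \<open>B\<close> are in \<open>B\<close>, in the next one.\<close>

lemma loc_nilpotent_conj_closure_abelian:
  assumes B: "normalises G M B" and M: "M = generate G (insert e B)" and A: "normalises G M A"
    and AB: "A \<subseteq> B" and ab: "\<And>x y. x \<in> B \<Longrightarrow> y \<in> B \<Longrightarrow> group_comm G x y \<in> A"
    and e: "e \<in> carrier G" and eng: "\<And>b. b \<in> B \<Longrightarrow> iter_comm G b n e \<in> A"
    and P: "loc_nilpotent G (conj_closure G A e)"
  shows "loc_nilpotent G (conj_closure G B e)"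
proof -
  have incl: "insert e B \<subseteq> M" using M by (auto intro: generate.incl)
  have AM: "A \<subseteq> M" using incl AB by auto
  note dB = normalisesD[OF B]
  note BG = subgroup.subset[OF dB(2)]
  note u = upper_central_over_normal[OF A AM] upper_central_over_incl[OF A AM]
  have b: "iter_comm G b i e \<in> A \<Longrightarrow> b \<in> B \<Longrightarrow> b \<in> upper_central_over G M A i" for b i
  proof (induction i arbitrary: b)
    case 0
    then show ?case by simp
  next
    case (Suc i)
    have "group_comm G b e \<in> B" using normalises_comm(1)[OF B Suc.prems(2)] incl by auto
    then have be: "group_comm G b e \<in> upper_central_over G M A i"
      using Suc.IH Suc.prems(1) unfolding iter_comm_Suc by blast
    have "group_comm G b m \<in> upper_central_over G M A i" if "m \<in> M" for m
    proof (rule comm_generate_right[OF u(1) _ incl])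
      show "b \<in> carrier G" using Suc.prems BG by auto
      show "m \<in> generate G (insert e B)" using that M by simp
      show "group_comm G b s \<in> upper_central_over G M A i" if "s \<in> insert e B" for s
        using that be ab[OF Suc.prems(2)] u(3) by blast
    qed
    then show ?case using Suc.prems(2) incl by auto
  qed
  have eG: "insert e B \<subseteq> carrier G" using e BG by auto
  have Bn: "B \<subseteq> upper_central_over G M A n" using b eng by blast
  have "group_comm G e m \<in> upper_central_over G M A n" if "m \<in> M" for m
  proof (rule comm_generate_right[OF u(1) e incl])
    show "m \<in> generate G (insert e B)" using that M by simp
    show "group_comm G e s \<in> upper_central_over G M A n" if "s \<in> insert e B" for s
      using that normalises_comm(2)[OF B, of s e] incl Bn e
        subgroup.one_closed[OF normalisesD(2)[OF u(1)], of n] by auto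
  qed
  then have "e \<in> upper_central_over G M A (Suc n)" using incl by auto
  moreover have "B \<subseteq> upper_central_over G M A (Suc n)"
    using Bn normalises_centre_over(2)[OF u(1,2)] by auto
  ultimately have "insert e B \<subseteq> upper_central_over G M A (Suc n)" by blast
  then have "M \<subseteq> upper_central_over G M A (Suc n)"
    using generate_subgroup_incl[OF _ normalisesD(2)[OF u(1)]] M by blast
  then have "nilpotent_over G M A" unfolding nilpotent_over_def by blast
  then have "loc_nilpotent G (conj_closure G M e)"
    using loc_nilpotent_conj_closure_nilpotent_over[OF A AM _ _ P] incl by blast
  then show ?thesis
    using loc_nilpotent_subgroup conj_closure_subgroup[OF BG e] conj_closure_mono[of B M e] incl
    by blast
qed

lemma derived_normalised:
  assumes "normalises G R F"
  shows "normalises G R (derived G F)"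
  unfolding derived_def
proof (rule normalises_generate_right[OF normalisesD(1)[OF assms]])
  note d = normalisesD[OF assms]
  note FG = subgroup.subset[OF d(2)]
  show "derived_set G F \<subseteq> carrier G" by (rule derived_set_in_carrier[OF FG])
  fix r x assume r: "r \<in> R" and "x \<in> derived_set G F"
  then obtain a b where ab: "a \<in> F" "b \<in> F" "x = a \<otimes> b \<otimes> inv a \<otimes> inv b" by blast
  let ?c = "\<lambda>x. inv r \<otimes> x \<otimes> r"
  have "?c a \<otimes> ?c b \<otimes> inv (?c a) \<otimes> inv (?c b) \<in> generate G (derived_set G F)"
    using d(3)[OF r ab(1)] d(3)[OF r ab(2)] by (intro generate.incl) blast
  moreover have "r \<in> carrier G" "a \<in> carrier G" "b \<in> carrier G"
    using subgroup.mem_carrier[OF d(1) r] FG ab by auto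
  ultimately show "?c x \<in> generate G (derived_set G F)"
    using ab(3) by (simp add: free_group_simps)
qed

lemma exp_of_derived_normalised:
  "normalises G R F \<Longrightarrow> normalises G R ((derived G ^^ k) F)"
  by (induction k) (auto simp: derived_normalised)

text \<open>\<open>derived_set\<close> consists of products \<open>a b a^-1 b^-1\<close>; the two
  conventions for commutators are exchanged by inverting both arguments.\<close>

lemma group_comm_in_derived:
  assumes "subgroup F G" "x \<in> F" "y \<in> F"
  shows "group_comm G x y \<in> derived G F"
proof -
  have "inv x \<otimes> inv y \<otimes> inv (inv x) \<otimes> inv (inv y) \<in> derived G F"
    unfolding derived_def using assms subgroup.m_inv_closed[OF assms(1)]
    by (intro generate.incl) blast
  then show ?thesis using assms subgroup.mem_carrier[OF assms(1)] by (simp add: group_comm_def)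
qed

lemma derived_subset_iff:
  assumes F: "subgroup F G" and V: "subgroup V G"
    and c: "\<And>x y. x \<in> F \<Longrightarrow> y \<in> F \<Longrightarrow> group_comm G x y \<in> V"
  shows "derived G F \<subseteq> V"
  unfolding derived_def
proof (rule generate_subgroup_incl[OF _ V])
  show "derived_set G F \<subseteq> V"
  proof
    fix x assume "x \<in> derived_set G F"
    then obtain a b where ab: "a \<in> F" "b \<in> F" "x = a \<otimes> b \<otimes> inv a \<otimes> inv b" by blast
    then have "group_comm G (inv a) (inv b) \<in> V" using c subgroup.m_inv_closed[OF F] by blast
    then show "x \<in> V" using ab subgroup.mem_carrier[OF F] by (simp add: group_comm_def)
  qed
qed

lemma engel_elementD:
  assumes "engel_element G n e"
  shows "e \<in> carrier G" "g \<in> carrier G \<Longrightarrow> iter_comm G g n e = \<one>"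
    "A \<subseteq> carrier G \<Longrightarrow> engel_on G A e"
  using assms by (auto simp: engel_element_def engel_on_def)

text \<open>Climb the derived series of \<open>F\<close> from its trivial term, where
  \<open>conj_closure\<close> is the cyclic group on \<open>e\<close>. The bounded Engel length
  gives the same exponent \<open>n\<close> in every abelian factor.\<close>

lemma gruenberg_soluble:
  assumes e: "engel_element G n e" and F: "normalises G (generate G (insert e F)) F"
    and d: "(derived G ^^ d) F \<subseteq> {\<one>}"
  shows "loc_nilpotent G (conj_closure G F e)"
proof -
  note eD = engel_elementD[OF e]
  note sF = normalisesD(2)[OF F]
  let ?D = "\<lambda>k. (derived G ^^ k) F"
  have nD: "normalises G (generate G (insert e F)) (?D k)" for k
    by (rule exp_of_derived_normalised[OF F])
  have DF: "?D k \<subseteq> F" for k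
    using derived_incl[OF _ sF] by (induction k) auto
  have "j \<le> d \<Longrightarrow> loc_nilpotent G (conj_closure G (?D (d - j)) e)" for j
  proof (induction j)
    case 0
    have "?D d = {\<one>}" using d subgroup.one_closed[OF normalisesD(2)[OF nD]] by blast
    then have "conj_closure G (?D d) e = generate G {e}"
      using eD(1) by (simp add: conj_closure_def)
    then show ?case
      using loc_nilpotent_of_nilpotent[OF _ nilpotent_cyclic[OF eD(1)]] generate_is_subgroup[of "{e}"]
        eD(1) by simp
  next
    case (Suc j)
    let ?i = "d - Suc j"
    let ?M = "generate G (insert e (?D ?i))"
    have i: "d - j = Suc ?i" using Suc by auto
    have sB: "subgroup (?D ?i) G" using normalisesD(2)[OF nD] .
    have BG: "?D ?i \<subseteq> carrier G" using subgroup.subset[OF sB] .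
    have sub: "?M \<subseteq> generate G (insert e F)" using DF by (intro mono_generate) auto
    have sM: "subgroup ?M G" using eD(1) BG by (intro generate_is_subgroup) auto
    show ?case
    proof (rule loc_nilpotent_conj_closure_abelian[OF _ refl, where A = "?D (Suc ?i)" and n = n])
      show "normalises G ?M (?D ?i)" "normalises G ?M (?D (Suc ?i))"
        by (rule normalises_subgroup[OF nD sM sub])+
      show "?D (Suc ?i) \<subseteq> ?D ?i" using derived_incl[OF _ sB] by auto
      show "group_comm G x y \<in> ?D (Suc ?i)" if "x \<in> ?D ?i" "y \<in> ?D ?i" for x y
        using group_comm_in_derived[OF sB that] by simp
      show "e \<in> carrier G" by (rule eD(1))
      show "iter_comm G b n e \<in> ?D (Suc ?i)" if "b \<in> ?D ?i" for b
      proof -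
        have "\<one> \<in> ?D (Suc ?i)" by (rule subgroup.one_closed[OF normalisesD(2)[OF nD]])
        then show ?thesis using eD(2)[of b] that BG by (simp del: funpow.simps add: subset_iff)
      qed
      show "loc_nilpotent G (conj_closure G (?D (Suc ?i)) e)" using Suc i by simp
    qed
  qed
  from this[of d] show ?thesis by simp
qed

text \<open>The conjugates of \<open>e\<close> by \<open>F\<close> form a finite set normalised by
  \<open>e\<close> and \<open>F\<close>, and conjugates of an Engel element are Engel. So the
  theorem on finite normal sets of Engel elements applies.\<close>

lemma baer_finite:
  assumes e: "engel_element G n e" and F: "normalises G (generate G (insert e F)) F" and fin: "finite F"
  shows "loc_nilpotent G (conj_closure G F e)"
proof -
  note eD = engel_elementD[OF e]
  note d = normalisesD[OF F]
  note FG = subgroup.subset[OF d(2)]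
  let ?X = "(\<lambda>a. inv a \<otimes> e \<otimes> a) ` F"
  let ?M = "generate G (insert e F)"
  have XG: "?X \<subseteq> carrier G" using FG eD(1) by auto
  have eM: "e \<in> ?M" "F \<subseteq> ?M" by (auto intro: generate.incl)
  have cX: "inv x \<otimes> y \<otimes> x \<in> ?X" if y: "y \<in> ?X" and x: "x \<in> ?M" for x y
  proof (rule conj_closed_generate[OF _ XG _ _ x y])
    show "finite ?X" using fin by auto
    show "insert e F \<subseteq> carrier G" using eD(1) FG by auto
    show "inv s \<otimes> a \<otimes> s \<in> ?X" if s: "s \<in> insert e F" and a: "a \<in> ?X" for s a
    proof -
      obtain b where b: "b \<in> F" "a = inv b \<otimes> e \<otimes> b" using a by auto
      have "inv s \<otimes> a \<otimes> s = inv (b \<otimes> s) \<otimes> e \<otimes> (b \<otimes> s)" if "s \<in> F"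
        using b that FG eD(1) by (simp add: free_group_simps subset_iff)
      moreover have "b \<otimes> s \<in> F" if "s \<in> F" using subgroup.m_closed[OF d(2) b(1) that] .
      moreover have "inv e \<otimes> a \<otimes> e = inv (inv e \<otimes> b \<otimes> e) \<otimes> e \<otimes> (inv e \<otimes> b \<otimes> e)"
        using b FG eD(1) by (simp add: free_group_simps subset_iff)
      moreover have "inv e \<otimes> b \<otimes> e \<in> F" using d(3)[OF eM(1) b(1)] .
      ultimately show ?thesis using s by blast
    qed
  qed
  have XM: "x \<in> ?M" if "x \<in> ?X" for x
    using that eM subgroup.m_closed[OF d(1)] subgroup.m_inv_closed[OF d(1)] by auto
  have "nilpotent_over G (generate G ?X) {\<one>}"
  proof (rule baer_finite_engel_set[OF _ XG])
    show "finite ?X" using fin by auto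
    show "inv x \<otimes> y \<otimes> x \<in> ?X" if "x \<in> ?X" "y \<in> ?X" for x y
      using cX[OF that(2) XM[OF that(1)]] .
    show "engel_on G (generate G ?X) x" if x: "x \<in> ?X" for x
      unfolding engel_on_def
    proof
      fix g assume "g \<in> generate G ?X"
      then have gG: "g \<in> carrier G" using generate_in_carrier[OF XG] by auto
      obtain a where a: "a \<in> F" "x = inv a \<otimes> e \<otimes> a" using x by auto
      have aG: "a \<in> carrier G" using a FG by auto
      interpret c: group_hom G G "\<lambda>x. inv a \<otimes> x \<otimes> a" by (rule conj_group_hom[OF aG])
      have "inv a \<otimes> iter_comm G (a \<otimes> g \<otimes> inv a) n e \<otimes> a = iter_comm G g n x"
        using c.hom_iter_comm[of e "a \<otimes> g \<otimes> inv a" n] eD(1) aG gG a(2)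
        by (simp add: free_group_simps)
      then show "\<exists>k. iter_comm G g k x = \<one>"
        using eD(2)[of "a \<otimes> g \<otimes> inv a"] aG gG by (intro exI[of _ n]) simp
    qed
  qed
  then show ?thesis
    unfolding conj_closure_def using loc_nilpotent_of_nilpotent generate_is_subgroup[OF XG] by blast
qed

lemma finite_over_one:
  assumes "finite_over G {\<one>} B" "B \<subseteq> carrier G"
  shows "finite B"
proof -
  obtain F where F: "finite F" "F \<subseteq> carrier G" "\<forall>x\<in>B. \<exists>f\<in>F. x \<otimes> inv f \<in> {\<one>}"
    using assms(1) by (auto simp: finite_over_def)
  have "B \<subseteq> F"
  proof
    fix x assume x: "x \<in> B"
    then obtain f where f: "f \<in> F" "x \<otimes> inv f = \<one>" using F(3) by auto
    have "x = x \<otimes> inv f \<otimes> f" using f(1) F(2) x assms(2) by (simp add: m_assoc subset_iff)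
    then show "x \<in> F" using f F(2) by auto
  qed
  then show ?thesis using F(1) finite_subset by blast
qed

text \<open>Finitely many conjugates \<open>e^a\<close> involve a finite part of \<open>T\<close>.
  The Engel condition enlarges it to a finite set generating an \<open>e\<close>-invariant subgroup,
  which is finite or soluble.\<close>

lemma engel_loc_finite_or_soluble:
  assumes e: "engel_element G n e" and T: "normalises G (generate G (insert e T)) T"
    and lfs: "loc_finite_over G {\<one>} T \<or> loc_soluble_over G {\<one>} T"
  shows "loc_nilpotent G (conj_closure G T e)"
proof (rule loc_nilpotentI)
  note eD = engel_elementD[OF e]
  note d = normalisesD[OF T]
  note TG = subgroup.subset[OF d(2)]
  show "subgroup (conj_closure G T e) G" by (rule conj_closure_subgroup[OF TG eD(1)])
  fix Q assume Q: "finite Q" "Q \<subseteq> conj_closure G T e"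
  obtain F where F: "finite F" "F \<subseteq> (\<lambda>a. inv a \<otimes> e \<otimes> a) ` T" "Q \<subseteq> generate G F"
    using generate_finite_support_set[OF Q[unfolded conj_closure_def]] by blast
  obtain T0 where T0: "T0 \<subseteq> T" "finite T0" "F = (\<lambda>a. inv a \<otimes> e \<otimes> a) ` T0"
    using finite_subset_image[OF F(1,2)] by blast
  have "T0 \<subseteq> carrier G" using T0 TG by auto
  then obtain S where S: "finite S" "T0 \<subseteq> S" "S \<subseteq> {iter_comm G s i e | s i. s \<in> T0}"
    and nS: "normalises G (generate G {e}) (generate G S)"
    using finite_commutator_closure[OF eD(1) T0(2) _ eD(3)] by blast
  have eM: "e \<in> generate G (insert e T)" by (auto intro: generate.incl)
  have ST: "S \<subseteq> T" using S(3) T0(1) normalises_iter_comm[OF T eM] by auto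
  have SG: "S \<subseteq> carrier G" using ST TG by auto
  let ?F = "generate G S"
  have sF: "subgroup ?F G" using generate_is_subgroup[OF SG] .
  have nF: "normalises G (generate G (insert e ?F)) ?F"
  proof (rule normalises_generateI[OF _ sF])
    have "e \<in> generate G {e}" by (auto intro: generate.incl)
    then show "inv s \<otimes> x \<otimes> s \<in> ?F" "s \<otimes> x \<otimes> inv s \<in> ?F" if "s \<in> insert e ?F" "x \<in> ?F" for s x
      using that normalisesD(3,4)[OF nS] normalisesD(3,4)[OF normalises_self[OF sF]] by blast+
    show "insert e ?F \<subseteq> carrier G" using eD(1) subgroup.subset[OF sF] by auto
  qed
  have "loc_nilpotent G (conj_closure G ?F e)"
    using lfs
  proof
    assume "loc_finite_over G {\<one>} T"
    then have "finite ?F"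
      using S(1) ST finite_over_one subgroup.subset[OF sF] by (simp add: loc_finite_over_def)
    then show ?thesis using baer_finite[OF e nF] by blast
  next
    assume "loc_soluble_over G {\<one>} T"
    then show ?thesis
      using gruenberg_soluble[OF e nF] S(1) ST by (auto simp: loc_soluble_over_def)
  qed
  moreover have "Q \<subseteq> conj_closure G ?F e"
  proof -
    have "T0 \<subseteq> ?F" using S(2) by (auto intro: generate.incl)
    then have "generate G F \<subseteq> conj_closure G ?F e"
      unfolding conj_closure_def T0(3) by (intro mono_generate) auto
    then show ?thesis using F(3) by blast
  qed
  ultimately show "\<exists>K. Q \<subseteq> K \<and> loc_nilpotent G K" by blast
qed

text \<open>The normal closure of each generator is locally nilpotent: over \<open>T\<close> by the
  preceding lemma, then up the nilpotent quotient. Their join contains the finite generating set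
  \<open>X\<close>, so \<open>G\<close> is nilpotent.\<close>

lemma engel_generated_nilpotent_extension:
  assumes X: "finite X" "X \<subseteq> carrier G" "generate G X = carrier G"
    and e: "\<And>x. x \<in> X \<Longrightarrow> engel_element G n x"
    and T: "normalises G (carrier G) T"
    and lfs: "loc_finite_over G {\<one>} T \<or> loc_soluble_over G {\<one>} T"
    and n: "nilpotent_over G (carrier G) T"
  shows "nilpotent_over G (carrier G) {\<one>}"
proof -
  let ?\<P> = "conj_closure G (carrier G) ` X"
  note TG = subgroup.subset[OF normalisesD(2)[OF T]]
  have P: "loc_nilpotent G P" "normalises G (carrier G) P" "P \<subseteq> carrier G" if P: "P \<in> ?\<P>" for P
  proof -
    obtain x where x: "x \<in> X" "P = conj_closure G (carrier G) x" using P by auto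
    have xG: "x \<in> carrier G" using x X by auto
    have g: "generate G (insert x T) \<subseteq> carrier G" "subgroup (generate G (insert x T)) G"
      using xG TG generate_is_subgroup[of "insert x T"] subgroup.subset by auto
    have "loc_nilpotent G (conj_closure G T x)"
      using engel_loc_finite_or_soluble[OF e[OF x(1)] normalises_subgroup[OF T g(2,1)] lfs] .
    then show "loc_nilpotent G P"
      using loc_nilpotent_conj_closure_nilpotent_over[OF T TG n xG] x by simp
    have "generate G (insert x (carrier G)) = carrier G"
      using generate_of_subgroup[OF subgroup_self] xG by (simp add: insert_absorb)
    then show "normalises G (carrier G) P"
      using conj_closure_normalised[OF xG, of "carrier G"] normalises_self[OF subgroup_self] x
      by simp
    then show "P \<subseteq> carrier G" using normalisesD(2) subgroup.subset by blast
  qed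
  have LN: "loc_nilpotent G (generate G (\<Union>?\<P>))"
    by (rule hirsch_plotkin_Union[OF subgroup_self]) (use P in blast)+
  have "X \<subseteq> \<Union>?\<P>"
  proof
    fix x assume x: "x \<in> X"
    then have "inv \<one> \<otimes> x \<otimes> \<one> \<in> conj_closure G (carrier G) x"
      using X by (intro conj_closure_incl) auto
    moreover have "x \<in> carrier G" using x X by auto
    ultimately have "x \<in> conj_closure G (carrier G) x" by simp
    then show "x \<in> \<Union>?\<P>" using x by blast
  qed
  then have "X \<subseteq> generate G (\<Union>?\<P>)" by (auto intro: generate.incl)
  then show ?thesis using LN X by (auto simp: loc_nilpotent_def)
qed

end

definition loc_finite :: "('a, 'b) monoid_scheme \<Rightarrow> 'a set \<Rightarrow> bool" where
  "loc_finite G H \<longleftrightarrow> subgroup H G \<and>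
     (\<forall>S. finite S \<longrightarrow> S \<subseteq> H \<longrightarrow> finite (generate G S))"

definition torsion :: "('a, 'b) monoid_scheme \<Rightarrow> 'a \<Rightarrow> bool" where
  "torsion G x \<longleftrightarrow> (\<exists>k>0. x [^]\<^bsub>G\<^esub> (k::nat) = \<one>\<^bsub>G\<^esub>)"

section \<open>Relative local properties under homomorphisms\<close>

context group_hom
begin

lemma normalises_img:
  assumes "normalises G R N"
  shows "normalises H (h ` R) (h ` N)"
proof -
  note d = G.normalisesD[OF assms]
  have c: "R \<subseteq> carrier G" "N \<subseteq> carrier G" using subgroup.subset d by auto
  have "inv\<^bsub>H\<^esub> (h r) \<otimes>\<^bsub>H\<^esub> h x \<otimes>\<^bsub>H\<^esub> h r \<in> h ` N" if "r \<in> R" "x \<in> N" for r x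
  proof -
    have "h (inv r \<otimes> x \<otimes> r) \<in> h ` N" using d(3)[OF that] by blast
    then show ?thesis using that c by (simp add: subset_iff)
  qed
  then show ?thesis
    using subgroup_img_is_subgroup[OF d(1)] subgroup_img_is_subgroup[OF d(2)]
    by (auto simp: normalises_def)
qed

lemma finite_over_img:
  assumes "finite_over G A B" "B \<subseteq> carrier G"
  shows "finite_over H (h ` A) (h ` B)"
proof -
  obtain F where F: "finite F" "F \<subseteq> carrier G" "\<And>x. x \<in> B \<Longrightarrow> \<exists>f\<in>F. x \<otimes> inv f \<in> A"
    using assms(1) by (auto simp: finite_over_def)
  have "\<exists>f\<in>h ` F. h x \<otimes>\<^bsub>H\<^esub> inv\<^bsub>H\<^esub> f \<in> h ` A" if x: "x \<in> B" for x
  proof -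
    obtain f where f: "f \<in> F" "x \<otimes> inv f \<in> A" using F(3)[OF x] by blast
    then have "h (x \<otimes> inv f) \<in> h ` A" by blast
    moreover have "h (x \<otimes> inv f) = h x \<otimes>\<^bsub>H\<^esub> inv\<^bsub>H\<^esub> (h f)"
      using f F(2) x assms(2) by (simp add: subset_iff)
    ultimately show ?thesis using f(1) by auto
  qed
  then show ?thesis
    unfolding finite_over_def using F(1,2) by (intro exI[of _ "h ` F"]) auto
qed

lemma loc_finite_over_img:
  assumes lf: "loc_finite_over G A B" and B: "B \<subseteq> carrier G"
  shows "loc_finite_over H (h ` A) (h ` B)"
  unfolding loc_finite_over_def
proof (intro allI impI)
  fix S assume S: "finite S" "S \<subseteq> h ` B"
  obtain T where T: "T \<subseteq> B" "finite T" "S = h ` T" using finite_subset_image[OF S] by blast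
  have TG: "T \<subseteq> carrier G" using T B by auto
  have "finite_over G A (generate G T)" using lf T by (simp add: loc_finite_over_def)
  then show "finite_over H (h ` A) (generate H S)"
    using finite_over_img[OF _ G.generate_incl[OF TG]] generate_img[OF TG] T(3) by simp
qed

lemma loc_soluble_over_img:
  assumes ls: "loc_soluble_over G A B" and B: "B \<subseteq> carrier G"
  shows "loc_soluble_over H (h ` A) (h ` B)"
  unfolding loc_soluble_over_def
proof (intro allI impI)
  fix S assume S: "finite S" "S \<subseteq> h ` B"
  obtain T where T: "T \<subseteq> B" "finite T" "S = h ` T" using finite_subset_image[OF S] by blast
  have TG: "T \<subseteq> carrier G" using T B by auto
  obtain d where "(derived G ^^ d) (generate G T) \<subseteq> A"
    using ls T by (auto simp: loc_soluble_over_def)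
  then have "(derived H ^^ d) (generate H S) \<subseteq> h ` A"
    using exp_of_derived_img[OF G.generate_incl[OF TG]] generate_img[OF TG] T(3) by auto
  then show "\<exists>d. (derived H ^^ d) (generate H S) \<subseteq> h ` A" by blast
qed

lemma hyper_loc_finite_or_soluble_img:
  assumes hp: "hyper_loc_finite_or_soluble G K"
  shows "hyper_loc_finite_or_soluble H (h ` K)"
  unfolding hyper_loc_finite_or_soluble_def
proof (intro conjI allI impI)
  have sK: "subgroup K G" using hp by (simp add: hyper_loc_finite_or_soluble_def)
  show "subgroup (h ` K) H" by (rule subgroup_img_is_subgroup[OF sK])
  fix M assume "\<one>\<^bsub>H\<^esub> \<in> M" "\<not> h ` K \<subseteq> M"
  then have "\<one> \<in> h -` M" "\<not> K \<subseteq> h -` M" by auto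
  then obtain A B where AB: "normalises G K A" "normalises G K B" "A \<subseteq> B" "B \<subseteq> K"
      "A \<subseteq> h -` M" "\<not> B \<subseteq> h -` M" "loc_finite_over G A B \<or> loc_soluble_over G A B"
    using hp unfolding hyper_loc_finite_or_soluble_def by meson
  have BG: "B \<subseteq> carrier G" using AB(4) subgroup.subset[OF sK] by blast
  have "loc_finite_over H (h ` A) (h ` B) \<or> loc_soluble_over H (h ` A) (h ` B)"
    using AB(7) loc_finite_over_img[OF _ BG] loc_soluble_over_img[OF _ BG] by blast
  then show "\<exists>A B. normalises H (h ` K) A \<and> normalises H (h ` K) B \<and> A \<subseteq> B \<and> B \<subseteq> h ` K
      \<and> A \<subseteq> M \<and> \<not> B \<subseteq> M \<and> (loc_finite_over H A B \<or> loc_soluble_over H A B)"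
    using normalises_img[OF AB(1)] normalises_img[OF AB(2)] AB(3-6)
    by (intro exI[of _ "h ` A"] exI[of _ "h ` B"]) auto
qed

end

section \<open>Passage to subgroups and nilpotency of groups generated by Engel elements\<close>

context group
begin

text \<open>Each useful representative \<open>f\<close> is replaced by an element of
  \<open>B\<close> in the same coset of \<open>A\<close>.\<close>

lemma finite_over_representatives:
  assumes A: "subgroup A G" and B: "B \<subseteq> carrier G" and f: "finite_over G A B"
  shows "\<exists>F. finite F \<and> F \<subseteq> B \<and> (\<forall>x\<in>B. \<exists>f\<in>F. x \<otimes> inv f \<in> A)"
proof -
  obtain F where F: "finite F" "F \<subseteq> carrier G" "\<And>x. x \<in> B \<Longrightarrow> \<exists>f\<in>F. x \<otimes> inv f \<in> A"
    using f by (auto simp: finite_over_def)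
  define c where "c f = (SOME b. b \<in> B \<and> b \<otimes> inv f \<in> A)" for f
  define F' where "F' = {f \<in> F. \<exists>b\<in>B. b \<otimes> inv f \<in> A}"
  have c: "c f \<in> B" "c f \<otimes> inv f \<in> A" if "f \<in> F'" for f
    using someI_ex[of "\<lambda>b. b \<in> B \<and> b \<otimes> inv f \<in> A"] that by (auto simp: c_def F'_def)
  have "\<exists>b\<in>c ` F'. x \<otimes> inv b \<in> A" if x: "x \<in> B" for x
  proof -
    obtain f where f: "f \<in> F" "x \<otimes> inv f \<in> A" using F(3)[OF x] by blast
    then have f': "f \<in> F'" using x by (auto simp: F'_def)
    have "(x \<otimes> inv f) \<otimes> inv (c f \<otimes> inv f) \<in> A"
      using f(2) c(2)[OF f'] subgroup.m_closed[OF A] subgroup.m_inv_closed[OF A] by auto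
    moreover have "x \<in> carrier G" "f \<in> carrier G" "c f \<in> carrier G"
      using x B f F(2) c(1)[OF f'] by auto
    ultimately show ?thesis using f' by (auto simp: free_group_simps)
  qed
  moreover have "finite (c ` F')" "c ` F' \<subseteq> B" using F(1) c(1) by (auto simp: F'_def)
  ultimately show ?thesis by blast
qed

lemma finite_over_Int:
  assumes A: "subgroup A G" and Q: "subgroup Q G" and BQ: "B \<subseteq> Q" and f: "finite_over G A B"
  shows "finite_over G (A \<inter> Q) B"
proof -
  have B: "B \<subseteq> carrier G" using BQ subgroup.subset[OF Q] by blast
  obtain F where F: "finite F" "F \<subseteq> B" "\<forall>x\<in>B. \<exists>f\<in>F. x \<otimes> inv f \<in> A"
    using finite_over_representatives[OF A B f] by blast
  have "\<exists>f\<in>F. x \<otimes> inv f \<in> A \<inter> Q" if x: "x \<in> B" for x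
  proof -
    obtain f where f: "f \<in> F" "x \<otimes> inv f \<in> A" using F(3) x by blast
    moreover have "x \<otimes> inv f \<in> Q"
      using x f(1) F(2) BQ subgroup.m_closed[OF Q] subgroup.m_inv_closed[OF Q] by blast
    ultimately show ?thesis by blast
  qed
  then show ?thesis using F B unfolding finite_over_def by blast
qed

lemma subgroup_restrict_iff:
  assumes "subgroup Q G" "H \<subseteq> Q"
  shows "subgroup H (G\<lparr>carrier := Q\<rparr>) \<longleftrightarrow> subgroup H G"
  using assms incl_subgroup subgroup_incl by blast

lemma normalises_restrict_iff:
  assumes Q: "subgroup Q G" "H \<subseteq> Q" "N \<subseteq> Q"
  shows "normalises (G\<lparr>carrier := Q\<rparr>) H N \<longleftrightarrow> normalises G H N"
  using subgroup_restrict_iff Q m_inv_consistent[OF Q(1)]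
  by (auto simp: normalises_def subset_iff)

lemma derived_restrict:
  assumes Q: "subgroup Q G" "K \<subseteq> Q"
  shows "(derived (G\<lparr>carrier := Q\<rparr>) ^^ d) K = (derived G ^^ d) K"
  using group_hom.exp_of_derived_img[OF inclusion_group_hom[OF Q(1)], of K d] Q(2) by simp

lemma hyper_loc_finite_or_soluble_subgroup:
  assumes hp: "hyper_loc_finite_or_soluble G H" and Q: "subgroup Q G" "Q \<subseteq> H"
  shows "hyper_loc_finite_or_soluble G Q"
  unfolding hyper_loc_finite_or_soluble_def
proof (intro conjI allI impI Q(1))
  fix M assume M: "\<one> \<in> M" "\<not> Q \<subseteq> M"
  \<comment> \<open>Adding the complement of \<open>Q\<close> makes the two inclusions into a test
    of \<open>A \<inter> Q\<close> and \<open>B \<inter> Q\<close> against \<open>M\<close>. This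
    union is usually not a subgroup.\<close>
  have "\<one> \<in> M \<union> - Q" "\<not> H \<subseteq> M \<union> - Q" using M Q(2) by auto
  then obtain A B where AB: "normalises G H A" "normalises G H B" "A \<subseteq> B" "B \<subseteq> H"
      "A \<subseteq> M \<union> - Q" "\<not> B \<subseteq> M \<union> - Q" "loc_finite_over G A B \<or> loc_soluble_over G A B"
    using hp unfolding hyper_loc_finite_or_soluble_def by meson
  have n: "normalises G Q (A \<inter> Q)" "normalises G Q (B \<inter> Q)"
    using normalises_Int normalises_subgroup[OF AB(1) Q] normalises_subgroup[OF AB(2) Q]
      normalises_self[OF Q(1)] by blast+
  have "loc_finite_over G (A \<inter> Q) (B \<inter> Q)" if lf: "loc_finite_over G A B"
    unfolding loc_finite_over_def
  proof (intro allI impI)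
    fix S assume S: "finite S" "S \<subseteq> B \<inter> Q"
    then have "finite_over G A (generate G S)" using lf by (simp add: loc_finite_over_def)
    then show "finite_over G (A \<inter> Q) (generate G S)"
      using finite_over_Int[OF normalisesD(2)[OF AB(1)] Q(1)] generate_subgroup_incl[OF _ Q(1), of S]
        S(2) by blast
  qed
  moreover have "loc_soluble_over G (A \<inter> Q) (B \<inter> Q)" if ls: "loc_soluble_over G A B"
    unfolding loc_soluble_over_def
  proof (intro allI impI)
    fix S assume S: "finite S" "S \<subseteq> B \<inter> Q"
    then obtain d where d: "(derived G ^^ d) (generate G S) \<subseteq> A"
      using ls by (auto simp: loc_soluble_over_def)
    have "generate G S \<subseteq> Q" using generate_subgroup_incl[OF _ Q(1), of S] S(2) by blast
    then have "(derived G ^^ d) (generate G S) \<subseteq> Q"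
      using derived_incl[OF _ Q(1)] by (induction d) auto
    then show "\<exists>d. (derived G ^^ d) (generate G S) \<subseteq> A \<inter> Q" using d by blast
  qed
  ultimately show "\<exists>A B. normalises G Q A \<and> normalises G Q B \<and> A \<subseteq> B \<and> B \<subseteq> Q \<and>
      A \<subseteq> M \<and> \<not> B \<subseteq> M \<and> (loc_finite_over G A B \<or> loc_soluble_over G A B)"
    using n AB(3-7) by (intro exI[of _ "A \<inter> Q"] exI[of _ "B \<inter> Q"]) blast
qed

lemma hyper_loc_finite_or_soluble_restrict:
  assumes hp: "hyper_loc_finite_or_soluble G Q"
  shows "hyper_loc_finite_or_soluble (G\<lparr>carrier := Q\<rparr>) Q"
  unfolding hyper_loc_finite_or_soluble_def
proof (intro conjI allI impI)
  let ?R = "G\<lparr>carrier := Q\<rparr>"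
  have Q: "subgroup Q G" using hp by (simp add: hyper_loc_finite_or_soluble_def)
  interpret R: group ?R by (rule subgroup_imp_group[OF Q])
  show "subgroup Q ?R" using R.subgroup_self by simp
  fix M assume "\<one>\<^bsub>?R\<^esub> \<in> M" "\<not> Q \<subseteq> M"
  then obtain A B where AB: "normalises G Q A" "normalises G Q B" "A \<subseteq> B" "B \<subseteq> Q"
      "A \<subseteq> M" "\<not> B \<subseteq> M" "loc_finite_over G A B \<or> loc_soluble_over G A B"
    using hp unfolding hyper_loc_finite_or_soluble_def by simp meson
  have n: "normalises ?R Q A" "normalises ?R Q B"
    using AB normalises_restrict_iff[OF Q] by auto
  have "loc_finite_over ?R A B" if lf: "loc_finite_over G A B"
    unfolding loc_finite_over_def
  proof (intro allI impI)
    fix S assume S: "finite S" "S \<subseteq> B"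
    have SQ: "S \<subseteq> Q" "generate G S \<subseteq> Q"
      using S(2) AB(4) generate_subgroup_incl[OF _ Q, of S] by auto
    have "finite_over G A (generate G S)" using lf S by (simp add: loc_finite_over_def)
    \<comment> \<open>The representatives must lie in \<open>Q\<close> before the carrier is cut
      down to \<open>Q\<close>.\<close>
    then obtain F where F: "finite F" "F \<subseteq> generate G S" "\<forall>x\<in>generate G S. \<exists>f\<in>F. x \<otimes> inv f \<in> A"
      using finite_over_representatives[OF normalisesD(2)[OF AB(1)]] SQ(2) subgroup.subset[OF Q]
      by (meson subset_trans)
    have "\<forall>x\<in>generate G S. \<exists>f\<in>F. x \<otimes>\<^bsub>?R\<^esub> inv\<^bsub>?R\<^esub> f \<in> A"
      using F(2,3) SQ(2) m_inv_consistent[OF Q] by (simp add: subset_iff)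
    then show "finite_over ?R A (generate ?R S)"
      unfolding finite_over_def generate_consistent[OF SQ(1) Q] using F(1,2) SQ(2) by auto
  qed
  moreover have "loc_soluble_over ?R A B" if ls: "loc_soluble_over G A B"
    unfolding loc_soluble_over_def
  proof (intro allI impI)
    fix S assume S: "finite S" "S \<subseteq> B"
    have SQ: "S \<subseteq> Q" "generate G S \<subseteq> Q"
      using S(2) AB(4) generate_subgroup_incl[OF _ Q, of S] by auto
    show "\<exists>d. (derived ?R ^^ d) (generate ?R S) \<subseteq> A"
      unfolding generate_consistent[OF SQ(1) Q] derived_restrict[OF Q SQ(2)]
      using ls S by (simp add: loc_soluble_over_def)
  qed
  ultimately show "\<exists>A B. normalises ?R Q A \<and> normalises ?R Q B \<and> A \<subseteq> B \<and> B \<subseteq> Q \<and>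
      A \<subseteq> M \<and> \<not> B \<subseteq> M \<and> (loc_finite_over ?R A B \<or> loc_soluble_over ?R A B)"
    using n AB(3-7) by blast
qed

lemma normal_of_normalises: "normalises G (carrier G) N \<Longrightarrow> N \<lhd> G"
  by (simp add: normalises_carrier_iff)

text \<open>Given a proper \<open>L\<close>, take a factor \<open>B/A\<close> with \<open>A\<close>
  inside \<open>L\<close> and \<open>B\<close> not. In the quotient by \<open>L\<close> the image of
  \<open>B\<close> is locally finite or locally soluble, so the extension lemma lifts nilpotency
  from the quotient by \<open>?T\<close>, the join of \<open>L\<close> and \<open>B\<close>, to the
  quotient by \<open>L\<close>.\<close>

lemma engel_generated_nilpotent:
  assumes X: "finite X" "X \<subseteq> carrier G" "generate G X = carrier G"
    and e: "\<And>x. x \<in> X \<Longrightarrow> engel_element G n x"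
    and hp: "hyper_loc_finite_or_soluble G (carrier G)"
  shows "nilpotent_over G (carrier G) {\<one>}"
proof (rule finitely_generated_nilpotentI[OF X(1,2) X(3)[symmetric]])
  fix L assume L: "normalises G (carrier G) L" "L \<subset> carrier G"
  have sL: "subgroup L G" using normalisesD(2)[OF L(1)] .
  have "\<not> carrier G \<subseteq> L" using L(2) by blast
  then obtain A B where AB: "normalises G (carrier G) A" "normalises G (carrier G) B"
      "B \<subseteq> carrier G" "A \<subseteq> L" "\<not> B \<subseteq> L" "loc_finite_over G A B \<or> loc_soluble_over G A B"
    using hp subgroup.one_closed[OF sL] unfolding hyper_loc_finite_or_soluble_def by meson
  interpret L: normal L G using normal_of_normalises[OF L(1)] .
  let ?Q = "G Mod L" and ?h = "\<lambda>x. L #> x"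
  interpret h: group_hom G ?Q ?h by (rule L.quotient_group_hom)
  have ker: "kernel G ?Q ?h = L" by (rule L.quotient_kernel)
  let ?T = "generate G (\<Union>{L, B})"
  have nT: "normalises G (carrier G) ?T"
    by (rule normalises_generate_Union[OF subgroup_self]) (use L(1) AB(2) in auto)
  have TG: "?T \<subseteq> carrier G" using subgroup.subset[OF normalisesD(2)[OF nT]] .
  have "?h x = \<one>\<^bsub>?Q\<^esub>" if "x \<in> L" for x
    using that ker by (auto simp: kernel_def)
  then have hL: "?h ` L = {\<one>\<^bsub>?Q\<^esub>}" using subgroup.one_closed[OF sL] by blast
  have hA: "?h ` A \<subseteq> {\<one>\<^bsub>?Q\<^esub>}" using hL AB(4) by blast
  have hQ: "?h ` carrier G = carrier ?Q" by (simp add: carrier_FactGroup)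
  have LBG: "\<Union>{L, B} \<subseteq> carrier G" using L(2) AB(3) by auto
  have sB: "subgroup B G" using normalisesD(2)[OF AB(2)] .
  \<comment> \<open>Modulo \<open>L\<close> the join \<open>?T\<close> is nothing more than the
    image of \<open>B\<close>; its factor property is therefore that of \<open>B\<close> over
    \<open>A\<close>.\<close>
  have hT: "?h ` ?T \<subseteq> ?h ` B"
  proof -
    have "\<one>\<^bsub>?Q\<^esub> \<in> ?h ` B"
      using subgroup.one_closed[OF h.subgroup_img_is_subgroup[OF sB]] .
    then have "?h ` L \<subseteq> ?h ` B" unfolding hL by blast
    then have "?h ` (\<Union>{L, B}) \<subseteq> ?h ` B" by blast
    then have "generate ?Q (?h ` (\<Union>{L, B})) \<subseteq> ?h ` B"
      using h.subgroup_img_is_subgroup[OF sB] by (rule h.H.generate_subgroup_incl)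
    then show ?thesis using h.generate_img[OF LBG] by simp
  qed
  have "nilpotent_over G (carrier G) L" if nT': "nilpotent_over G (carrier G) ?T"
  proof -
    obtain k where k: "left_comms G X k \<subseteq> ?T"
      using nilpotent_over_iff_left_comms[OF X(2) X(3)[symmetric] nT TG] nT' by blast
    have hX: "finite (?h ` X)" "?h ` X \<subseteq> carrier ?Q" "generate ?Q (?h ` X) = carrier ?Q"
      using X h.generate_img[OF X(2)] hQ by auto
    have nB: "normalises ?Q (carrier ?Q) (?h ` B)" using h.normalises_img[OF AB(2)] hQ by simp
    have BQ: "?h ` B \<subseteq> carrier ?Q" using hQ AB(3) by auto
    have "left_comms ?Q (?h ` X) k \<subseteq> ?h ` B" 
      unfolding h.left_comms_img[OF X(2)] using image_mono[OF k, of ?h] hT by (rule subset_trans)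
    then have "nilpotent_over ?Q (carrier ?Q) (?h ` B)"
      using h.H.nilpotent_over_iff_left_comms[OF hX(2) hX(3)[symmetric] nB BQ] by blast
    moreover have "loc_finite_over ?Q {\<one>\<^bsub>?Q\<^esub>} (?h ` B) \<or> loc_soluble_over ?Q {\<one>\<^bsub>?Q\<^esub>} (?h ` B)"
      using AB(6) h.loc_finite_over_img[OF _ AB(3)] h.loc_soluble_over_img[OF _ AB(3)] hA
        finite_over_mono[OF _ hA order_refl]
      unfolding loc_finite_over_def loc_soluble_over_def by (meson subset_trans)
    moreover have "engel_element ?Q n y" if y: "y \<in> ?h ` X" for y
    proof -
      obtain x where x: "x \<in> X" "y = ?h x" using y by auto
      have xG: "x \<in> carrier G" using x X by auto
      have "iter_comm ?Q (?h g) n y = \<one>\<^bsub>?Q\<^esub>" if "g \<in> carrier G" for g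
        using h.hom_iter_comm[OF xG that, of n] engel_elementD(2)[OF e[OF x(1)] that] x(2)
          h.hom_one by simp
      then show ?thesis
        using xG x(2) hQ unfolding engel_element_def by (metis (no_types, lifting) imageE imageI)
    qed
    ultimately have "nilpotent_over ?Q (carrier ?Q) {\<one>\<^bsub>?Q\<^esub>}"
      using h.H.engel_generated_nilpotent_extension[OF hX _ nB] by blast
    then show ?thesis
      using h.nilpotent_over_img_iff[OF X(2)] X(3) hQ ker L(2) by (simp add: Int_absorb1 psubset_imp_subset)
  qed
  moreover have "L \<subset> ?T" using AB(5) by (auto intro: generate.incl)
  ultimately show "\<exists>T. normalises G (carrier G) T \<and> L \<subset> T \<and> T \<subseteq> carrier G \<and>
      (nilpotent_over G (carrier G) T \<longrightarrow> nilpotent_over G (carrier G) L)"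
    using nT TG by blast
qed

text \<open>A finite subset lies in the group generated by finitely many elements of
  \<open>E\<close>. That group inherits the Engel and series conditions, so it can take the place of
  the whole group.\<close>

theorem engel_generated_loc_nilpotent:
  assumes hp: "hyper_loc_finite_or_soluble G H" and E: "E \<subseteq> H" and e: "\<And>x. x \<in> E \<Longrightarrow> engel_element G n x"
  shows "loc_nilpotent G (generate G E)"
proof (rule loc_nilpotentI)
  have sH: "subgroup H G" using hp by (simp add: hyper_loc_finite_or_soluble_def)
  have EG: "E \<subseteq> carrier G" using E subgroup.subset[OF sH] by blast
  show "subgroup (generate G E) G" using generate_is_subgroup[OF EG] .
  fix S assume S: "finite S" "S \<subseteq> generate G E"
  obtain F where F: "finite F" "F \<subseteq> E" "S \<subseteq> generate G F"
    using generate_finite_support_set[OF S] by blast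
  let ?M = "generate G F"
  let ?R = "G\<lparr>carrier := ?M\<rparr>"
  have FG: "F \<subseteq> carrier G" using F EG by auto
  have sM: "subgroup ?M G" using generate_is_subgroup[OF FG] .
  interpret i: group_hom ?R G "\<lambda>x. x" by (rule inclusion_group_hom[OF sM])
  have FM: "F \<subseteq> ?M" by (auto intro: generate.incl)
  have gen: "generate ?R F = ?M" by (rule generate_consistent[OF FM sM])
  have MH: "?M \<subseteq> H" using generate_subgroup_incl[OF _ sH, of F] F E by auto
  have "engel_element ?R n x" if x: "x \<in> F" for x
  proof -
    have "iter_comm ?R g n x = \<one>\<^bsub>?R\<^esub>" if "g \<in> ?M" for g
    proof -
      have "x \<in> ?M" "x \<in> E" "g \<in> carrier G"
        using x F(2) FM that subgroup.mem_carrier[OF sM] by auto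
      then show ?thesis
        using i.hom_iter_comm[of x g n] engel_elementD(2)[OF e, of x g] that by simp
    qed
    then show ?thesis using x FM by (auto simp: engel_element_def)
  qed
  moreover have "hyper_loc_finite_or_soluble ?R ?M"
    by (rule hyper_loc_finite_or_soluble_restrict[OF hyper_loc_finite_or_soluble_subgroup[OF hp sM MH]])
  ultimately have "nilpotent_over ?R (generate ?R F) {\<one>}"
    using i.G.engel_generated_nilpotent[of F] F(1) FM gen by auto
  then have "nilpotent_over ?R (generate ?R F) (generate ?R F \<inter> kernel ?R G (\<lambda>x. x))"
    using gen generate.one[of G F] i.G.nilpotent_over_mono i.G.subgroup_self
    by (auto simp: kernel_def intro!: i.G.nilpotent_over_mono)
  then have "nilpotent_over G ?M {\<one>}" using i.nilpotent_over_img_iff[of F] FM gen by simp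
  then have "loc_nilpotent G ?M" by (rule loc_nilpotent_of_nilpotent[OF sM])
  then show "\<exists>K. S \<subseteq> K \<and> loc_nilpotent G K" using F by blast
qed

end

section \<open>Locally finite groups\<close>

context group
begin

definition list_prod :: "'a list \<Rightarrow> 'a" where
  "list_prod xs = foldr (\<otimes>) xs \<one>"

lemma list_prod_simps [simp]: "list_prod [] = \<one>" "list_prod (x # xs) = x \<otimes> list_prod xs"
  by (simp_all add: list_prod_def)

lemma list_prod_closed [simp]: "set xs \<subseteq> carrier G \<Longrightarrow> list_prod xs \<in> carrier G"
  by (induction xs) auto

lemma list_prod_append:
  "set xs \<subseteq> carrier G \<Longrightarrow> set ys \<subseteq> carrier G \<Longrightarrow> list_prod (xs @ ys) = list_prod xs \<otimes> list_prod ys"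
  by (induction xs) (auto simp: m_assoc)

lemma list_prod_conj:
  "t \<in> carrier G \<Longrightarrow> set xs \<subseteq> carrier G \<Longrightarrow>
    t \<otimes> list_prod (map (\<lambda>x. inv t \<otimes> x \<otimes> t) xs) = list_prod xs \<otimes> t"
proof (induction xs)
  case (Cons x xs)
  let ?p = "list_prod (map (\<lambda>x. inv t \<otimes> x \<otimes> t) xs)"
  have c: "set (map (\<lambda>x. inv t \<otimes> x \<otimes> t) xs) \<subseteq> carrier G" using Cons by auto
  have "t \<otimes> list_prod (map (\<lambda>x. inv t \<otimes> x \<otimes> t) (x # xs)) = x \<otimes> (t \<otimes> ?p)"
    using Cons.prems list_prod_closed[OF c] by (simp add: free_group_simps)
  also have "\<dots> = list_prod (x # xs) \<otimes> t" using Cons by (simp add: m_assoc)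
  finally show ?case .
qed simp

text \<open>Moving \<open>x\<close> to the front conjugates the letters it passes by
  \<open>x\<close>; these stay in \<open>X\<close>, and the length is unchanged.\<close>

lemma list_prod_extract_power:
  assumes X: "X \<subseteq> carrier G" and x: "x \<in> X"
    and conj: "\<And>y. y \<in> X \<Longrightarrow> inv x \<otimes> y \<otimes> x \<in> X"
  shows "set xs \<subseteq> X \<Longrightarrow> k \<le> count_list xs x \<Longrightarrow>
    \<exists>ys. set ys \<subseteq> X \<and> length ys + k = length xs \<and> list_prod xs = x [^] k \<otimes> list_prod ys"
proof (induction k arbitrary: xs)
  case 0
  then have "list_prod xs \<in> carrier G" using X by (intro list_prod_closed) auto
  then show ?case using 0 by (intro exI[of _ xs]) simp
next
  case (Suc k)
  have "x \<in> set xs" using Suc.prems(2) by (metis count_notin not_less_eq_eq zero_le)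
  \<comment> \<open>With the first occurrence, all others are in \<open>vs\<close>, which is not
    conjugated, so they are still there for the induction.\<close>
  then obtain us vs where uv: "xs = us @ x # vs" "x \<notin> set us" using split_list_first by metis
  have xG: "x \<in> carrier G" using x X by auto
  have usG: "set us \<subseteq> carrier G" "set vs \<subseteq> carrier G" using Suc.prems(1) uv X by auto
  let ?us = "map (\<lambda>y. inv x \<otimes> y \<otimes> x) us"
  have us: "set ?us \<subseteq> X" "set ?us \<subseteq> carrier G" using conj uv Suc.prems(1) usG xG by auto
  have "k \<le> count_list (?us @ vs) x" using Suc.prems(2) uv by simp
  then obtain ys where ys: "set ys \<subseteq> X" "length ys + k = length (?us @ vs)"
      "list_prod (?us @ vs) = x [^] k \<otimes> list_prod ys"
    using Suc.IH[of "?us @ vs"] us uv Suc.prems(1) by auto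
  have ysG: "set ys \<subseteq> carrier G" using ys X by auto
  have "list_prod xs = (list_prod us \<otimes> x) \<otimes> list_prod vs"
    using uv usG xG list_prod_append[of us "x # vs"] by (simp add: m_assoc)
  also have "\<dots> = (x \<otimes> list_prod ?us) \<otimes> list_prod vs" using list_prod_conj[OF xG usG(1)] by simp
  also have "\<dots> = x \<otimes> (x [^] k \<otimes> list_prod ys)"
    using list_prod_append[OF us(2) usG(2)] ys(3) list_prod_closed[OF us(2)] xG usG
    by (simp add: m_assoc)
  also have "\<dots> = (x \<otimes> x [^] k) \<otimes> list_prod ys" using xG ysG by (simp add: m_assoc)
  also have "x \<otimes> x [^] k = x [^] Suc k" using nat_pow_Suc2[OF xG] by simp
  finally show ?case using ys uv by (intro exI[of _ ys]) auto
qed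

text \<open>The inverse of an element of finite order is a nonnegative power, so words without
  inverses suffice.\<close>

lemma torsion_inv_list_prod:
  assumes "x \<in> X" "X \<subseteq> carrier G" "torsion G x"
  shows "\<exists>xs. set xs \<subseteq> X \<and> inv x = list_prod xs"
proof -
  have xG: "x \<in> carrier G" using assms by auto
  obtain k where k: "k > 0" "x [^] (k::nat) = \<one>" using assms by (auto simp: torsion_def)
  then obtain j where j: "k = Suc j" using gr0_implies_Suc by blast
  have "x [^] j \<otimes> x = \<one>" using k j by simp
  then have "inv x = x [^] j" using xG by (simp add: inv_equality)
  moreover have "list_prod (replicate j x) = x [^] j"
    using nat_pow_Suc2[OF xG] by (induction j) auto
  ultimately show ?thesis using assms by (intro exI[of _ "replicate j x"]) auto
qed

lemma generate_eq_list_prods: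
  assumes X: "X \<subseteq> carrier G" and t: "\<And>x. x \<in> X \<Longrightarrow> torsion G x" and g: "g \<in> generate G X"
  shows "\<exists>xs. set xs \<subseteq> X \<and> g = list_prod xs"
  using g
proof induction
  case one
  then show ?case by (intro exI[of _ "[]"]) auto
next
  case (incl h)
  then show ?case using X by (intro exI[of _ "[h]"]) auto
next
  case (inv h)
  then show ?case using torsion_inv_list_prod[OF inv X t] by auto
next
  case (eng h1 h2)
  then obtain xs ys where "set xs \<subseteq> X" "h1 = list_prod xs" "set ys \<subseteq> X" "h2 = list_prod ys"
    by blast
  then show ?case using X list_prod_append[of xs ys] by (intro exI[of _ "xs @ ys"]) auto
qed

text \<open>Dietzmann's lemma: a word in which some \<open>x\<close> occurs at least \<open>ord x\<close> times
  can be shortened, after moving these occurrences to the front.\<close>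

theorem dietzmann:
  assumes fin: "finite X" and X: "X \<subseteq> carrier G" and t: "\<And>x. x \<in> X \<Longrightarrow> torsion G x"
    and conj: "\<And>x y. x \<in> X \<Longrightarrow> y \<in> X \<Longrightarrow> inv x \<otimes> y \<otimes> x \<in> X"
  shows "finite (generate G X)"
proof -
  have "\<exists>k. \<forall>x\<in>X. k x > 0 \<and> x [^] (k x :: nat) = \<one>" using t unfolding torsion_def by metis
  then obtain k where k: "\<And>x. x \<in> X \<Longrightarrow> k x > 0" "\<And>x. x \<in> X \<Longrightarrow> x [^] (k x :: nat) = \<one>"
    by blast
  let ?B = "sum k X"
  have short: "set xs \<subseteq> X \<Longrightarrow> \<exists>ys. set ys \<subseteq> X \<and> length ys \<le> ?B \<and> list_prod xs = list_prod ys" for xs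
  proof (induction "length xs" arbitrary: xs rule: less_induct)
    case less
    show ?case
    proof (cases "length xs \<le> ?B")
      case False
      have "sum (count_list xs) X = length xs"
        using less.prems fin by (rule sum_count_set)
      then have "\<not> (\<forall>x\<in>X. count_list xs x \<le> k x)" using False sum_mono[of X "count_list xs" k] by auto
      then obtain x where x: "x \<in> X" "k x \<le> count_list xs x" by force
      obtain ys where ys: "set ys \<subseteq> X" "length ys + k x = length xs"
          "list_prod xs = x [^] k x \<otimes> list_prod ys"
        using list_prod_extract_power[OF X x(1) conj[OF x(1)] less.prems x(2)] by blast
      have "list_prod xs = list_prod ys" using ys(1,3) k(2)[OF x(1)] X by auto
      moreover have "length ys < length xs" using ys(2) k(1)[OF x(1)] by linarith
      ultimately show ?thesis using less.hyps[OF _ ys(1)] by auto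
    qed (use less.prems in blast)
  qed
  have "generate G X \<subseteq> list_prod ` {ys. set ys \<subseteq> X \<and> length ys \<le> ?B}"
  proof
    fix g assume "g \<in> generate G X"
    then obtain xs where xs: "set xs \<subseteq> X" "g = list_prod xs"
      using generate_eq_list_prods[OF X t] by blast
    obtain ys where "set ys \<subseteq> X" "length ys \<le> ?B" "list_prod xs = list_prod ys"
      using short[OF xs(1)] by blast
    then show "g \<in> list_prod ` {ys. set ys \<subseteq> X \<and> length ys \<le> ?B}" using xs(2) by blast
  qed
  then show ?thesis using finite_lists_length_le[OF fin] finite_subset by blast
qed

lemma torsion_conj:
  assumes "x \<in> carrier G" "t \<in> carrier G" "torsion G x"
  shows "torsion G (inv t \<otimes> x \<otimes> t)"
proof -
  interpret c: group_hom G G "\<lambda>x. inv t \<otimes> x \<otimes> t" by (rule conj_group_hom[OF assms(2)])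
  obtain k where "k > 0" "x [^] (k::nat) = \<one>" using assms by (auto simp: torsion_def)
  then have "k > 0" "(inv t \<otimes> x \<otimes> t) [^] k = \<one>"
    using c.hom_nat_pow[OF assms(1), of k] assms(2) by auto
  then show ?thesis by (auto simp: torsion_def)
qed

text \<open>Conjugation by \<open>q\<close> depends only on the coset of \<open>q\<close> modulo the
  centralising subgroup \<open>Z\<close>. So the generators have finitely many conjugates, all of
  finite order, and Dietzmann's lemma applies to these.\<close>

lemma central_by_finite_generated_by_torsion:
  assumes Y: "finite Y" "Y \<subseteq> carrier G" and t: "\<And>y. y \<in> Y \<Longrightarrow> torsion G y"
    and Z: "subgroup Z G" and f: "finite_over G Z (generate G Y)"
    and c: "\<And>z q. z \<in> Z \<Longrightarrow> q \<in> generate G Y \<Longrightarrow> z \<otimes> q = q \<otimes> z"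
  shows "finite (generate G Y)"
proof -
  let ?Q = "generate G Y"
  have sQ: "subgroup ?Q G" using generate_is_subgroup[OF Y(2)] .
  have QG: "?Q \<subseteq> carrier G" using subgroup.subset[OF sQ] .
  obtain F where F: "finite F" "F \<subseteq> ?Q" "\<forall>x\<in>?Q. \<exists>f\<in>F. x \<otimes> inv f \<in> Z"
    using finite_over_representatives[OF Z QG f] by blast
  define X where "X = {inv q \<otimes> y \<otimes> q | q y. q \<in> ?Q \<and> y \<in> Y}"
  have "X \<subseteq> (\<lambda>(f, y). inv f \<otimes> y \<otimes> f) ` (F \<times> Y)"
  proof
    fix x assume "x \<in> X"
    then obtain q y where q: "q \<in> ?Q" "y \<in> Y" "x = inv q \<otimes> y \<otimes> q" by (auto simp: X_def)
    then obtain f where f: "f \<in> F" "q \<otimes> inv f \<in> Z" using F(3) by blast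
    have g: "q \<in> carrier G" "f \<in> carrier G" "y \<in> carrier G" using q f F(2) QG Y(2) by auto
    have yQ: "y \<in> ?Q" using q(2) by (auto intro: generate.incl)
    have "inv q \<otimes> y \<otimes> q = inv f \<otimes> (inv (q \<otimes> inv f) \<otimes> (y \<otimes> (q \<otimes> inv f))) \<otimes> f"
      using g by (simp add: free_group_simps)
    also have "y \<otimes> (q \<otimes> inv f) = (q \<otimes> inv f) \<otimes> y" using c[OF f(2) yQ] by simp
    also have "inv f \<otimes> (inv (q \<otimes> inv f) \<otimes> ((q \<otimes> inv f) \<otimes> y)) \<otimes> f = inv f \<otimes> y \<otimes> f"
      using g by (simp add: free_group_simps)
    finally show "x \<in> (\<lambda>(f, y). inv f \<otimes> y \<otimes> f) ` (F \<times> Y)" using f q by auto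
  qed
  then have finX: "finite X" using F(1) Y(1) finite_subset by blast
  have "Y \<subseteq> ?Q" by (auto intro: generate.incl)
  then have XQ: "X \<subseteq> ?Q"
    using subgroup.m_closed[OF sQ] subgroup.m_inv_closed[OF sQ] by (auto simp: X_def subset_iff)
  have XG: "X \<subseteq> carrier G" using XQ QG by blast
  have "finite (generate G X)"
  proof (rule dietzmann[OF finX XG])
    show "torsion G x" if "x \<in> X" for x
      using that t torsion_conj QG Y(2) by (auto simp: X_def subset_iff)
    fix x y assume x: "x \<in> X" and "y \<in> X"
    then obtain q u where q: "q \<in> ?Q" "u \<in> Y" "y = inv q \<otimes> u \<otimes> q" by (auto simp: X_def)
    have "q \<otimes> x \<in> ?Q" using subgroup.m_closed[OF sQ q(1)] x XQ by blast
    moreover have "inv x \<otimes> y \<otimes> x = inv (q \<otimes> x) \<otimes> u \<otimes> (q \<otimes> x)"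
      using q x XG QG Y(2) by (simp add: free_group_simps subset_iff)
    ultimately show "inv x \<otimes> y \<otimes> x \<in> X" using q(2) unfolding X_def by blast
  qed
  moreover have "Y \<subseteq> X"
  proof
    fix y assume y: "y \<in> Y"
    have "y = inv \<one> \<otimes> y \<otimes> \<one>" using y Y(2) by auto
    then show "y \<in> X" unfolding X_def using generate.one y by blast
  qed
  ultimately show ?thesis using mono_generate[of Y X] finite_subset by blast
qed

lemma loc_finite_central_by_loc_finite:
  assumes Y: "Y \<subseteq> carrier G" and t: "\<And>y. y \<in> Y \<Longrightarrow> torsion G y"
    and Z: "subgroup Z G" and f: "loc_finite_over G Z (generate G Y)"
    and c: "\<And>z q. z \<in> Z \<Longrightarrow> q \<in> generate G Y \<Longrightarrow> z \<otimes> q = q \<otimes> z"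
  shows "loc_finite G (generate G Y)"
  unfolding loc_finite_def
proof (intro conjI allI impI)
  show "subgroup (generate G Y) G" by (rule generate_is_subgroup[OF Y])
  fix S assume S: "finite S" "S \<subseteq> generate G Y"
  obtain F where F: "finite F" "F \<subseteq> Y" "S \<subseteq> generate G F"
    using generate_finite_support_set[OF S] by blast
  have FQ: "F \<subseteq> generate G Y" using F by (auto intro: generate.incl)
  have FG: "F \<subseteq> carrier G" using F Y by auto
  have "generate G F \<subseteq> generate G Y" using F by (intro mono_generate)
  moreover have "finite_over G Z (generate G F)" using f F(1) FQ by (simp add: loc_finite_over_def)
  ultimately have "finite (generate G F)"
    using central_by_finite_generated_by_torsion[OF F(1) FG _ Z] t c F(2) by blast
  then show "finite (generate G S)"
    using generate_idem[OF FG F(3)] finite_subset by blast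
qed

text \<open>The central-by-locally-finite case with \<open>Z\<close> equal to the whole generated
  group.\<close>

lemma loc_finite_abelian_generated_by_torsion:
  assumes Y: "Y \<subseteq> carrier G" and t: "\<And>y. y \<in> Y \<Longrightarrow> torsion G y"
    and c: "\<And>x y. x \<in> generate G Y \<Longrightarrow> y \<in> generate G Y \<Longrightarrow> x \<otimes> y = y \<otimes> x"
  shows "loc_finite G (generate G Y)"
proof (rule loc_finite_central_by_loc_finite[OF Y t generate_is_subgroup[OF Y] _ c])
  show "loc_finite_over G (generate G Y) (generate G Y)"
    unfolding loc_finite_over_def
  proof (intro allI impI)
    fix S assume "S \<subseteq> generate G Y"
    then have "generate G S \<subseteq> generate G Y" by (rule generate_idem[OF Y])
    moreover have "x \<otimes> inv \<one> \<in> generate G Y" if "x \<in> generate G Y" for x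
      using that generate_in_carrier[OF Y that] by simp
    ultimately show "finite_over G (generate G Y) (generate G S)"
      unfolding finite_over_def by (intro exI[of _ "{\<one>}"]) auto
  qed
qed

text \<open>Schreier's argument: the finitely many products \<open>t s u^-1\<close> lying in
  \<open>A\<close> generate a finite group \<open>?D\<close>, and the finite set of products of
  \<open>?D\<close> with the representatives is closed under right multiplication by
  generators.\<close>

lemma finite_extension:
  assumes A: "loc_finite G A" and S: "finite S" "S \<subseteq> carrier G" and f: "finite_over G A (generate G S)"
  shows "finite (generate G S)"
proof -
  let ?M = "generate G S"
  have sA: "subgroup A G" using A by (simp add: loc_finite_def)
  have sM: "subgroup ?M G" using generate_is_subgroup[OF S(2)] .
  have MG: "?M \<subseteq> carrier G" using subgroup.subset[OF sM] .
  obtain F where F: "finite F" "F \<subseteq> ?M" "\<forall>x\<in>?M. \<exists>f\<in>F. x \<otimes> inv f \<in> A"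
    using finite_over_representatives[OF sA MG f] by blast
  \<comment> \<open>The identity is added so that the final set \<open>P\<close> contains
    it.\<close>
  define T where "T = insert \<one> F"
  define S' where "S' = S \<union> (\<lambda>s. inv s) ` S"
  have T: "finite T" "T \<subseteq> ?M" "\<one> \<in> T" using F generate.one by (auto simp: T_def)
  have S': "finite S'" "S' \<subseteq> ?M" using S by (auto simp: S'_def intro: generate.incl generate.inv)
  define C where "C = A \<inter> (\<lambda>(t, s, u). t \<otimes> s \<otimes> inv u) ` (T \<times> S' \<times> T)"
  have finC: "finite C" using T S' by (auto simp: C_def)
  have CA: "C \<subseteq> A" by (auto simp: C_def)
  have CG: "C \<subseteq> carrier G" using CA subgroup.subset[OF sA] by blast
  let ?D = "generate G C"
  have finD: "finite ?D" using A finC CA by (simp add: loc_finite_def)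
  define P where "P = (\<lambda>(d, t). d \<otimes> t) ` (?D \<times> T)"
  have step: "p \<otimes> s \<in> P" if p: "p \<in> P" and s: "s \<in> S'" for p s
  proof -
    obtain d t where dt: "d \<in> ?D" "t \<in> T" "p = d \<otimes> t" using p by (auto simp: P_def)
    have "t \<otimes> s \<in> ?M" using dt s T S' subgroup.m_closed[OF sM] by blast
    then obtain u where u: "u \<in> F" "t \<otimes> s \<otimes> inv u \<in> A" using F(3) by blast
    then have uT: "u \<in> T" by (simp add: T_def)
    have "t \<otimes> s \<otimes> inv u \<in> C"
      unfolding C_def using u(2) dt(2) s uT by (intro IntI image_eqI[of _ _ "(t, s, u)"]) auto
    then have "d \<otimes> (t \<otimes> s \<otimes> inv u) \<in> ?D" using dt(1) by (blast intro: generate.eng generate.incl)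
    then have "d \<otimes> (t \<otimes> s \<otimes> inv u) \<otimes> u \<in> P" using uT unfolding P_def by blast
    moreover have "d \<in> carrier G" "t \<in> carrier G" "s \<in> carrier G" "u \<in> carrier G"
      using generate_in_carrier[OF CG dt(1)] dt(2) s uT T(2) S'(2) MG by auto
    ultimately show ?thesis using dt(3) by (simp add: free_group_simps)
  qed
  have PG: "p \<in> carrier G" if "p \<in> P" for p
    using that generate_in_carrier[OF CG] T(2) MG by (auto simp: P_def)
  have "\<forall>p\<in>P. p \<otimes> m \<in> P" if "m \<in> ?M" for m
    using that
  proof induction
    case one
    then show ?case using PG by simp
  next
    case (incl h)
    then show ?case using step by (auto simp: S'_def)
  next
    case (inv h)
    then show ?case using step by (auto simp: S'_def)
  next
    case (eng h1 h2)
    then have "p \<otimes> h1 \<otimes> h2 \<in> P" if "p \<in> P" for p using that by blast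
    moreover have "h1 \<in> carrier G" "h2 \<in> carrier G" using eng MG by auto
    ultimately show ?case using PG by (simp add: m_assoc)
  qed
  moreover have "\<one> \<in> P"
  proof -
    have "\<one> \<otimes> \<one> \<in> P" unfolding P_def using T(3) generate.one by blast
    then show ?thesis by simp
  qed
  ultimately have "?M \<subseteq> P" using MG by force
  moreover have "finite P" using finD T(1) by (auto simp: P_def)
  ultimately show ?thesis using finite_subset by blast
qed

lemma loc_finite_extension:
  assumes "loc_finite G A" "subgroup B G" "loc_finite_over G A B"
  shows "loc_finite G B"
  using assms finite_extension subgroup.subset[OF assms(2)]
  unfolding loc_finite_def loc_finite_over_def by (metis subset_trans)

text \<open>Modulo \<open>A\<close>, a finitely generated subgroup of the join is covered by the
  finite group that its generators from \<open>B\<close> generate.\<close>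

lemma loc_finite_Un:
  assumes A: "loc_finite G A" and B: "loc_finite G B" and n: "normalises G B A"
  shows "loc_finite G (generate G (A \<union> B))"
proof (rule loc_finite_extension[OF A])
  have sA: "subgroup A G" and sB: "subgroup B G" using A B by (simp_all add: loc_finite_def)
  have G: "A \<subseteq> carrier G" "B \<subseteq> carrier G" using subgroup.subset sA sB by auto
  show "subgroup (generate G (A \<union> B)) G" using G by (intro generate_is_subgroup) auto
  show "loc_finite_over G A (generate G (A \<union> B))"
    unfolding loc_finite_over_def
  proof (intro allI impI)
    fix S assume S: "finite S" "S \<subseteq> generate G (A \<union> B)"
    then obtain F where F: "finite F" "F \<subseteq> A \<union> B" "S \<subseteq> generate G F"
      using generate_finite_support_set[OF S] by blast
    let ?B = "generate G (F \<inter> B)"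
    have FB: "F \<inter> B \<subseteq> carrier G" using G by auto
    have BB: "?B \<subseteq> B" using generate_subgroup_incl[OF _ sB] by blast
    have finB: "finite ?B" using B F(1) by (simp add: loc_finite_def)
    \<comment> \<open>The union of the cosets \<open>A b\<close> with \<open>b\<close> in
      \<open>?B\<close> is preserved by right multiplication; a factor from \<open>A\<close> is
      moved past \<open>b\<close> by normality.\<close>
    have closed: "\<exists>b'\<in>?B. x \<otimes> y \<otimes> inv b' \<in> A"
      if "x \<in> carrier G" "b \<in> ?B" "x \<otimes> inv b \<in> A" "y \<in> A \<or> y \<in> ?B" for x y b
    proof -
      have bG: "b \<in> carrier G" using generate_in_carrier[OF FB that(2)] .
      show ?thesis
      proof (cases "y \<in> A")
        case True
        have "(x \<otimes> inv b) \<otimes> (b \<otimes> y \<otimes> inv b) \<in> A"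
          using that(3) normalisesD(4)[OF n _ True, of b] BB that(2) subgroup.m_closed[OF sA] by blast
        then have "x \<otimes> y \<otimes> inv b \<in> A" using that(1) bG True G by (simp add: free_group_simps subset_iff)
        then show ?thesis using that(2) by blast
      next
        case False
        then have y: "y \<in> ?B" using that(4) by simp
        have "x \<otimes> y \<otimes> inv (b \<otimes> y) \<in> A"
          using that(1,3) bG generate_in_carrier[OF FB y] by (simp add: free_group_simps)
        then show ?thesis using generate.eng[OF that(2) y] by blast
      qed
    qed
    have FG: "F \<subseteq> carrier G" using F(2) G by auto
    have "\<forall>x\<in>carrier G. (\<exists>b\<in>?B. x \<otimes> inv b \<in> A) \<longrightarrow> (\<exists>b\<in>?B. x \<otimes> m \<otimes> inv b \<in> A)"
      if "m \<in> generate G F" for m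
      using that
    proof induction
      case one
      then show ?case by simp
    next
      case (incl y)
      then have "y \<in> A \<or> y \<in> ?B" using F(2) by (auto intro: generate.incl)
      then show ?case using closed by blast
    next
      case (inv y)
      then have "inv y \<in> A \<or> inv y \<in> ?B"
        using F(2) subgroup.m_inv_closed[OF sA] by (auto intro: generate.inv)
      then show ?case using closed by blast
    next
      case (eng h1 h2)
      have h: "h1 \<in> carrier G" "h2 \<in> carrier G" using eng generate_in_carrier[OF FG] by auto
      show ?case
      proof (intro ballI impI)
        fix x assume x: "x \<in> carrier G" "\<exists>b\<in>?B. x \<otimes> inv b \<in> A"
        then have "\<exists>b\<in>?B. x \<otimes> h1 \<otimes> inv b \<in> A" using eng.IH(1) by blast
        then have "\<exists>b\<in>?B. x \<otimes> h1 \<otimes> h2 \<otimes> inv b \<in> A" using eng.IH(2) x(1) h by auto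
        then show "\<exists>b\<in>?B. x \<otimes> (h1 \<otimes> h2) \<otimes> inv b \<in> A" using x(1) h by (simp add: m_assoc)
      qed
    qed
    moreover have "\<exists>b\<in>?B. \<one> \<otimes> inv b \<in> A"
      using generate.one subgroup.one_closed[OF sA] by (intro bexI[of _ \<one>]) auto
    ultimately have "\<exists>b\<in>?B. m \<otimes> inv b \<in> A" if "m \<in> generate G F" for m
      using that generate_in_carrier[OF FG that] by (metis l_one one_closed)
    then have "finite_over G A (generate G F)"
      unfolding finite_over_def using finB BB G by (intro exI[of _ ?B]) auto
    then show "finite_over G A (generate G S)"
      using finite_over_mono generate_idem[OF FG F(3)] by blast
  qed
qed

lemma loc_finite_Union:
  assumes "subgroup R G"
    and "\<And>P. P \<in> \<P> \<Longrightarrow> normalises G R P" "\<And>P. P \<in> \<P> \<Longrightarrow> P \<subseteq> R"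
      "\<And>P. P \<in> \<P> \<Longrightarrow> loc_finite G P"
  shows "loc_finite G (generate G (\<Union>\<P>))"
proof (rule local_property_Union[where R = R])
  show "loc_finite G H" if "subgroup H G"
    and *: "\<And>S. finite S \<Longrightarrow> S \<subseteq> H \<Longrightarrow> \<exists>K. S \<subseteq> K \<and> loc_finite G K" for H
    unfolding loc_finite_def
  proof (intro conjI allI impI that(1))
    fix S assume S: "finite S" "S \<subseteq> H"
    then obtain K where "S \<subseteq> K" "loc_finite G K" using * by blast
    then show "finite (generate G S)" using S(1) by (simp add: loc_finite_def)
  qed
  have "finite (generate G S)" if "S \<subseteq> {\<one>}" for S
    using generate_subgroup_incl[OF that triv_subgroup] by (rule finite_subset) simp
  then show "loc_finite G {\<one>}"
    using triv_subgroup by (simp add: loc_finite_def)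
  show "loc_finite G (generate G (A \<union> B))"
    if "loc_finite G A" "loc_finite G B" "normalises G B A" for A B
    using that by (rule loc_finite_Un)
qed (use assms in simp_all)

end

section \<open>Verbal subgroups\<close>

text \<open>Values with entries in a subgroup \<open>K\<close>, evaluated in \<open>G\<close>, so
  that \<open>v(K)\<close> stays inside \<open>G\<close>; the argument needs \<open>v(H)\<close> and
  \<open>v(L)\<close> beside \<open>v(G)\<close>.\<close>

definition values_in :: "('a, 'b) monoid_scheme \<Rightarrow> 'a set \<Rightarrow> group_word \<Rightarrow> 'a set" where
  "values_in G K v = {word_eval G f v | f. \<forall>i. f i \<in> K}"

definition verbal_in :: "('a, 'b) monoid_scheme \<Rightarrow> 'a set \<Rightarrow> group_word \<Rightarrow> 'a set" where
  "verbal_in G K v = generate G (values_in G K v)"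

text \<open>Assignments are total functions, so the entry in \<open>N\<close> is required at a
  variable that occurs in \<open>v\<close>; otherwise an irrelevant index could satisfy the
  condition.\<close>

definition mixed_values :: "('a, 'b) monoid_scheme \<Rightarrow> 'a set \<Rightarrow> 'a set \<Rightarrow> group_word \<Rightarrow> 'a set" where
  "mixed_values G K N v =
     {word_eval G f v | f. (\<forall>i. f i \<in> K) \<and> (\<exists>i\<in>word_vars v. f i \<in> N)}"

lemma finite_word_vars: "finite (word_vars w)"
  by (induction w) auto

lemma word_eval_cong:
  "(\<And>i. i \<in> word_vars w \<Longrightarrow> f i = g i) \<Longrightarrow> word_eval G f w = word_eval G g w"
  by (induction w) auto

lemma word_eval_comm_word:
  "word_eval G f (comm_word x y) = group_comm G (word_eval G f x) (word_eval G f y)"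
  by (simp add: comm_word_def group_comm_def)

lemma word_vars_comm_word: "word_vars (comm_word x y) = word_vars x \<union> word_vars y"
  by (auto simp: comm_word_def)

lemma (in group_hom) values_in_img:
  assumes "K \<subseteq> carrier G"
  shows "values_in H (h ` K) v = h ` values_in G K v"
proof
  show "h ` values_in G K v \<subseteq> values_in H (h ` K) v"
  proof
    fix y assume "y \<in> h ` values_in G K v"
    then obtain f where f: "\<And>i. f i \<in> K" "y = h (word_eval G f v)" by (auto simp: values_in_def)
    then have "y = word_eval H (h \<circ> f) v" using hom_word_eval assms by blast
    then show "y \<in> values_in H (h ` K) v" using f by (auto simp: values_in_def)
  qed
  show "values_in H (h ` K) v \<subseteq> h ` values_in G K v"
  proof
    fix y assume "y \<in> values_in H (h ` K) v"
    then obtain g where g: "\<And>i. g i \<in> h ` K" "y = word_eval H g v" by (auto simp: values_in_def)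
    then have "\<forall>i. \<exists>x. x \<in> K \<and> g i = h x" by blast
    then obtain f where f: "\<And>i. f i \<in> K" "\<And>i. g i = h (f i)" by metis
    then have "g = h \<circ> f" by auto
    moreover have "f i \<in> carrier G" for i using f(1) assms by blast
    ultimately have "y = h (word_eval G f v)" using hom_word_eval[of f v] g(2) by simp
    then show "y \<in> h ` values_in G K v" using f by (auto simp: values_in_def)
  qed
qed

lemma (in group_hom) verbal_in_img:
  assumes "K \<subseteq> carrier G"
  shows "verbal_in H (h ` K) v = h ` verbal_in G K v"
proof -
  have "values_in G K v \<subseteq> carrier G"
    using assms G.word_eval_closed unfolding values_in_def by blast
  then show ?thesis
    using generate_img values_in_img[OF assms] by (simp add: verbal_in_def)
qed

lemma (in group_hom) hom_torsion:
  assumes "x \<in> carrier G" "torsion G x"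
  shows "torsion H (h x)"
  using assms hom_nat_pow[OF assms(1)] unfolding torsion_def by (metis hom_one)

context group
begin

lemma word_eval_in_subgroup:
  assumes "subgroup K G" "\<And>i. f i \<in> K"
  shows "word_eval G f w \<in> K"
  using assms by (induction w) (auto simp: subgroup.m_closed subgroup.m_inv_closed subgroup.one_closed)

lemma values_in_subset: "subgroup K G \<Longrightarrow> values_in G K v \<subseteq> K"
  using word_eval_in_subgroup by (auto simp: values_in_def)

lemma verbal_in_subset: "subgroup K G \<Longrightarrow> verbal_in G K v \<subseteq> K"
  unfolding verbal_in_def using values_in_subset generate_subgroup_incl by blast

lemma word_eval_conj:
  assumes "t \<in> carrier G" "\<And>i. f i \<in> carrier G"
  shows "inv t \<otimes> word_eval G f w \<otimes> t = word_eval G (\<lambda>i. inv t \<otimes> f i \<otimes> t) w"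
  using group_hom.hom_word_eval[OF conj_group_hom[OF assms(1)] assms(2)] by (simp add: comp_def)

lemma normalises_values:
  assumes R: "normalises G R K" and r: "r \<in> R" and x: "x \<in> values_in G K v"
  shows "inv r \<otimes> x \<otimes> r \<in> values_in G K v"
proof -
  note d = normalisesD[OF R]
  obtain f where f: "\<And>i. f i \<in> K" "x = word_eval G f v" using x by (auto simp: values_in_def)
  then have "inv r \<otimes> x \<otimes> r = word_eval G (\<lambda>i. inv r \<otimes> f i \<otimes> r) v"
    using word_eval_conj subgroup.mem_carrier[OF d(1) r] subgroup.mem_carrier[OF d(2)] by blast
  then show ?thesis using d(3)[OF r f(1)] unfolding values_in_def by blast
qed

lemma normalises_verbal_in:
  assumes R: "normalises G R K"
  shows "normalises G R (verbal_in G K v)"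
  unfolding verbal_in_def
proof (rule normalises_generate_right[OF normalisesD(1)[OF R]])
  show "values_in G K v \<subseteq> carrier G"
    using values_in_subset[OF normalisesD(2)[OF R]] subgroup.subset[OF normalisesD(2)[OF R]] by blast
  show "inv h \<otimes> x \<otimes> h \<in> generate G (values_in G K v)" if "h \<in> R" "x \<in> values_in G K v" for h x
    using normalises_values[OF R that] by (rule generate.incl)
qed

lemma mixed_values_subset: "mixed_values G K N v \<subseteq> values_in G K v"
  by (auto simp: mixed_values_def values_in_def)

lemma normalises_mixed_values:
  assumes N: "normalises G K N"
  shows "normalises G K (generate G (mixed_values G K N v))"
proof (rule normalises_generate_right[OF normalisesD(1)[OF N]])
  note d = normalisesD[OF N]
  note s = normalisesD(3)[OF normalises_self[OF d(1)]]
  show "mixed_values G K N v \<subseteq> carrier G"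
    using mixed_values_subset[of K N v] values_in_subset[OF d(1), of v] subgroup.subset[OF d(1)] by blast
  fix h x assume h: "h \<in> K" and "x \<in> mixed_values G K N v"
  then obtain f i where f: "\<And>i. f i \<in> K" "i \<in> word_vars v" "f i \<in> N" "x = word_eval G f v"
    by (auto simp: mixed_values_def)
  have "inv h \<otimes> x \<otimes> h = word_eval G (\<lambda>i. inv h \<otimes> f i \<otimes> h) v"
    unfolding f(4) using subgroup.mem_carrier[OF d(1)] h f(1) by (intro word_eval_conj) auto
  moreover have "inv h \<otimes> f i \<otimes> h \<in> K" for i using s[OF h f(1)] .
  moreover have "inv h \<otimes> f i \<otimes> h \<in> N" using d(3)[OF h f(3)] .
  ultimately have "inv h \<otimes> x \<otimes> h \<in> mixed_values G K N v"
    unfolding mixed_values_def using f(2) by blast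
  then show "inv h \<otimes> x \<otimes> h \<in> generate G (mixed_values G K N v)" by (rule generate.incl)
qed

text \<open>Commutation with \<open>K\<close> does not leave \<open>N\<close>, so membership climbs
  from the distinguished variable through the brackets of \<open>v\<close>.\<close>

lemma mixed_values_in_normal:
  assumes N: "normalises G K N" and v: "multilinear_commutator_word s v"
  shows "mixed_values G K N v \<subseteq> N"
proof -
  have "i \<in> word_vars v \<Longrightarrow> f i \<in> N \<Longrightarrow> word_eval G f v \<in> N" if f: "\<And>i. f i \<in> K" for f i
    using v
  proof (induction arbitrary: i)
    case (1 j)
    then show ?case by simp
  next
    case (2 s x t y)
    have "word_eval G f x \<in> K" "word_eval G f y \<in> K"
      using word_eval_in_subgroup[OF normalisesD(1)[OF N] f] by auto
    then show ?case
      using 2 normalises_comm[OF N] unfolding word_eval_comm_word word_vars_comm_word by blast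
  qed
  then show ?thesis by (auto simp: mixed_values_def)
qed

text \<open>Multilinearity enters here: since the variables are disjoint, the two assignments can be
  glued into one.\<close>

lemma mixed_values_comm_left:
  assumes disj: "word_vars x \<inter> word_vars y = {}"
    and p: "p \<in> mixed_values G K N x" and q: "q \<in> values_in G K y"
  shows "group_comm G p q \<in> mixed_values G K N (comm_word x y)"
proof -
  obtain f i where f: "\<And>i. f i \<in> K" "i \<in> word_vars x" "f i \<in> N" "p = word_eval G f x"
    using p by (auto simp: mixed_values_def)
  obtain g where g: "\<And>i. g i \<in> K" "q = word_eval G g y" using q by (auto simp: values_in_def)
  define h where "h i = (if i \<in> word_vars x then f i else g i)" for i
  have "word_eval G h x = p" unfolding f(4) by (rule word_eval_cong) (simp add: h_def)
  moreover have "word_eval G h y = q"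
    unfolding g(2) by (rule word_eval_cong) (use disj in \<open>auto simp: h_def\<close>)
  ultimately have "group_comm G p q = word_eval G h (comm_word x y)"
    by (simp add: word_eval_comm_word)
  moreover have "h i \<in> K" for i using f(1) g(1) by (simp add: h_def)
  moreover have "i \<in> word_vars (comm_word x y)" "h i \<in> N"
    using f by (auto simp: word_vars_comm_word h_def)
  ultimately show ?thesis unfolding mixed_values_def by blast
qed

lemma mixed_values_comm_right:
  assumes disj: "word_vars x \<inter> word_vars y = {}"
    and p: "p \<in> values_in G K x" and q: "q \<in> mixed_values G K N y"
  shows "group_comm G p q \<in> mixed_values G K N (comm_word x y)"
proof -
  obtain f i where f: "\<And>i. f i \<in> K" "i \<in> word_vars y" "f i \<in> N" "q = word_eval G f y"
    using q by (auto simp: mixed_values_def)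
  obtain g where g: "\<And>i. g i \<in> K" "p = word_eval G g x" using p by (auto simp: values_in_def)
  define h where "h i = (if i \<in> word_vars y then f i else g i)" for i
  have "word_eval G h y = q" unfolding f(4) by (rule word_eval_cong) (simp add: h_def)
  moreover have "word_eval G h x = p"
    unfolding g(2) by (rule word_eval_cong) (use disj in \<open>auto simp: h_def\<close>)
  ultimately have "group_comm G p q = word_eval G h (comm_word x y)"
    by (simp add: word_eval_comm_word)
  moreover have "h i \<in> K" for i using f(1) g(1) by (simp add: h_def)
  moreover have "i \<in> word_vars (comm_word x y)" "h i \<in> N"
    using f by (auto simp: word_vars_comm_word h_def)
  ultimately show ?thesis unfolding mixed_values_def by blast
qed

lemma comm_generate_both:
  assumes V: "normalises G K V" and S: "S \<subseteq> K" and T: "T \<subseteq> K"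
    and c: "\<And>s t. s \<in> S \<Longrightarrow> t \<in> T \<Longrightarrow> group_comm G s t \<in> V"
    and x: "x \<in> generate G S" and y: "y \<in> generate G T"
  shows "group_comm G x y \<in> V"
proof (rule comm_generate_left[OF V _ S _ x])
  have KG: "K \<subseteq> carrier G" using subgroup.subset[OF normalisesD(1)[OF V]] .
  show "y \<in> carrier G" using generate_in_carrier[OF _ y] T KG by blast
  show "group_comm G s y \<in> V" if "s \<in> S" for s
    by (rule comm_generate_right[OF V _ T c[OF that] y]) (use that S KG in auto)
qed

text \<open>The Hall--Witt identity is used in the role of the three subgroups lemma.\<close>

lemma normal_comm_verbal:
  assumes N: "normalises G K N" "N \<subseteq> K" and v: "multilinear_commutator_word s v"
  shows "a \<in> N \<Longrightarrow> x \<in> verbal_in G K v \<Longrightarrow> group_comm G a x \<in> generate G (mixed_values G K N v)"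
  using v
proof (induction arbitrary: a x)
  case (1 i)
  have "N \<subseteq> mixed_values G K N (Var i)" using N(2) unfolding mixed_values_def by force
  moreover have "x \<in> K" using 1 verbal_in_subset[OF normalisesD(1)[OF N(1)]] by blast
  ultimately show ?case using normalises_comm(1)[OF N(1) 1(1)] by (blast intro: generate.incl)
next
  case (2 s \<alpha> t \<beta>)
  note sK = normalisesD(1)[OF N(1)]
  note KG = subgroup.subset[OF sK]
  let ?P = "\<lambda>v. generate G (mixed_values G K N v)"
  let ?V = "?P (comm_word \<alpha> \<beta>)"
  have nV: "normalises G K ?V" by (rule normalises_mixed_values[OF N(1)])
  note sV = normalisesD(2)[OF nV]
  have mK: "mixed_values G K N v \<subseteq> K" "values_in G K v \<subseteq> K" for v
    using mixed_values_subset[of K N v] values_in_subset[OF sK, of v] by auto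
  have PK: "?P v \<subseteq> K" for v using generate_subgroup_incl[OF mK(1) sK] .
  have vK: "verbal_in G K v \<subseteq> K" for v by (rule verbal_in_subset[OF sK])
  have M1: "group_comm G p y \<in> ?V" if "p \<in> ?P \<alpha>" "y \<in> verbal_in G K \<beta>" for p y
    using comm_generate_both[OF nV mK(1) mK(2) _ that[unfolded verbal_in_def]]
      mixed_values_comm_left[OF 2(3)] by (blast intro: generate.incl)
  have M2: "group_comm G x q \<in> ?V" if "x \<in> verbal_in G K \<alpha>" "q \<in> ?P \<beta>" for x q
    using comm_generate_both[OF nV mK(2) mK(1) _ that[unfolded verbal_in_def]]
      mixed_values_comm_right[OF 2(3)] by (blast intro: generate.incl)
  \<comment> \<open>Hall--Witt for \<open>x\<close>, \<open>inv y\<close>, \<open>a\<close>. The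
    inner commutators of the second and third factor have \<open>a\<close> against
    \<open>\<beta>\<close>- and \<open>\<alpha>\<close>-elements and are covered by the induction
    hypotheses; the first factor is a conjugate of \<open>[[x, y], a]\<close>.\<close>
  have comm: "group_comm G a (group_comm G x y) \<in> ?V"
    if x: "x \<in> values_in G K \<alpha>" and y: "y \<in> values_in G K \<beta>" for x y
  proof -
    have g: "a \<in> carrier G" "x \<in> carrier G" "y \<in> carrier G" "a \<in> K"
      using 2(6) x y mK(2) N(2) KG by blast+
    have vx: "x \<in> verbal_in G K \<alpha>" "inv x \<in> verbal_in G K \<alpha>" "inv y \<in> verbal_in G K \<beta>"
      using x y unfolding verbal_in_def by (auto intro: generate.incl generate.inv)
    have ia: "inv a \<in> N" using subgroup.m_inv_closed[OF normalisesD(2)[OF N(1)] 2(6)] .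
    let ?t1 = "inv (inv y) \<otimes> group_comm G (group_comm G x (inv (inv y))) a \<otimes> inv y"
    let ?t2 = "inv a \<otimes> group_comm G (group_comm G (inv y) (inv a)) x \<otimes> a"
    let ?t3 = "inv x \<otimes> group_comm G (group_comm G a (inv x)) (inv y) \<otimes> x"
    have "group_comm G (inv y) (inv a) \<in> ?P \<beta>"
      using comm_swap_mem[OF normalisesD(2)[OF normalises_mixed_values[OF N(1)]] _ _ 2(5)[OF ia vx(3)]]
        g by simp
    then have "group_comm G (group_comm G (inv y) (inv a)) x \<in> ?V"
      using comm_swap_mem[OF sV _ _ M2[OF vx(1)]] g by simp
    then have t2: "?t2 \<in> ?V" using normalisesD(3)[OF nV g(4)] by blast
    have "group_comm G (group_comm G a (inv x)) (inv y) \<in> ?V"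
      using M1[OF 2(4)[OF 2(6) vx(2)] vx(3)] .
    then have t3: "?t3 \<in> ?V" using normalisesD(3)[OF nV, of x] x mK(2) by blast
    have "?t1 \<otimes> (?t2 \<otimes> ?t3) = \<one>"
      using hall_witt[OF g(2) inv_closed[OF g(3)] g(1)] g by (simp add: m_assoc)
    then have "?t1 = inv (?t2 \<otimes> ?t3)" using g by (intro inv_equality[symmetric]) auto
    then have t1: "?t1 \<in> ?V" using t2 t3 subgroup.m_closed[OF sV] subgroup.m_inv_closed[OF sV] by auto
    have "y \<in> K" using y mK(2) by blast
    then have "inv y \<otimes> ?t1 \<otimes> y \<in> ?V" using normalisesD(3)[OF nV _ t1] by blast
    moreover have "inv y \<otimes> ?t1 \<otimes> y = group_comm G (group_comm G x y) a"
      using g by (simp add: m_assoc)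
    ultimately show ?thesis using comm_swap_mem[OF sV _ g(1)] g by simp
  qed
  show ?case
  proof (rule comm_generate_right[OF nV _ mK(2) _ 2(7)[unfolded verbal_in_def]])
    show "a \<in> carrier G" using 2(6) N(2) KG by blast
    show "group_comm G a s \<in> ?V" if "s \<in> values_in G K (comm_word \<alpha> \<beta>)" for s
      using that comm unfolding values_in_def word_eval_comm_word by blast
  qed
qed

text \<open>Values with an entry in \<open>N\<close> are elements of \<open>N\<close> of finite
  order, hence trivial, and they generate a subgroup containing the commutators of \<open>N\<close>
  with \<open>v(K)\<close>.\<close>

lemma torsion_free_comm_verbal:
  assumes N: "normalises G K N" "N \<subseteq> K" and v: "multilinear_commutator_word s v"
    and t: "\<And>x. x \<in> values_in G K v \<Longrightarrow> torsion G x"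
    and tf: "\<And>x. x \<in> N \<Longrightarrow> torsion G x \<Longrightarrow> x = \<one>"
    and ax: "a \<in> N" "x \<in> verbal_in G K v"
  shows "group_comm G a x = \<one>"
proof -
  have "mixed_values G K N v \<subseteq> {\<one>}"
    using mixed_values_in_normal[OF N(1) v] mixed_values_subset[of K N v] t tf by blast
  then have "generate G (mixed_values G K N v) \<subseteq> {\<one>}"
    using generate_subgroup_incl triv_subgroup by blast
  then show ?thesis using normal_comm_verbal[OF N v ax] by blast
qed

text \<open>The quotient of \<open>K\<close> by \<open>v(K)\<close> is soluble: a derived term
  inside both \<open>\<alpha>(K)\<close> and \<open>\<beta>(K)\<close> has its own derived group
  inside \<open>[\<alpha>, \<beta>](K)\<close>.\<close>

lemma exp_of_derived_subset_verbal:
  assumes K: "subgroup K G" and v: "multilinear_commutator_word s v"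
  shows "\<exists>k. (derived G ^^ k) K \<subseteq> verbal_in G K v"
  using v
proof induction
  case (1 i)
  have "K \<subseteq> values_in G K (Var i)" by (force simp: values_in_def)
  then have "(derived G ^^ 0) K \<subseteq> verbal_in G K (Var i)"
    unfolding verbal_in_def by (auto intro: generate.incl)
  then show ?case by blast
next
  case (2 s \<alpha> t \<beta>)
  then obtain i j where ij: "(derived G ^^ i) K \<subseteq> verbal_in G K \<alpha>"
    "(derived G ^^ j) K \<subseteq> verbal_in G K \<beta>" by blast
  let ?D = "\<lambda>k. (derived G ^^ k) K"
  have sD: "subgroup (?D k) G" for k by (rule exp_of_derived_is_subgroup[OF K])
  have "?D (Suc k) \<subseteq> ?D k" for k using derived_incl[OF _ sD[of k]] by auto
  then have "?D (max i j) \<subseteq> ?D i" "?D (max i j) \<subseteq> ?D j"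
    using lift_Suc_antimono_le[of ?D] by auto
  then have m: "?D (max i j) \<subseteq> verbal_in G K \<alpha>" "?D (max i j) \<subseteq> verbal_in G K \<beta>" using ij by auto
  let ?V = "verbal_in G K (comm_word \<alpha> \<beta>)"
  have nV: "normalises G K ?V" by (rule normalises_verbal_in[OF normalises_self[OF K]])
  have gen: "group_comm G x y \<in> ?V" if x: "x \<in> values_in G K \<alpha>" and y: "y \<in> values_in G K \<beta>" for x y
  proof -
    obtain f where f: "\<And>i. f i \<in> K" "x = word_eval G f \<alpha>" using x by (auto simp: values_in_def)
    obtain g where g: "\<And>i. g i \<in> K" "y = word_eval G g \<beta>" using y by (auto simp: values_in_def)
    define h where "h i = (if i \<in> word_vars \<alpha> then f i else g i)" for i
    have "word_eval G h \<alpha> = x" unfolding f(2) by (rule word_eval_cong) (simp add: h_def)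
    moreover have "word_eval G h \<beta> = y"
      unfolding g(2) by (rule word_eval_cong) (use 2(3) in \<open>auto simp: h_def\<close>)
    ultimately have "group_comm G x y = word_eval G h (comm_word \<alpha> \<beta>)"
      by (simp add: word_eval_comm_word)
    moreover have "h i \<in> K" for i using f(1) g(1) by (simp add: h_def)
    ultimately have "group_comm G x y \<in> values_in G K (comm_word \<alpha> \<beta>)"
      unfolding values_in_def by blast
    then show ?thesis unfolding verbal_in_def by (rule generate.incl)
  qed
  have "group_comm G x y \<in> ?V" if "x \<in> verbal_in G K \<alpha>" "y \<in> verbal_in G K \<beta>" for x y
    using comm_generate_both[OF nV values_in_subset[OF K] values_in_subset[OF K] gen
        that[unfolded verbal_in_def]] .
  then have "derived G (?D (max i j)) \<subseteq> ?V"
    using m by (intro derived_subset_iff[OF sD normalisesD(2)[OF nV]]) blast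
  then have "?D (Suc (max i j)) \<subseteq> ?V" by simp
  then show ?case by blast
qed

lemma normalises_centraliser:
  assumes H: "normalises G M H" and S: "normalises G M S"
  shows "normalises G M {c \<in> H. \<forall>x\<in>S. group_comm G c x = \<one>}" (is "normalises G M ?C")
proof -
  note dH = normalisesD[OF H] and dS = normalisesD[OF S]
  have g: "x \<in> H \<Longrightarrow> x \<in> carrier G" "x \<in> S \<Longrightarrow> x \<in> carrier G" for x
    by (rule subgroup.mem_carrier[OF dH(2)], simp) (rule subgroup.mem_carrier[OF dS(2)], simp)
  have "subgroup ?C G"
  proof (rule subgroupI)
    show "?C \<subseteq> carrier G" using g by auto
    show "?C \<noteq> {}" using subgroup.one_closed[OF dH(2)] g by auto
    show "inv x \<in> ?C" if "x \<in> ?C" for x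
      using that g subgroup.m_inv_closed[OF dH(2)] by (auto simp: group_comm_inv_left)
    show "x \<otimes> y \<in> ?C" if "x \<in> ?C" "y \<in> ?C" for x y
      using that g subgroup.m_closed[OF dH(2)] by (auto simp: group_comm_mult_left)
  qed
  moreover have "inv m \<otimes> c \<otimes> m \<in> ?C" if m: "m \<in> M" and c: "c \<in> ?C" for m c
  proof -
    have "group_comm G (inv m \<otimes> c \<otimes> m) x = \<one>" if x: "x \<in> S" for x
    proof -
      have "group_comm G c (m \<otimes> x \<otimes> inv m) = \<one>" using c dS(4)[OF m x] by blast
      then have "inv m \<otimes> group_comm G c (m \<otimes> x \<otimes> inv m) \<otimes> m = \<one>"
        using subgroup.mem_carrier[OF dH(1) m] by simp
      then show ?thesis
        using subgroup.mem_carrier[OF dH(1) m] g c x by (simp add: free_group_simps)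
    qed
    then show ?thesis using dH(3)[OF m] c by blast
  qed
  ultimately show ?thesis using dH(1) by (auto simp: normalises_def)
qed

lemma group_comm_eq_one_iff:
  assumes "x \<in> carrier G" "y \<in> carrier G"
  shows "group_comm G x y = \<one> \<longleftrightarrow> x \<otimes> y = y \<otimes> x"
proof -
  have 1: "group_comm G x y = inv (y \<otimes> x) \<otimes> (x \<otimes> y)" using assms by (simp add: free_group_simps)
  have 2: "x \<otimes> y = (y \<otimes> x) \<otimes> group_comm G x y" using assms by (simp add: free_group_simps)
  show ?thesis
  proof
    assume "group_comm G x y = \<one>"
    then show "x \<otimes> y = y \<otimes> x" using 2 assms by (simp only: r_one m_closed)
  next
    assume "x \<otimes> y = y \<otimes> x"
    then show "group_comm G x y = \<one>" using 1 assms by (simp only: l_inv m_closed)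
  qed
qed

end

section \<open>Torsion values\<close>

lemma (in group) exp_of_derived_subset:
  "subgroup K G \<Longrightarrow> (derived G ^^ k) K \<subseteq> K"
  using derived_incl by (induction k) auto

lemma (in group) finite_subset_values_in:
  assumes F: "finite F" "F \<subseteq> values_in G K v" and K: "subgroup K G"
  shows "\<exists>S. finite S \<and> S \<subseteq> K \<and> F \<subseteq> values_in G (generate G S) v"
  using F
proof (induction F rule: finite_induct)
  case empty
  then show ?case by blast
next
  case (insert x F)
  then obtain S where S: "finite S" "S \<subseteq> K" "F \<subseteq> values_in G (generate G S) v" by blast
  obtain f where f: "\<And>i. f i \<in> K" "x = word_eval G f v" using insert by (auto simp: values_in_def)
  \<comment> \<open>Variables outside \<open>v\<close> receive \<open>\<one>\<close>; only finitely
    many entries are then needed to generate the subgroup containing the assignment.\<close>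
  define g where "g i = (if i \<in> word_vars v then f i else \<one>)" for i
  let ?S = "S \<union> f ` word_vars v"
  have "x = word_eval G g v" unfolding f(2) by (rule word_eval_cong) (simp add: g_def)
  moreover have "g i \<in> generate G ?S" for i
    by (auto simp: g_def intro: generate.incl generate.one)
  ultimately have "x \<in> values_in G (generate G ?S) v" unfolding values_in_def by blast
  moreover have "values_in G (generate G S) v \<subseteq> values_in G (generate G ?S) v"
    using mono_generate[of S ?S] unfolding values_in_def by blast
  ultimately show ?case
    using S f(1) finite_word_vars[of v] by (intro exI[of _ ?S]) auto
qed

text \<open>The situation after the locally finite radical of \<open>v(G)\<close> has been factored
  out. The last condition concerns all subgroups normal in \<open>v(G)\<close>, not only those
  normal in \<open>G\<close>.\<close>

locale torsion_values = group G for G (structure) +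
  fixes v :: group_word and s :: nat
  assumes multilinear: "multilinear_commutator_word s v"
    and torsion_values: "\<And>x. x \<in> values_in G (carrier G) v \<Longrightarrow> torsion G x"
    and no_loc_finite: "\<And>R. normalises G (verbal_in G (carrier G) v) R \<Longrightarrow>
      R \<subseteq> verbal_in G (carrier G) v \<Longrightarrow> loc_finite G R \<Longrightarrow> R = {\<one>}"
begin

abbreviation "H \<equiv> verbal_in G (carrier G) v"

definition "Z = {z \<in> H. \<forall>h\<in>H. group_comm G z h = \<one>}"

lemma normalises_H: "normalises G (carrier G) H"
  by (rule normalises_verbal_in[OF normalises_self[OF subgroup_self]])

lemma subgroup_H: "subgroup H G" by (rule normalisesD(2)[OF normalises_H])

lemma H_carrier: "H \<subseteq> carrier G" by (rule subgroup.subset[OF subgroup_H])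

lemma normalises_H_of_carrier: "normalises G (carrier G) T \<Longrightarrow> normalises G H T"
  using normalises_subgroup[OF _ subgroup_H H_carrier] .

lemma normalises_Z: "normalises G (carrier G) Z"
  unfolding Z_def by (rule normalises_centraliser[OF normalises_H normalises_H])

text \<open>The elements of finite order in \<open>T\<close> form a set invariant under
  \<open>H\<close>. If they generate a locally finite group, that group is trivial because the
  radical is.\<close>

lemma torsion_freeI:
  assumes T: "normalises G H T" "T \<subseteq> H"
    and lf: "loc_finite G (generate G {t \<in> T. torsion G t})" and x: "x \<in> T" "torsion G x"
  shows "x = \<one>"
proof -
  let ?Y = "{t \<in> T. torsion G t}"
  have TG: "T \<subseteq> carrier G" using T(2) H_carrier by blast
  have "normalises G H (generate G ?Y)"
  proof (rule normalises_generate_right[OF subgroup_H])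
    show "?Y \<subseteq> carrier G" using TG by blast
    show "inv h \<otimes> y \<otimes> h \<in> generate G ?Y" if "h \<in> H" "y \<in> ?Y" for h y
      using that normalisesD(3)[OF T(1)] torsion_conj[of y h] TG H_carrier
      by (intro generate.incl) auto
  qed
  moreover have "generate G ?Y \<subseteq> H" using T(2) by (intro generate_subgroup_incl subgroup_H) auto
  ultimately have "generate G ?Y = {\<one>}" using no_loc_finite lf by blast
  then show ?thesis using x by (metis (mono_tags, lifting) generate.incl mem_Collect_eq singletonD)
qed

lemma torsion_free_if_torsion_central:
  assumes T: "normalises G H T" "T \<subseteq> H"
    and c: "\<And>x y. x \<in> T \<Longrightarrow> torsion G x \<Longrightarrow> y \<in> T \<Longrightarrow> torsion G y \<Longrightarrow> group_comm G x y = \<one>"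
    and x: "x \<in> T" "torsion G x"
  shows "x = \<one>"
proof (rule torsion_freeI[OF T _ x])
  let ?Y = "{t \<in> T. torsion G t}"
  have YG: "?Y \<subseteq> carrier G" using T(2) H_carrier by blast
  show "loc_finite G (generate G ?Y)"
  proof (rule loc_finite_abelian_generated_by_torsion[OF YG])
    show "torsion G y" if "y \<in> ?Y" for y using that by simp
    fix x y assume xy: "x \<in> generate G ?Y" "y \<in> generate G ?Y"
    have "group_comm G x y \<in> {\<one>}"
      by (rule comm_generate_both[OF normalises_one[OF subgroup_self] YG YG _ xy]) (use c in auto)
    then show "x \<otimes> y = y \<otimes> x"
      using group_comm_eq_one_iff generate_in_carrier[OF YG] xy by auto
  qed
qed

lemma Z_torsion_free:
  assumes "x \<in> Z" "torsion G x"
  shows "x = \<one>"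
  by (rule torsion_free_if_torsion_central[OF normalises_H_of_carrier[OF normalises_Z] _ _ assms])
    (auto simp: Z_def)

text \<open>Modulo the centre \<open>T\<close> is abelian, so \<open>[t, u]^k = [t^k, u]\<close>.
  For \<open>t\<close> of finite order \<open>[t, u]\<close> is a central element of finite order,
  hence trivial; the elements of finite order thus commute.\<close>

lemma torsion_free_class2:
  assumes T: "normalises G H T" "T \<subseteq> H"
    and c: "\<And>x y. x \<in> T \<Longrightarrow> y \<in> T \<Longrightarrow> group_comm G x y \<in> Z" and x: "x \<in> T" "torsion G x"
  shows "x = \<one>"
proof (rule torsion_free_if_torsion_central[OF T _ x])
  fix t u assume t: "t \<in> T" "torsion G t" and u: "u \<in> T"
  have g: "t \<in> carrier G" "u \<in> carrier G" "t \<in> H" using t u T(2) H_carrier by auto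
  obtain k where k: "k > 0" "t [^] (k::nat) = \<one>" using t by (auto simp: torsion_def)
  let ?c = "group_comm G t u"
  have "group_comm G (t [^] j) u = ?c [^] j" for j :: nat
  proof (induction j)
    case (Suc j)
    have "?c [^] j \<in> Z"
      using c[OF t(1) u] normalisesD(2)[OF normalises_Z]
      by (induction j) (auto simp: subgroup.one_closed subgroup.m_closed)
    then have "(?c [^] j) \<otimes> t = t \<otimes> (?c [^] j)"
      using g group_comm_eq_one_iff[of "?c [^] j" t] unfolding Z_def by auto
    then have "inv t \<otimes> ?c [^] j \<otimes> t = ?c [^] j" using g by (simp add: m_assoc)
    then show ?case using g Suc by (simp add: group_comm_mult_left)
  qed (use g in simp)
  then have "?c [^] k = \<one>" using k(2) g by (metis group_comm_one)
  then show "?c = \<one>" using Z_torsion_free[OF c[OF t(1) u]] k(1) by (auto simp: torsion_def)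
qed

text \<open>The last derived term not in \<open>Z\<close> would have its derived group in
  \<open>Z\<close>, so it would be torsion-free and by \<open>tf\<close> in \<open>Z\<close> after
  all. The normaliser \<open>R\<close> is a parameter because the argument is run for
  \<open>G\<close> first, and for \<open>H\<close> once the torsion-free case in \<open>H\<close> is
  known.\<close>

lemma soluble_subset_Z:
  assumes K: "normalises G R K" "K \<subseteq> H" and HR: "H \<subseteq> R"
    and d: "(derived G ^^ d) K \<subseteq> {\<one>}"
    and tf: "\<And>T. normalises G R T \<Longrightarrow> T \<subseteq> H \<Longrightarrow> (\<And>x. x \<in> T \<Longrightarrow> torsion G x \<Longrightarrow> x = \<one>) \<Longrightarrow> T \<subseteq> Z"
  shows "K \<subseteq> Z"
proof -
  let ?D = "\<lambda>k. (derived G ^^ k) K"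
  have nD: "normalises G R (?D k)" for k by (rule exp_of_derived_normalised[OF K(1)])
  have sD: "subgroup (?D k) G" for k using normalisesD(2)[OF nD] .
  have DK: "?D k \<subseteq> K" for k by (rule exp_of_derived_subset[OF normalisesD(2)[OF K(1)]])
  have "\<one> \<in> Z" using subgroup.one_closed[OF normalisesD(2)[OF normalises_Z]] .
  then have "?D d \<subseteq> Z" using d by blast
  then have ex: "\<exists>k. ?D k \<subseteq> Z" by blast
  define k where "k = (LEAST k. ?D k \<subseteq> Z)"
  have k: "?D k \<subseteq> Z" "\<And>i. i < k \<Longrightarrow> \<not> ?D i \<subseteq> Z"
    unfolding k_def by (rule LeastI_ex[OF ex], use not_less_Least in blast)
  show ?thesis
  proof (cases k)
    case 0
    then show ?thesis using k(1) by simp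
  next
    case (Suc i)
    have "?D i \<subseteq> Z"
    proof (rule tf[OF nD])
      show DH: "?D i \<subseteq> H" using DK K(2) by blast
      show "x = \<one>" if "x \<in> ?D i" "torsion G x" for x
      proof (rule torsion_free_class2[OF _ DH _ that])
        show "normalises G H (?D i)" by (rule normalises_subgroup[OF nD subgroup_H HR])
        show "group_comm G x y \<in> Z" if "x \<in> ?D i" "y \<in> ?D i" for x y
          using group_comm_in_derived[OF sD that] k(1) Suc by auto
      qed
    qed
    then show ?thesis using k(2)[of i] Suc by blast
  qed
qed

text \<open>For subgroups normal in \<open>G\<close> the torsion-free case is immediate: they
  commute with \<open>v(G)\<close>, which is \<open>H\<close> itself.\<close>

lemma characteristic_soluble_subset_Z:
  assumes "normalises G (carrier G) K" "K \<subseteq> H" "(derived G ^^ d) K \<subseteq> {\<one>}"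
  shows "K \<subseteq> Z"
proof (rule soluble_subset_Z[OF assms(1,2) H_carrier assms(3)])
  fix T assume T: "normalises G (carrier G) T" "T \<subseteq> H" "\<And>x. x \<in> T \<Longrightarrow> torsion G x \<Longrightarrow> x = \<one>"
  have TG: "T \<subseteq> carrier G" using T(2) H_carrier by blast
  show "T \<subseteq> Z"
    using torsion_free_comm_verbal[OF T(1) TG multilinear torsion_values T(3)] T(2)
    unfolding Z_def by blast
qed

text \<open>A torsion-free normal subgroup \<open>T\<close> of \<open>H\<close> centralises \<open>v(H)\<close>. The centraliser of \<open>v(H)\<close>
  in \<open>H\<close> is normal in \<open>G\<close>, and soluble because \<open>H/v(H)\<close> is.\<close>

lemma torsion_free_subset_Z:
  assumes T: "normalises G H T" "T \<subseteq> H" and tf: "\<And>x. x \<in> T \<Longrightarrow> torsion G x \<Longrightarrow> x = \<one>"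
  shows "T \<subseteq> Z"
proof -
  let ?V = "verbal_in G H v"
  define C where "C = {c \<in> H. \<forall>x\<in>?V. group_comm G c x = \<one>}"
  have nC: "normalises G (carrier G) C"
    unfolding C_def by (rule normalises_centraliser[OF normalises_H normalises_verbal_in[OF normalises_H]])
  have CH: "C \<subseteq> H" by (auto simp: C_def)
  have "torsion G x" if "x \<in> values_in G H v" for x
    using that torsion_values H_carrier unfolding values_in_def by blast
  then have TC: "T \<subseteq> C"
    using torsion_free_comm_verbal[OF T multilinear _ tf] T(2) unfolding C_def by blast
  obtain k where k: "(derived G ^^ k) H \<subseteq> ?V"
    using exp_of_derived_subset_verbal[OF subgroup_H multilinear] by blast
  \<comment> \<open>A derived term of \<open>C\<close> lies both in \<open>v(H)\<close> and in the
    centraliser of \<open>v(H)\<close>, hence is abelian.\<close>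
  have D: "(derived G ^^ k) C \<subseteq> ?V" "(derived G ^^ k) C \<subseteq> C"
    using mono_exp_of_derived[OF CH, of k] k exp_of_derived_subset[OF normalisesD(2)[OF nC]]
    by auto
  have "derived G ((derived G ^^ k) C) \<subseteq> {\<one>}"
    using D by (intro derived_subset_iff[OF exp_of_derived_is_subgroup[OF normalisesD(2)[OF nC]]]
        triv_subgroup) (auto simp: C_def)
  then have "(derived G ^^ Suc k) C \<subseteq> {\<one>}" by simp
  then show ?thesis using characteristic_soluble_subset_Z[OF nC CH] TC by blast
qed

lemma normal_soluble_subset_Z:
  assumes "normalises G H K" "K \<subseteq> H" "(derived G ^^ d) K \<subseteq> {\<one>}"
  shows "K \<subseteq> Z"
  using soluble_subset_Z[OF assms(1,2) order_refl assms(3)] torsion_free_subset_Z by blast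

lemma verbal_trivial_if_central:
  assumes "H \<subseteq> Z"
  shows "H = {\<one>}"
proof (rule no_loc_finite[OF normalises_self[OF subgroup_H] order_refl])
  have "x \<otimes> y = y \<otimes> x" if "x \<in> H" "y \<in> H" for x y
    using that assms group_comm_eq_one_iff[of x y] H_carrier by (auto simp: Z_def)
  then show "loc_finite G H"
    using torsion_values values_in_subset[OF subgroup_self] unfolding verbal_in_def
    by (intro loc_finite_abelian_generated_by_torsion) auto
qed

lemma verbal_trivial_if_soluble:
  assumes "(derived G ^^ d) (carrier G) \<subseteq> {\<one>}"
  shows "H = {\<one>}"
proof (rule verbal_trivial_if_central)
  have "(derived G ^^ d) H \<subseteq> {\<one>}" using assms mono_exp_of_derived[OF H_carrier] by blast
  then show "H \<subseteq> Z" by (rule characteristic_soluble_subset_Z[OF normalises_H order_refl])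
qed

text \<open>The elements of finite order in \<open>T\<close> generate a group that is locally finite
  modulo a central subgroup, hence locally finite and so trivial. Thus \<open>T\<close> is
  torsion-free.\<close>

lemma loc_finite_over_subset_Z:
  assumes T: "normalises G H T" "T \<subseteq> H" and A: "subgroup A G" "A \<subseteq> Z" "loc_finite_over G A T"
  shows "T \<subseteq> Z"
proof (rule torsion_free_subset_Z[OF T])
  fix x assume x: "x \<in> T" "torsion G x"
  let ?Y = "{t \<in> T. torsion G t}"
  have YT: "generate G ?Y \<subseteq> T" by (rule generate_subgroup_incl[OF _ normalisesD(2)[OF T(1)]]) auto
  have YG: "?Y \<subseteq> carrier G" using T(2) H_carrier by blast
  have "loc_finite G (generate G ?Y)"
  proof (rule loc_finite_central_by_loc_finite[OF YG _ A(1)])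
    show "torsion G y" if "y \<in> ?Y" for y using that by simp
    show "loc_finite_over G A (generate G ?Y)"
      using A(3) YT unfolding loc_finite_over_def by blast
    show "z \<otimes> q = q \<otimes> z" if "z \<in> A" "q \<in> generate G ?Y" for z q
      using that A(2) YT T(2) H_carrier group_comm_eq_one_iff[of z q] unfolding Z_def by blast
  qed
  then show "x = \<one>" by (rule torsion_freeI[OF T _ x])
qed

end

section \<open>Reduction modulo the locally finite radical\<close>

context group
begin

lemma loc_finite_over_of_finite_img:
  assumes N: "N \<lhd> G" and S: "S \<subseteq> carrier G" and f: "finite ((\<lambda>x. N #> x) ` S)"
  shows "finite_over G N S"
proof -
  interpret N: normal N G by (rule N)
  obtain F where F: "F \<subseteq> S" "finite F" "(\<lambda>x. N #> x) ` S = (\<lambda>x. N #> x) ` F"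
    using finite_subset_image[OF f order_refl] by blast
  have "\<exists>f\<in>F. x \<otimes> inv f \<in> N" if x: "x \<in> S" for x
  proof -
    have "N #> x \<in> (\<lambda>x. N #> x) ` F" using F(3) x by blast
    then obtain f where f: "f \<in> F" "N #> x = N #> f" by blast
    have g: "x \<in> carrier G" "f \<in> carrier G" using x f F(1) S by auto
    have "x \<in> N #> f" using rcos_self[OF g(1) N.subgroup_axioms] f(2) by simp
    then obtain n where n: "n \<in> N" "x = n \<otimes> f" by (auto simp: r_coset_def)
    then have "x \<otimes> inv f = n" using g N.mem_carrier by (simp add: m_assoc)
    then show ?thesis using f(1) n(1) by blast
  qed
  moreover have "F \<subseteq> carrier G" using F(1) S by blast
  ultimately show ?thesis using F(2) unfolding finite_over_def by blast
qed

lemma loc_finite_normalised_conj: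
  assumes t: "t \<in> carrier G" and R: "loc_finite G R"
  shows "loc_finite G ((\<lambda>x. inv t \<otimes> x \<otimes> t) ` R)"
proof -
  interpret c: group_hom G G "\<lambda>x. inv t \<otimes> x \<otimes> t" by (rule conj_group_hom[OF t])
  have sR: "subgroup R G" using R by (simp add: loc_finite_def)
  show ?thesis
    unfolding loc_finite_def
  proof (intro conjI allI impI)
    show "subgroup ((\<lambda>x. inv t \<otimes> x \<otimes> t) ` R) G" by (rule c.subgroup_img_is_subgroup[OF sR])
    fix S assume S: "finite S" "S \<subseteq> (\<lambda>x. inv t \<otimes> x \<otimes> t) ` R"
    obtain T where T: "T \<subseteq> R" "finite T" "S = (\<lambda>x. inv t \<otimes> x \<otimes> t) ` T"
      using finite_subset_image[OF S] by blast
    have "finite (generate G T)" using R T by (simp add: loc_finite_def)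
    then show "finite (generate G S)"
      using c.generate_img[of T] T subgroup.subset[OF sR] by auto
  qed
qed

text \<open>With \<open>N\<close> the locally finite radical of \<open>v(G)\<close>, the quotient by
  \<open>N\<close> satisfies \<open>torsion_values\<close>; if \<open>v\<close> vanishes there, then
  \<open>v(G)\<close> equals \<open>N\<close>.\<close>

lemma loc_finite_verbal_reduction:
  assumes v: "multilinear_commutator_word s v"
    and t: "\<And>x. x \<in> values_in G (carrier G) v \<Longrightarrow> torsion G x"
    and red: "\<And>N. N \<lhd> G \<Longrightarrow> torsion_values (G Mod N) v s \<Longrightarrow>
      verbal_in (G Mod N) (carrier (G Mod N)) v = {\<one>\<^bsub>G Mod N\<^esub>}"
  shows "loc_finite G (verbal_in G (carrier G) v)"
proof -
  define H where "H = verbal_in G (carrier G) v"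
  have nH: "normalises G (carrier G) H"
    unfolding H_def by (rule normalises_verbal_in[OF normalises_self[OF subgroup_self]])
  have sH: "subgroup H G" by (rule normalisesD(2)[OF nH])
  note HG = subgroup.subset[OF sH]
  define \<P> where "\<P> = {R. normalises G H R \<and> R \<subseteq> H \<and> loc_finite G R}"
  define N where "N = generate G (\<Union>\<P>)"
  have lfN: "loc_finite G N"
    unfolding N_def by (rule loc_finite_Union[OF sH]) (auto simp: \<P>_def)
  have UH: "\<Union>\<P> \<subseteq> H" by (auto simp: \<P>_def)
  have NH: "N \<subseteq> H" unfolding N_def by (rule generate_subgroup_incl[OF UH sH])
  have max: "R \<subseteq> N" if "R \<in> \<P>" for R using that unfolding N_def by (auto intro: generate.incl)
  have "normalises G (carrier G) N"
    unfolding N_def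
  proof (rule normalises_generate_right[OF subgroup_self])
    show "\<Union>\<P> \<subseteq> carrier G" using UH HG by blast
    fix g x assume g: "g \<in> carrier G" and "x \<in> \<Union>\<P>"
    then obtain R where R: "R \<in> \<P>" "x \<in> R" by blast
    interpret c: group_hom G G "\<lambda>x. inv g \<otimes> x \<otimes> g" by (rule conj_group_hom[OF g])
    let ?c = "\<lambda>x. inv g \<otimes> x \<otimes> g"
    \<comment> \<open>Conjugation by \<open>g\<close> carries subgroups normal in \<open>H\<close>
      to such subgroups, so the radical is normal in \<open>G\<close> although its constituents need
      not be.\<close>
    have "?c ` H = H"
    proof
      show "?c ` H \<subseteq> H" using normalisesD(3)[OF nH g] by blast
      show "H \<subseteq> ?c ` H"
      proof
        fix x assume x: "x \<in> H"
        then have "x = ?c (g \<otimes> x \<otimes> inv g)" using g HG by (simp add: free_group_simps subset_iff)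
        then show "x \<in> ?c ` H" using normalisesD(4)[OF nH g x] by blast
      qed
    qed
    then have "?c ` R \<in> \<P>"
      using c.normalises_img[of H R] R(1) loc_finite_normalised_conj[OF g] by (auto simp: \<P>_def)
    then show "?c x \<in> generate G (\<Union>\<P>)" using R(2) by (blast intro: generate.incl)
  qed
  then have N: "N \<lhd> G" by (rule normal_of_normalises)
  interpret N: normal N G by (rule N)
  let ?Q = "G Mod N" and ?h = "\<lambda>x. N #> x"
  interpret h: group_hom G ?Q ?h by (rule N.quotient_group_hom)
  have hQ: "?h ` carrier G = carrier ?Q" by (simp add: carrier_FactGroup)
  have hH: "verbal_in ?Q (carrier ?Q) v = ?h ` H"
    using h.verbal_in_img[OF order_refl] hQ by (simp add: H_def)
  have "torsion_values ?Q v s"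
  proof (intro torsion_values.intro torsion_values_axioms.intro h.H.is_group v)
    show "torsion ?Q y" if "y \<in> values_in ?Q (carrier ?Q) v" for y
    proof -
      have "y \<in> ?h ` values_in G (carrier G) v"
        using that h.values_in_img[OF order_refl] hQ by simp
      then show ?thesis using h.hom_torsion t values_in_subset[OF subgroup_self] by blast
    qed
    fix R assume R: "normalises ?Q (verbal_in ?Q (carrier ?Q) v) R"
      "R \<subseteq> verbal_in ?Q (carrier ?Q) v" "loc_finite ?Q R"
    note dR = h.H.normalisesD[OF R(1), unfolded hH]
    \<comment> \<open>The preimage of \<open>R\<close> in \<open>H\<close> is an extension of
      \<open>N\<close> by a locally finite group, hence locally finite and contained in the
      radical.\<close>
    define R' where "R' = {x \<in> H. ?h x \<in> R}"
    have hg: "?h (x \<otimes> y) = ?h x \<otimes>\<^bsub>?Q\<^esub> ?h y" "?h (inv x) = inv\<^bsub>?Q\<^esub> (?h x)"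
      if "x \<in> H" "y \<in> H" for x y
      using that HG h.hom_mult[of x y] h.hom_inv[of x] by blast+
    have sR': "subgroup R' G"
    proof (rule subgroupI)
      show "R' \<subseteq> carrier G" using HG by (auto simp: R'_def)
      have "?h \<one> \<in> R" using subgroup.one_closed[OF dR(2)] h.hom_one by simp
      then show "R' \<noteq> {}" using subgroup.one_closed[OF sH] unfolding R'_def by blast
      show "inv x \<in> R'" if "x \<in> R'" for x
        using that hg(2)[of x x] subgroup.m_inv_closed[OF dR(2)] subgroup.m_inv_closed[OF sH]
        unfolding R'_def by simp
      show "x \<otimes> y \<in> R'" if "x \<in> R'" "y \<in> R'" for x y
        using that hg(1)[of x y] subgroup.m_closed[OF dR(2)] subgroup.m_closed[OF sH]
        unfolding R'_def by simp
    qed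
    have "inv k \<otimes> x \<otimes> k \<in> R'" if k: "k \<in> H" and x: "x \<in> R'" for k x
    proof -
      have xH: "x \<in> H" "?h x \<in> R" using x by (auto simp: R'_def)
      have "inv\<^bsub>?Q\<^esub> (?h k) \<otimes>\<^bsub>?Q\<^esub> ?h x \<otimes>\<^bsub>?Q\<^esub> ?h k \<in> R" using dR(3)[OF _ xH(2)] k by blast
      moreover have "inv k \<in> H" using subgroup.m_inv_closed[OF sH k] .
      ultimately show ?thesis
        using hg k xH subgroup.m_closed[OF sH] unfolding R'_def by simp
    qed
    then have "normalises G H R'" using sH sR' by (auto simp: normalises_def)
    moreover have "loc_finite G R'"
    proof (rule loc_finite_extension[OF lfN sR'])
      show "loc_finite_over G N R'"
        unfolding loc_finite_over_def
      proof (intro allI impI)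
        fix S assume S: "finite S" "S \<subseteq> R'"
        have SG: "S \<subseteq> carrier G" using S(2) HG by (auto simp: R'_def)
        have "finite (generate ?Q (?h ` S))"
          using R(3) S unfolding loc_finite_def R'_def by blast
        then have "finite (?h ` generate G S)" using h.generate_img[OF SG] by simp
        then show "finite_over G N (generate G S)"
          by (rule loc_finite_over_of_finite_img[OF N generate_incl[OF SG]])
      qed
    qed
    ultimately have "R' \<subseteq> N" using max by (auto simp: \<P>_def R'_def)
    have "r = \<one>\<^bsub>?Q\<^esub>" if r: "r \<in> R" for r
    proof -
      obtain x where x: "x \<in> H" "r = ?h x" using r R(2) hH by auto
      then have "x \<in> kernel G ?Q ?h"
        using r \<open>R' \<subseteq> N\<close> N.quotient_kernel unfolding R'_def by blast
      then show ?thesis using x(2) by (simp add: kernel_def)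
    qed
    then show "R = {\<one>\<^bsub>?Q\<^esub>}" using subgroup.one_closed[OF dR(2)] by blast
  qed
  then have "?h ` H = {\<one>\<^bsub>?Q\<^esub>}" using red[OF N] hH by simp
  then have "H \<subseteq> kernel G ?Q ?h" using HG unfolding kernel_def by blast
  then have "H = N" using NH N.quotient_kernel by blast
  then show ?thesis using lfN by (simp add: H_def)
qed

lemma loc_finite_verbal_soluble:
  assumes v: "multilinear_commutator_word s v"
    and t: "\<And>x. x \<in> values_in G (carrier G) v \<Longrightarrow> torsion G x"
    and d: "(derived G ^^ d) (carrier G) \<subseteq> {\<one>}"
  shows "loc_finite G (verbal_in G (carrier G) v)"
proof (rule loc_finite_verbal_reduction[OF v t])
  fix N assume N: "N \<lhd> G" and tv: "torsion_values (G Mod N) v s"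
  interpret N: normal N G by (rule N)
  let ?Q = "G Mod N" and ?h = "\<lambda>x. N #> x"
  interpret h: group_hom G ?Q ?h by (rule N.quotient_group_hom)
  have "(derived ?Q ^^ d) (?h ` carrier G) \<subseteq> {\<one>\<^bsub>?Q\<^esub>}"
    using h.exp_of_derived_img[OF order_refl, of d] d h.hom_one by auto
  then have "(derived ?Q ^^ d) (carrier ?Q) \<subseteq> {\<one>\<^bsub>?Q\<^esub>}" by (simp add: carrier_FactGroup)
  then show "verbal_in ?Q (carrier ?Q) v = {\<one>\<^bsub>?Q\<^esub>}"
    by (rule torsion_values.verbal_trivial_if_soluble[OF tv])
qed

text \<open>\<open>L\<close> is treated as a group of its own, with its own locally finite
  radical.\<close>

lemma loc_finite_verbal_in_soluble_subgroup:
  assumes v: "multilinear_commutator_word s v" and L: "subgroup L G"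
    and t: "\<And>x. x \<in> values_in G L v \<Longrightarrow> torsion G x" and d: "(derived G ^^ d) L \<subseteq> {\<one>}"
  shows "loc_finite G (verbal_in G L v)"
proof -
  let ?R = "G\<lparr>carrier := L\<rparr>"
  interpret i: group_hom ?R G "\<lambda>x. x" by (rule inclusion_group_hom[OF L])
  have vals: "values_in ?R L v = values_in G L v" using i.values_in_img[of L v] by simp
  have verb: "verbal_in ?R L v = verbal_in G L v" using i.verbal_in_img[of L v] by simp
  have "torsion ?R x" if "x \<in> values_in ?R L v" for x
    using t[of x] that vals unfolding torsion_def nat_pow_consistent[symmetric] by simp
  then have lf: "loc_finite ?R (verbal_in G L v)"
    using i.G.loc_finite_verbal_soluble[OF v, of d] d verb derived_restrict[OF L order_refl, of d] by simp
  show ?thesis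
    unfolding loc_finite_def
  proof (intro conjI allI impI)
    show "subgroup (verbal_in G L v) G"
      using normalisesD(2)[OF normalises_verbal_in[OF normalises_self[OF L]]] .
    fix S assume S: "finite S" "S \<subseteq> verbal_in G L v"
    have "S \<subseteq> L" using S(2) verbal_in_subset[OF L] by blast
    then show "finite (generate G S)"
      using lf S generate_consistent[OF _ L] unfolding loc_finite_def by auto
  qed
qed

end

section \<open>Locally soluble factors and the end of the series argument\<close>

context torsion_values
begin

text \<open>Finitely generated subgroups \<open>?L\<close> of \<open>K\<close> are soluble, so each
  \<open>v(L)\<close> is locally finite by the soluble case, and with them \<open>v(K)\<close>. As
  \<open>K\<close> is normal in \<open>H\<close>, \<open>v(K)\<close> is trivial; then
  \<open>K\<close> itself is soluble.\<close>

lemma loc_soluble_over_subset_Z: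
  assumes K: "normalises G H K" "K \<subseteq> H" and A: "A \<subseteq> Z" "loc_soluble_over G A K"
  shows "K \<subseteq> Z"
proof -
  have sK: "subgroup K G" using normalisesD(2)[OF K(1)] .
  have KG: "K \<subseteq> carrier G" using subgroup.subset[OF sK] .
  have tK: "torsion G x" if "x \<in> values_in G K v" for x
    using that torsion_values KG unfolding values_in_def by blast
  have "loc_finite G (verbal_in G K v)"
    unfolding loc_finite_def
  proof (intro conjI allI impI)
    show "subgroup (verbal_in G K v) G"
      using normalisesD(2)[OF normalises_verbal_in[OF normalises_self[OF sK]]] .
    fix S assume S: "finite S" "S \<subseteq> verbal_in G K v"
    obtain F where F: "finite F" "F \<subseteq> values_in G K v" "S \<subseteq> generate G F"
      using generate_finite_support_set[OF S[unfolded verbal_in_def]] by blast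
    obtain T where T: "finite T" "T \<subseteq> K" "F \<subseteq> values_in G (generate G T) v"
      using finite_subset_values_in[OF F(1,2) sK] by blast
    let ?L = "generate G T"
    have TG: "T \<subseteq> carrier G" using T(2) KG by blast
    have sL: "subgroup ?L G" using generate_is_subgroup[OF TG] .
    have LK: "?L \<subseteq> K" using generate_subgroup_incl[OF T(2) sK] .
    obtain d where d: "(derived G ^^ d) ?L \<subseteq> A" using A(2) T by (auto simp: loc_soluble_over_def)
    have "(derived G ^^ d) ?L \<subseteq> H" using exp_of_derived_subset[OF sL, of d] LK K(2) by blast
    \<comment> \<open>The derived term lies in the centre of \<open>H\<close>, so one more
      derivation makes it trivial.\<close>
    then have "derived G ((derived G ^^ d) ?L) \<subseteq> {\<one>}"
      using d A(1) unfolding Z_def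
      by (intro derived_subset_iff[OF exp_of_derived_is_subgroup[OF sL] triv_subgroup]) blast
    then have "(derived G ^^ Suc d) ?L \<subseteq> {\<one>}" by simp
    moreover have "torsion G x" if "x \<in> values_in G ?L v" for x
      using that tK LK unfolding values_in_def by blast
    ultimately have "loc_finite G (verbal_in G ?L v)"
      using loc_finite_verbal_in_soluble_subgroup[OF multilinear sL] by blast
    moreover have "S \<subseteq> verbal_in G ?L v"
      using F(3) mono_generate[OF T(3)] unfolding verbal_in_def by blast
    ultimately show "finite (generate G S)" using S(1) by (simp add: loc_finite_def)
  qed
  moreover have "verbal_in G K v \<subseteq> H" using verbal_in_subset[OF sK] K(2) by blast
  ultimately have "verbal_in G K v = {\<one>}"
    using no_loc_finite normalises_verbal_in[OF K(1)] by blast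
  then show ?thesis
    using exp_of_derived_subset_verbal[OF sK multilinear] normal_soluble_subset_Z[OF K] by auto
qed

lemma verbal_trivial_if_hyper:
  assumes "hyper_loc_finite_or_soluble G H"
  shows "H = {\<one>}"
proof (rule verbal_trivial_if_central, rule ccontr)
  assume "\<not> H \<subseteq> Z"
  moreover have "\<one> \<in> Z" using subgroup.one_closed[OF normalisesD(2)[OF normalises_Z]] .
  ultimately obtain A B where AB: "normalises G H A" "normalises G H B" "B \<subseteq> H" "A \<subseteq> Z"
      "\<not> B \<subseteq> Z" "loc_finite_over G A B \<or> loc_soluble_over G A B"
    using assms unfolding hyper_loc_finite_or_soluble_def by meson
  then show False
    using loc_finite_over_subset_Z[OF AB(2,3) normalisesD(2)[OF AB(1)] AB(4)]
      loc_soluble_over_subset_Z[OF AB(2-4)] by blast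
qed

end

theorem (in group) loc_finite_verbal:
  assumes v: "multilinear_commutator_word s v"
    and t: "\<And>x. x \<in> values_in G (carrier G) v \<Longrightarrow> torsion G x"
    and hp: "hyper_loc_finite_or_soluble G (verbal_in G (carrier G) v)"
  shows "loc_finite G (verbal_in G (carrier G) v)"
proof (rule loc_finite_verbal_reduction[OF v t])
  fix N assume N: "N \<lhd> G" and tv: "torsion_values (G Mod N) v s"
  interpret N: normal N G by (rule N)
  let ?Q = "G Mod N" and ?h = "\<lambda>x. N #> x"
  interpret h: group_hom G ?Q ?h by (rule N.quotient_group_hom)
  have "verbal_in ?Q (carrier ?Q) v = ?h ` verbal_in G (carrier G) v"
    using h.verbal_in_img[OF order_refl] by (simp add: carrier_FactGroup)
  then show "verbal_in ?Q (carrier ?Q) v = {\<one>\<^bsub>?Q\<^esub>}"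
    using torsion_values.verbal_trivial_if_hyper[OF tv] h.hyper_loc_finite_or_soluble_img[OF hp] by simp
qed

section \<open>The class of groups\<close>

lemma word_values_eq: "word_values G w = values_in G (carrier G) w"
  by (simp add: word_values_def values_in_def)

lemma verbal_subgroup_eq: "verbal_subgroup G v = verbal_in G (carrier G) v"
  by (simp add: verbal_subgroup_def verbal_in_def word_values_eq)

context group
begin

lemma word_eval_pow_word:
  "(\<And>i. f i \<in> carrier G) \<Longrightarrow> word_eval G f (pow_word w m) = word_eval G f w [^] m"
  by (induction m) auto

lemma subgroup_lower_central: "subgroup (lower_central G k) G"
proof (induction k)
  case 0
  show ?case using subgroup_self by simp
next
  case (Suc k)
  show ?case
    using subgroup.mem_carrier[OF Suc] by (auto intro!: generate_is_subgroup)
qed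

lemma nilpotent_over_imp_nilpotent:
  assumes "nilpotent_over G (carrier G) {\<one>}"
  shows "nilpotent G"
proof -
  let ?U = "upper_central_over G (carrier G) {\<one>}"
  obtain c where c: "carrier G \<subseteq> ?U c" using assms by (auto simp: nilpotent_over_def)
  have sU: "subgroup (?U k) G" for k
    using upper_central_over_normal(1)[OF normalises_one[OF subgroup_self]] normalisesD(2) by blast
  have "j \<le> c \<Longrightarrow> lower_central G j \<subseteq> ?U (c - j)" for j
  proof (induction j)
    case 0
    then show ?case using c by simp
  next
    case (Suc j)
    then have "c - j = Suc (c - Suc j)" by auto
    then have "lower_central G j \<subseteq> ?U (Suc (c - Suc j))" using Suc by auto
    then have "{group_comm G x y |x y. x \<in> lower_central G j \<and> y \<in> carrier G} \<subseteq> ?U (c - Suc j)"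
      by auto
    then show ?case using generate_subgroup_incl[OF _ sU] by simp
  qed
  from this[of c] have "lower_central G c = {\<one>}"
    using subgroup.one_closed[OF subgroup_lower_central] by auto
  then show ?thesis unfolding nilpotent_def by blast
qed

lemma nilpotent_imp_solvable:
  assumes "nilpotent G"
  shows "solvable G"
proof -
  obtain c where c: "lower_central G c = {\<one>}" using assms by (auto simp: nilpotent_def)
  have "(derived G ^^ k) (carrier G) \<subseteq> lower_central G k" for k
  proof (induction k)
    case (Suc k)
    have sD: "subgroup ((derived G ^^ k) (carrier G)) G"
      by (rule exp_of_derived_is_subgroup[OF subgroup_self])
    have "derived G ((derived G ^^ k) (carrier G)) \<subseteq> lower_central G (Suc k)"
    proof (rule derived_subset_iff[OF sD subgroup_lower_central])
      fix x y assume "x \<in> (derived G ^^ k) (carrier G)" "y \<in> (derived G ^^ k) (carrier G)"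
      then have "x \<in> lower_central G k" "y \<in> carrier G"
        using Suc subgroup.mem_carrier[OF sD] by auto
      then show "group_comm G x y \<in> lower_central G (Suc k)" by (auto intro: generate.incl)
    qed
    then show ?case by simp
  qed simp
  from this[of c] have "(derived G ^^ c) (carrier G) = {\<one>}"
    using c subgroup.one_closed[OF exp_of_derived_is_subgroup[OF subgroup_self]] by auto
  then show ?thesis using solvable_iff_trivial_derived_seq by blast
qed

lemma nilpotent_restrict:
  assumes L: "subgroup L G" and n: "nilpotent_over G L {\<one>}"
  shows "nilpotent (G\<lparr>carrier := L\<rparr>)"
proof -
  let ?R = "G\<lparr>carrier := L\<rparr>"
  interpret i: group_hom ?R G "\<lambda>x. x" by (rule inclusion_group_hom[OF L])
  have gen: "generate ?R L = L" using i.G.generate_of_subgroup[OF i.G.subgroup_self] by simp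
  have "kernel ?R G (\<lambda>x. x) \<inter> L = {\<one>}" using subgroup.one_closed[OF L] by (auto simp: kernel_def)
  then have "nilpotent_over ?R L {\<one>}"
    using i.nilpotent_over_img_iff[of L] n gen by (simp add: Int_commute)
  then show ?thesis using i.G.nilpotent_over_imp_nilpotent by simp
qed

lemma solvable_restrict_iff:
  assumes "subgroup L G"
  shows "solvable (G\<lparr>carrier := L\<rparr>) \<longleftrightarrow> (\<exists>d. (derived G ^^ d) L = {\<one>})"
  using group.solvable_iff_trivial_derived_seq[OF subgroup_imp_group[OF assms]]
    derived_restrict[OF assms order_refl] by simp

end

section \<open>Translation between the series and the relative local conditions\<close>

lemma (in group) loc_over_of_quotient:
  assumes B: "subgroup B G" and A: "normalises G B A" "A \<subseteq> B"
    and q: "locally_soluble (G\<lparr>carrier := B\<rparr> Mod A) \<or> locally_finite (G\<lparr>carrier := B\<rparr> Mod A)"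
  shows "loc_finite_over G A B \<or> loc_soluble_over G A B"
proof -
  let ?R = "G\<lparr>carrier := B\<rparr>"
  interpret i: group_hom ?R G "\<lambda>x. x" by (rule inclusion_group_hom[OF B])
  have nA: "A \<lhd> ?R"
    using normalises_restrict_iff[OF B order_refl A(2)] A(1) i.G.normalises_carrier_iff by simp
  interpret A: normal A ?R by (rule nA)
  let ?Q = "?R Mod A" and ?h = "\<lambda>x. A #>\<^bsub>?R\<^esub> x"
  interpret h: group_hom ?R ?Q ?h by (rule A.quotient_group_hom)
  have hS: "finite (?h ` S)" "?h ` S \<subseteq> carrier ?Q" "generate ?Q (?h ` S) = ?h ` generate ?R S"
    "generate ?R S \<subseteq> B" if "finite S" "S \<subseteq> B" for S
    using that h.generate_img[of S] i.G.generate_incl[of S] by (auto simp: carrier_FactGroup)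
  have "loc_finite_over ?R A B \<or> loc_soluble_over ?R A B"
    using q
  proof
    assume s: "locally_soluble ?Q"
    have "loc_soluble_over ?R A B"
      unfolding loc_soluble_over_def
    proof (intro allI impI)
      fix S assume S: "finite S" "S \<subseteq> B"
      have "solvable (?Q\<lparr>carrier := generate ?Q (?h ` S)\<rparr>)"
        using s hS(1,2)[OF S] by (simp add: locally_soluble_def locally_has_def)
      then obtain d where "(derived ?Q ^^ d) (generate ?Q (?h ` S)) = {\<one>\<^bsub>?Q\<^esub>}"
        using h.H.solvable_restrict_iff h.H.generate_is_subgroup[OF hS(2)[OF S]] by blast
      then have "?h ` ((derived ?R ^^ d) (generate ?R S)) = {\<one>\<^bsub>?Q\<^esub>}"
        using h.exp_of_derived_img hS(3,4)[OF S] by simp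
      moreover have "(derived ?R ^^ d) (generate ?R S) \<subseteq> B"
        using i.G.exp_of_derived_in_carrier hS(4)[OF S] by simp
      ultimately have "(derived ?R ^^ d) (generate ?R S) \<subseteq> kernel ?R ?Q ?h"
        unfolding kernel_def by auto
      then show "\<exists>d. (derived ?R ^^ d) (generate ?R S) \<subseteq> A" using A.quotient_kernel by auto
    qed
    then show ?thesis by blast
  next
    assume f: "locally_finite ?Q"
    have "loc_finite_over ?R A B"
      unfolding loc_finite_over_def
    proof (intro allI impI)
      fix S assume S: "finite S" "S \<subseteq> B"
      have "finite (generate ?Q (?h ` S))"
        using f hS(1,2)[OF S] by (simp add: locally_finite_def locally_has_def)
      then show "finite_over ?R A (generate ?R S)"
        using i.G.loc_finite_over_of_finite_img[OF nA] hS(3,4)[OF S] by simp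
    qed
    then show ?thesis by blast
  qed
  then show ?thesis
    using i.loc_finite_over_img[of A B] i.loc_soluble_over_img[of A B] by auto
qed

text \<open>The least index whose member leaves \<open>M\<close> is not the least of all, since
  \<open>\<one> \<in> M\<close>, and not a limit, since a union of subsets of \<open>M\<close> is
  inside \<open>M\<close>.\<close>

lemma ascending_normal_series_imp_hyper_loc_finite_or_soluble:
  fixes G :: "'a monoid" (structure)
  assumes G: "group G" and H: "subgroup H G"
    and s: "ascending_normal_series (\<lambda>Q. locally_soluble Q \<or> locally_finite Q) (G\<lparr>carrier := H\<rparr>) r K"
  shows "hyper_loc_finite_or_soluble G H"
  unfolding hyper_loc_finite_or_soluble_def
proof (intro conjI allI impI H)
  interpret group G by (rule G)
  let ?R = "G\<lparr>carrier := H\<rparr>"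
  interpret R: group ?R by (rule subgroup_imp_group[OF H])
  fix M assume M: "\<one> \<in> M" "\<not> H \<subseteq> M"
  have W: "Well_order r" using s by (simp add: ascending_normal_series_def)
  have an: "antisym r" using W by (simp add: order_on_defs)
  obtain i0 where i0: "least_in r i0" "K i0 = {\<one>}"
    using s by (auto simp: ascending_normal_series_def)
  obtain i1 where i1: "greatest_in r i1" "K i1 = H"
    using s by (auto simp: ascending_normal_series_def)
  have "{i \<in> Field r. \<not> K i \<subseteq> M} \<noteq> {}" using i1 M by (auto simp: greatest_in_def)
  then obtain i where i: "i \<in> Field r" "\<not> K i \<subseteq> M"
    and least: "\<And>j. j \<in> Field r \<Longrightarrow> \<not> K j \<subseteq> M \<Longrightarrow> (i, j) \<in> r"
    using Well_order_least[OF W, of "{i \<in> Field r. \<not> K i \<subseteq> M}"] by blast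
  have below: "K j \<subseteq> M" if "(j, i) \<in> r" "j \<noteq> i" for j
    using least[of j] that an by (auto simp: Field_def dest: antisymD)
  have "i \<noteq> i0" using i(2) i0(2) M(1) by auto
  then have "\<not> least_in r i"
    using i0(1) an by (auto simp: least_in_def dest: antisymD)
  moreover have "\<not> limit_in r i"
  proof
    assume "limit_in r i"
    then have "K i = (\<Union>j\<in>underS r i. K j)" using s by (auto simp: ascending_normal_series_def)
    then show False using i(2) below by (auto simp: underS_def)
  qed
  ultimately obtain j where j: "covers r j i" using i(1) by (auto simp: limit_in_def)
  have ji: "(j, i) \<in> r" "j \<noteq> i" using j by (auto simp: covers_def)
  have n: "K i \<lhd> ?R" "K j \<lhd> ?R"
    using s i(1) ji(1) by (auto simp: ascending_normal_series_def Field_def)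
  have KK: "K j \<subseteq> K i"
    and q: "locally_soluble (?R\<lparr>carrier := K i\<rparr> Mod K j) \<or> locally_finite (?R\<lparr>carrier := K i\<rparr> Mod K j)"
    using s j unfolding ascending_normal_series_def by blast+
  have KH: "K i \<subseteq> H" using R.normalisesD(2) n(1) R.normalises_carrier_iff subgroup.subset by fastforce
  have nG: "normalises G H (K i)" "normalises G H (K j)"
    using n normalises_restrict_iff[OF H order_refl] KH KK R.normalises_carrier_iff by auto
  have sKi: "subgroup (K i) G" using normalisesD(2)[OF nG(1)] .
  have "loc_finite_over G (K j) (K i) \<or> loc_soluble_over G (K j) (K i)"
    using loc_over_of_quotient[OF sKi normalises_subgroup[OF nG(2) sKi KH] KK] q by simp
  then show "\<exists>A B. normalises G H A \<and> normalises G H B \<and> A \<subseteq> B \<and> B \<subseteq> H \<and> A \<subseteq> M \<and> \<not> B \<subseteq> M \<and>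
      (loc_finite_over G A B \<or> loc_soluble_over G A B)"
    using nG KK KH below[OF ji] i(2) by blast
qed

text \<open>A quotient is treated because the bottom factor of the series below is \<open>N\<close>
  modulo the trivial subgroup, whose elements are cosets.\<close>

lemma locally_nilpotent_imp_quotient_locally_soluble:
  fixes G :: "'a monoid"
  assumes G: "group G" and ln: "locally_nilpotent G" and N: "N \<lhd> G"
  shows "locally_soluble (G Mod N)"
  unfolding locally_soluble_def locally_has_def
proof (intro allI impI)
  interpret group G by (rule G)
  interpret N: normal N G by (rule N)
  let ?Q = "G Mod N" and ?h = "\<lambda>x. N #>\<^bsub>G\<^esub> x"
  interpret h: group_hom G ?Q ?h by (rule N.quotient_group_hom)
  fix S' assume S': "finite S' \<and> S' \<subseteq> carrier ?Q"
  then have S'h: "finite S'" "S' \<subseteq> ?h ` carrier G" by (auto simp: carrier_FactGroup)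
  obtain S where S: "S \<subseteq> carrier G" "finite S" "S' = ?h ` S"
    using finite_subset_image[OF S'h] by blast
  have sS: "subgroup (generate G S) G" using generate_is_subgroup[OF S(1)] .
  have "nilpotent (G\<lparr>carrier := generate G S\<rparr>)"
    using ln S by (simp add: locally_nilpotent_def locally_has_def)
  then have "solvable (G\<lparr>carrier := generate G S\<rparr>)"
    using group.nilpotent_imp_solvable[OF subgroup_imp_group[OF sS]] by blast
  then obtain d where d: "(derived G ^^ d) (generate G S) = {\<one>\<^bsub>G\<^esub>}"
    using solvable_restrict_iff[OF sS] by blast
  have "generate ?Q S' = ?h ` generate G S" using h.generate_img[OF S(1)] S(3) by simp
  then have "(derived ?Q ^^ d) (generate ?Q S') = {\<one>\<^bsub>?Q\<^esub>}"
    using h.exp_of_derived_img[OF generate_incl[OF S(1)], of d] d h.hom_one by simp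
  moreover have "subgroup (generate ?Q S') ?Q" using S' by (intro h.H.generate_is_subgroup) simp
  ultimately show "solvable (?Q\<lparr>carrier := generate ?Q S'\<rparr>)"
    using h.H.solvable_restrict_iff by blast
qed

lemma locally_nilpotent_by_locally_finite_imp_series:
  fixes G :: "'a monoid" (structure)
  assumes G: "group G" and lf: "locally_nilpotent_by_locally_finite G"
  shows "has_ascending_normal_series (\<lambda>Q. locally_soluble Q \<or> locally_finite Q) G"
proof -
  interpret group G by (rule G)
  obtain N where N: "N \<lhd> G" "locally_nilpotent (G\<lparr>carrier := N\<rparr>)" "locally_finite (G Mod N)"
    using lf by (auto simp: locally_nilpotent_by_locally_finite_def)
  have sN: "subgroup N G" using N(1) by (rule normal_imp_subgroup)
  interpret R: group "G\<lparr>carrier := N\<rparr>" by (rule subgroup_imp_group[OF sN])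
  \<comment> \<open>The three-term series from \<open>\<one>\<close> through \<open>N\<close> to
    \<open>G\<close> on the ordinals 0, 1, 2, which include no limit;
    \<open>has_ascending_normal_seriesI\<close> changes the index type at the end.\<close>
  define r where "r = {(i, j). i \<le> j \<and> j \<le> (2::nat)}"
  define K where "K i = (if i = 0 then {\<one>} else if i = 1 then N else carrier G)" for i :: nat
  have F: "Field r = {..2}" by (force simp: r_def Field_def)
  have lin: "Linear_order r"
    unfolding order_on_defs F
    by (auto simp: r_def refl_on_def trans_def antisym_def total_on_def)
  have W: "Well_order r"
    unfolding Linear_order_Well_order_iff[OF lin]
  proof (intro allI impI)
    fix A assume A: "A \<subseteq> Field r" "A \<noteq> {}"
    then have "(LEAST a. a \<in> A) \<in> A" by (metis LeastI ex_in_conv)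
    then show "\<exists>a\<in>A. \<forall>a'\<in>A. (a, a') \<in> r"
      using A Least_le[of "\<lambda>a. a \<in> A"] unfolding F by (intro bexI[of _ "LEAST a. a \<in> A"]) (auto simp: r_def)
  qed
  have least: "least_in r 0" unfolding least_in_def F by (auto simp: r_def)
  have greatest: "greatest_in r 2" unfolding greatest_in_def F by (auto simp: r_def)
  have cov: "covers r i j \<longleftrightarrow> j = Suc i \<and> j \<le> 2" for i j
  proof
    assume c: "covers r i j"
    then have ij: "i \<le> j" "i \<noteq> j" "j \<le> 2" by (auto simp: covers_def r_def)
    then have "(i, Suc i) \<in> r" "(Suc i, j) \<in> r" by (auto simp: r_def)
    then have "Suc i = i \<or> Suc i = j" using c unfolding covers_def by blast
    then show "j = Suc i \<and> j \<le> 2" using ij by auto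
  qed (auto simp: covers_def r_def)
  have nolim: "\<not> limit_in r i" for i
  proof
    assume l: "limit_in r i"
    then have "i \<noteq> 0" using least unfolding limit_in_def by metis
    then obtain k where "i = Suc k" using not0_implies_Suc by blast
    moreover have "i \<le> 2" using l F by (auto simp: limit_in_def)
    ultimately have "covers r k i" using cov by auto
    then show False using l by (auto simp: limit_in_def)
  qed
  have one_normal: "{\<one>} \<lhd> G\<lparr>carrier := N\<rparr>" using R.one_is_normal by simp
  have quo: "locally_soluble (G\<lparr>carrier := K j\<rparr> Mod K i) \<or> locally_finite (G\<lparr>carrier := K j\<rparr> Mod K i)"
    if "covers r i j" for i j
  proof -
    have "i = 0 \<and> j = 1 \<or> i = 1 \<and> j = 2" using that cov by auto
    then show ?thesis
    proof
      assume "i = 0 \<and> j = 1"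
      then show ?thesis
        using locally_nilpotent_imp_quotient_locally_soluble[OF R.is_group N(2) one_normal]
        by (simp add: K_def)
    next
      assume "i = 1 \<and> j = 2"
      then show ?thesis using N(3) by (simp add: K_def)
    qed
  qed
  have "ascending_normal_series (\<lambda>Q. locally_soluble Q \<or> locally_finite Q) G r K"
    unfolding ascending_normal_series_def
  proof (intro conjI)
    show "Well_order r" by (rule W)
    show "\<forall>i. limit_in r i \<longrightarrow> K i = (\<Union>j\<in>underS r i. K j)" using nolim by blast
    show "\<forall>i j. covers r i j \<longrightarrow> locally_soluble (G\<lparr>carrier := K j\<rparr> Mod K i) \<or>
        locally_finite (G\<lparr>carrier := K j\<rparr> Mod K i)" using quo by blast
    show "\<forall>i\<in>Field r. K i \<lhd> G"
      using N(1) one_is_normal normal_of_normalises[OF normalises_self[OF subgroup_self]]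
      by (simp add: K_def)
    show "\<exists>i. least_in r i \<and> K i = {\<one>}" 
      using least by (intro exI[of _ 0]) (simp add: K_def)
    show "\<exists>i. greatest_in r i \<and> K i = carrier G" 
      using greatest by (intro exI[of _ 2]) (simp add: K_def)
    show "\<forall>i j. covers r i j \<longrightarrow> K i \<subseteq> K j"
    proof (intro allI impI)
      fix i j assume "covers r i j"
      then have "i = 0 \<and> j = 1 \<or> i = 1 \<and> j = 2" using cov by auto
      then show "K i \<subseteq> K j"
        using subgroup.one_closed[OF sN] subgroup.subset[OF sN] by (auto simp: K_def)
    qed
  qed
  then show ?thesis by (rule has_ascending_normal_seriesI)
qed

lemma engel_series_imp_locally_nilpotent_by_locally_finite:
  fixes G :: "'a monoid" (structure)
  assumes G: "group G" and m: "m > 0" and v: "multilinear_commutator_word s v"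
    and e: "\<And>x. x \<in> word_values G (pow_word v m) \<Longrightarrow> engel_element G n x"
    and ser: "has_ascending_normal_series (\<lambda>Q. locally_soluble Q \<or> locally_finite Q)
      (G\<lparr>carrier := verbal_subgroup G v\<rparr>)"
  shows "locally_nilpotent_by_locally_finite (G\<lparr>carrier := verbal_subgroup G v\<rparr>)"
proof -
  interpret group G by (rule G)
  define H where "H = verbal_in G (carrier G) v"
  let ?R = "G\<lparr>carrier := H\<rparr>"
  have HV: "verbal_subgroup G v = H" by (simp add: H_def verbal_subgroup_eq)
  have sH: "subgroup H G"
    unfolding H_def by (rule normalisesD(2)[OF normalises_verbal_in[OF normalises_self[OF subgroup_self]]])
  interpret R: group ?R by (rule subgroup_imp_group[OF sH])
  have hp: "hyper_loc_finite_or_soluble G H"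
    using ser ascending_normal_series_imp_hyper_loc_finite_or_soluble[OF G sH]
    unfolding has_ascending_normal_series_def HV by blast
  define W where "W = verbal_in G (carrier G) (pow_word v m)"
  have nW: "normalises G (carrier G) W"
    unfolding W_def by (rule normalises_verbal_in[OF normalises_self[OF subgroup_self]])
  have sW: "subgroup W G" using normalisesD(2)[OF nW] .
  \<comment> \<open>\<open>w\<close>-values are \<open>m\<close>-th powers of
    \<open>v\<close>-values, so the series of \<open>H\<close> also governs the subgroup they
    generate.\<close>
  have E: "values_in G (carrier G) (pow_word v m) \<subseteq> H"
  proof
    fix x assume "x \<in> values_in G (carrier G) (pow_word v m)"
    then obtain f where f: "\<And>i. f i \<in> carrier G" "x = word_eval G f (pow_word v m)"
      by (auto simp: values_in_def)
    have "word_eval G f v \<in> H"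
      unfolding H_def verbal_in_def values_in_def using f(1) by (intro generate.incl) blast
    then have "word_eval G f v [^] m \<in> H"
      by (induction m) (auto simp: subgroup.one_closed[OF sH] subgroup.m_closed[OF sH])
    then show "x \<in> H" using f word_eval_pow_word by simp
  qed
  have lnW: "loc_nilpotent G W"
    unfolding W_def verbal_in_def
    using engel_generated_loc_nilpotent[OF hp E, of n] e by (simp add: word_values_eq)
  have WH: "W \<subseteq> H" unfolding W_def verbal_in_def by (rule generate_subgroup_incl[OF E sH])
  have W: "W \<lhd> G" by (rule normal_of_normalises[OF nW])
  have WR: "W \<lhd> ?R"
    using normalises_restrict_iff[OF sH order_refl WH]
      normalises_subgroup[OF nW sH subgroup.subset[OF sH]] R.normalises_carrier_iff by simp
  have "locally_nilpotent (?R\<lparr>carrier := W\<rparr>)"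
    unfolding locally_nilpotent_def locally_has_def
  proof (intro allI impI)
    fix S assume "finite S \<and> S \<subseteq> carrier (?R\<lparr>carrier := W\<rparr>)"
    then have S: "finite S" "S \<subseteq> W" by auto
    have SG: "S \<subseteq> carrier G" using S(2) subgroup.subset[OF sW] by blast
    have "nilpotent (G\<lparr>carrier := generate G S\<rparr>)"
      using nilpotent_restrict[OF generate_is_subgroup[OF SG]] lnW S by (simp add: loc_nilpotent_def)
    then show "nilpotent (?R\<lparr>carrier := W\<rparr>\<lparr>carrier := generate (?R\<lparr>carrier := W\<rparr>) S\<rparr>)"
      using generate_consistent[OF S(2) sW] by simp
  qed
  moreover have "locally_finite (?R Mod W)"
  proof -
    \<comment> \<open>The quotient of all of \<open>G\<close> is formed, since the
      \<open>v\<close>-values that generate \<open>H\<close> have entries from all of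
      \<open>G\<close>; only afterwards is the factor group of \<open>H\<close> found inside
      it.\<close>
    interpret W: normal W G by (rule W)
    let ?Q = "G Mod W" and ?h = "\<lambda>x. W #> x"
    interpret h: group_hom G ?Q ?h by (rule W.quotient_group_hom)
    have hQ: "carrier ?Q = ?h ` carrier G" by (rule carrier_FactGroup)
    have hH: "verbal_in ?Q (carrier ?Q) v = ?h ` H"
      unfolding hQ H_def by (rule h.verbal_in_img[OF order_refl])
    have "torsion ?Q y" if "y \<in> values_in ?Q (carrier ?Q) v" for y
    proof -
      have "y \<in> ?h ` values_in G (carrier G) v"
        using that unfolding hQ h.values_in_img[OF order_refl] .
      then obtain f where f: "\<And>i. f i \<in> carrier G" "y = ?h (word_eval G f v)"
        by (auto simp: values_in_def)
      have "word_eval G f (pow_word v m) \<in> W"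
        unfolding W_def verbal_in_def values_in_def using f(1) by (intro generate.incl) blast
      then have "word_eval G f v [^] m \<in> kernel G ?Q ?h"
        using W.quotient_kernel f(1) word_eval_pow_word by simp
      then have "y [^]\<^bsub>?Q\<^esub> m = \<one>\<^bsub>?Q\<^esub>"
        using h.hom_nat_pow[of "word_eval G f v" m] word_eval_closed[of f v] f
        unfolding kernel_def by simp
      then show ?thesis using m by (auto simp: torsion_def)
    qed
    then have lf: "loc_finite ?Q (?h ` H)"
      using h.H.loc_finite_verbal[OF v] h.hyper_loc_finite_or_soluble_img[OF hp] hH by simp
    have sQ: "subgroup (?h ` H) ?Q" using lf by (simp add: loc_finite_def)
    \<comment> \<open>Cosets are multiplied as sets, and this product is the same in
      \<open>G\<close> as in its restriction to \<open>H\<close>.\<close>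
    have eq: "?R Mod W = ?Q\<lparr>carrier := ?h ` H\<rparr>"
    proof -
      have "set_mult ?R = set_mult G" by (intro ext) (simp add: set_mult_def)
      then show ?thesis using carrier_FactGroup[of ?R W] by (simp add: FactGroup_def)
    qed
    show ?thesis
      unfolding locally_finite_def locally_has_def eq
    proof (intro allI impI)
      fix S assume "finite S \<and> S \<subseteq> carrier (?Q\<lparr>carrier := ?h ` H\<rparr>)"
      then have S: "finite S" "S \<subseteq> ?h ` H" by auto
      then show "finite (carrier (?Q\<lparr>carrier := ?h ` H\<rparr>
          \<lparr>carrier := generate (?Q\<lparr>carrier := ?h ` H\<rparr>) S\<rparr>))"
        using lf h.H.generate_consistent[OF S(2) sQ] by (simp add: loc_finite_def)
    qed
  qed
  ultimately show ?thesis
    unfolding locally_nilpotent_by_locally_finite_def HV using WR by blast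
qed

theorem mainTheorem4:
  fixes m n s :: nat and v :: group_word
  assumes "primepow m" and "n \<ge> 1" and "multilinear_commutator_word s v"
  shows "(engel_series_class m n v :: 'a monoid set) =
    {G. group G \<and>
        (\<forall>x\<in>word_values G (pow_word v m). engel_element G n x) \<and>
        locally_nilpotent_by_locally_finite (G\<lparr>carrier := verbal_subgroup G v\<rparr>)}"
proof -
  have m: "m > 0" using assms(1) by (auto simp: primepow_def prime_gt_0_nat)
  have "group (G\<lparr>carrier := verbal_subgroup G v\<rparr>)" if "group G" for G :: "'a monoid"
  proof -
    interpret group G by (rule that)
    have "subgroup (verbal_subgroup G v) G"
      unfolding verbal_subgroup_eq
      by (rule normalisesD(2)[OF normalises_verbal_in[OF normalises_self[OF subgroup_self]]])
    then show ?thesis by (rule subgroup_imp_group)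
  qed
  then show ?thesis
    unfolding engel_series_class_def
    using engel_series_imp_locally_nilpotent_by_locally_finite[OF _ m assms(3), of _ n]
      locally_nilpotent_by_locally_finite_imp_series
    by (intro Collect_cong) blast
qed

end
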